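(* (1) The algebra $u_k(2,r)$ is semisimple for $l>r$. (2) The blocks $\mathfrak B_1^r(\overline\lambda)$ with $\overline\lambda\in\overline{\mathrm{St}}\cup\overline{\boldsymbol{\mathcal I}}$ are precisely all the semisimple blocks of $u_k(2,r)$. (3) Assume $l\leq r$. Then the blocks $\mathfrak B_1^r(\overline\lambda)$ with $\overline\lambda\in\overline{\boldsymbol{\mathcal J}}$ are precisely all the non-semisimple blocks of $u_k(2,r)$.
   Context: Setting. $k$ is a field containing a primitive $l$-th root of unity $\varepsilon$, with $l\geq 3$ odd; $r\geq1$ is an integer. Let $\mathbf U(2)$ be the quantum enveloping algebra of $\mathfrak{gl}_2$ over $\mathbb Q(\upsilon)$, generated by $E,F,K_1^{\pm1},K_2^{\pm1}$ with relations $K_1K_2=K_2K_1$, $K_iK_i^{-1}=1$, $K_1E=\upsilon EK_1$, $K_2E=\upsilon^{-1}EK_2$, $K_1F=\upsilon^{-1}FK_1$, $K_2F=\upsilon FK_2$, $EF-FE=\frac{K-K^{-1}}{\upsilon-\upsilon^{-1}}$ where $K=K_1K_2^{-1}$; its comultiplication is $\Delta(E)=E\otimes K+1\otimes E$, $\Delta(F)=F\otimes1+K^{-1}\otimes F$, $\Delta(K_i)=K_i\otimes K_i$. Put $\mathcal Z=\mathbb Z[\upsilon,\upsilon^{-1}]$, $[i]=\frac{\upsilon^i-\upsilon^{-i}}{\upsilon-\upsilon^{-1}}$, $[m]^!=[1]\cdots[m]$. $U_{\mathcal Z}(2)$ is the $\mathcal Z$-subalgebra generated by all $E^{(m)}=E^m/[m]^!$,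 $F^{(m)}=F^m/[m]^!$, $K_i^{\pm1}$ and $\left[{K_i;0\atop t}\right]=\prod_{s=1}^t\frac{K_i\upsilon^{-s+1}-K_i^{-1}\upsilon^{s-1}}{\upsilon^s-\upsilon^{-s}}$ ($m,t\in\mathbb N$), and $U_k(2)=U_{\mathcal Z}(2)\otimes_{\mathcal Z}k$ with $\upsilon\mapsto\varepsilon$. $\tilde u_k(2)$ is the $k$-subalgebra of $U_k(2)$ generated by $E,F,K_1^{\pm1},K_2^{\pm1}$. Let $\Omega_k$ be the $U_k(2)$-module with basis $\omega_1,\omega_2$ and $K_a\omega_b=\varepsilon^{\delta_{a,b}}\omega_b$, $E\omega_2=\omega_1$, $E\omega_1=0$, $F\omega_1=\omega_2$, $F\omega_2=0$. Via $\Delta$ one gets $\zeta_r:U_k(2)\to\mathrm{End}(\Omega_k^{\otimes r})$. The little $q$-Schur algebra is $u_k(2,r)=\zeta_r(\tilde u_k(2))$. Weights and simple modules. $P(D)=\mathbb N^2$ (with $0\in\mathbb N$), $P_1(D)=\{\lambda\in\mathbb N^2\mid 0\leq\lambda_1-\lambda_2\leq l-1,\ 0\leq\lambda_2\leq l-1\}$, $\Gamma_1^r(D)=\{\lambda\in P_1(D)+lP(D)\mid\lambda_1+\lambda_2=r\}$. For $\lambda\in\mathbb Z^2$, $\overline\lambda$ is its image in $(\mathbb Z/l\mathbb Z)^2$, and $\overline X=\{\overline\lambda\mid\lambda\in X\}$ for $X\subseteq\mathbb Z^2$. For $\lambda\in\Gamma_1^r(D)$, $L_1(\overline\lambda)$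 is the simple $u_k(2,r)$-module generated by a nonzero vector $v$ with $Ev=0$, $K_iv=\varepsilon^{\lambda_i}v$ ($i=1,2$); these (indexed by $\overline{\Gamma_1^r(D)}$) form a complete set of non-isomorphic simple $u_k(2,r)$-modules. $\mathfrak B_1^r(\overline\lambda)$ is the block of $u_k(2,r)$ containing $L_1(\overline\lambda)$. $\mathrm{St}=\{\lambda\in\Gamma_1^r(D)\mid\lambda_1-\lambda_2+1=ml\text{ for some }m\in\mathbb Z\}$. $\boldsymbol{\mathcal I}=\{(\frac{r+i}2,\frac{r-i}2)\mid 0\leq i\leq l-2,\ i<2l-r-2,\ r-i\geq0\text{ is even}\}$. $\boldsymbol{\mathcal J}=\{(\frac{r+i}2,\frac{r-i}2)\mid 0\leq i\leq l-2,\ i\geq 2l-r-2,\ r-i\text{ is even}\}$. *)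

theory Defs
  imports
    "HOL-Computational_Algebra.Fraction_Field"
    "HOL-Computational_Algebra.Polynomial"
    "Jordan_Normal_Form.Matrix"
    "HOL-Algebra.Generated_Rings"
    "HOL-Algebra.QuotRing"
begin

section \<open>Monoid algebras\<close>

text \<open>The algebra of a monoid \<open>M\<close> with coefficients in \<open>'c\<close>: finitely supported functions on
  \<open>carrier M\<close> with convolution. It is used twice: over the free monoid (free algebras) and
  over a product of two multiplicative monoids (tensor products of rings).\<close>

definition monoid_algebra :: "('a, 'm) monoid_scheme \<Rightarrow> ('a \<Rightarrow> 'c :: comm_ring_1) ring" where
  "monoid_algebra M =
    \<lparr>carrier = {f. finite {x. f x \<noteq> 0} \<and> {x. f x \<noteq> 0} \<subseteq> carrier M},
     mult = (\<lambda>f g w. \<Sum>(u, v) \<in> {(u, v). f u \<noteq> 0 \<and> g v \<noteq> 0 \<and> u \<otimes>\<^bsub>M\<^esub> v = w}. f u * g v),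
     one = (\<lambda>w. if w = \<one>\<^bsub>M\<^esub> then 1 else 0),
     zero = (\<lambda>w. 0),
     add = (\<lambda>f g w. f w + g w)\<rparr>"

definition term_of :: "'c :: zero \<Rightarrow> 'a \<Rightarrow> 'a \<Rightarrow> 'c" where
  "term_of c x = (\<lambda>y. if y = x then c else 0)"

definition free_monoid :: "'g list monoid" where
  "free_monoid = \<lparr>carrier = UNIV, mult = (@), one = []\<rparr>"

section \<open>The quantum enveloping algebra of gl(2)\<close>

type_synonym qfield = "rat poly fract"

definition \<upsilon> :: qfield where
  "\<upsilon> = Fraction_Field.Fract [:0, 1:] 1"

definition qint :: "nat \<Rightarrow> qfield" where
  "qint i = (\<upsilon> ^ i - inverse \<upsilon> ^ i) / (\<upsilon> - inverse \<upsilon>)"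

definition qfact :: "nat \<Rightarrow> qfield" where
  "qfact m = (\<Prod>i = 1..m. qint i)"

datatype gen = GE | GF | GK1 | GK2 | GK1inv | GK2inv

abbreviation FA :: "(gen list \<Rightarrow> qfield) ring" where
  "FA \<equiv> monoid_algebra free_monoid"

definition U_relators :: "(gen list \<Rightarrow> qfield) set" where
  "U_relators =
    (let x = (\<lambda>g. term_of 1 [g]); c = (\<lambda>a. term_of a []) in
     {x GK1 \<otimes>\<^bsub>FA\<^esub> x GK2 \<ominus>\<^bsub>FA\<^esub> x GK2 \<otimes>\<^bsub>FA\<^esub> x GK1,
      x GK1 \<otimes>\<^bsub>FA\<^esub> x GK1inv \<ominus>\<^bsub>FA\<^esub> \<one>\<^bsub>FA\<^esub>,
      x GK1inv \<otimes>\<^bsub>FA\<^esub> x GK1 \<ominus>\<^bsub>FA\<^esub> \<one>\<^bsub>FA\<^esub>,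
      x GK2 \<otimes>\<^bsub>FA\<^esub> x GK2inv \<ominus>\<^bsub>FA\<^esub> \<one>\<^bsub>FA\<^esub>,
      x GK2inv \<otimes>\<^bsub>FA\<^esub> x GK2 \<ominus>\<^bsub>FA\<^esub> \<one>\<^bsub>FA\<^esub>,
      x GK1 \<otimes>\<^bsub>FA\<^esub> x GE \<ominus>\<^bsub>FA\<^esub> c \<upsilon> \<otimes>\<^bsub>FA\<^esub> (x GE \<otimes>\<^bsub>FA\<^esub> x GK1),
      x GK2 \<otimes>\<^bsub>FA\<^esub> x GE \<ominus>\<^bsub>FA\<^esub> c (inverse \<upsilon>) \<otimes>\<^bsub>FA\<^esub> (x GE \<otimes>\<^bsub>FA\<^esub> x GK2),
      x GK1 \<otimes>\<^bsub>FA\<^esub> x GF \<ominus>\<^bsub>FA\<^esub> c (inverse \<upsilon>) \<otimes>\<^bsub>FA\<^esub> (x GF \<otimes>\<^bsub>FA\<^esub> x GK1),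
      x GK2 \<otimes>\<^bsub>FA\<^esub> x GF \<ominus>\<^bsub>FA\<^esub> c \<upsilon> \<otimes>\<^bsub>FA\<^esub> (x GF \<otimes>\<^bsub>FA\<^esub> x GK2),
      (x GE \<otimes>\<^bsub>FA\<^esub> x GF \<ominus>\<^bsub>FA\<^esub> x GF \<otimes>\<^bsub>FA\<^esub> x GE) \<ominus>\<^bsub>FA\<^esub>
        c (1 / (\<upsilon> - inverse \<upsilon>)) \<otimes>\<^bsub>FA\<^esub>
          (x GK1 \<otimes>\<^bsub>FA\<^esub> x GK2inv \<ominus>\<^bsub>FA\<^esub> x GK2 \<otimes>\<^bsub>FA\<^esub> x GK1inv)})"

definition Uq :: "(gen list \<Rightarrow> qfield) set ring" where
  "Uq = FA Quot (Idl\<^bsub>FA\<^esub> U_relators)"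

definition U_gen :: "gen \<Rightarrow> (gen list \<Rightarrow> qfield) set" where
  "U_gen g = (Idl\<^bsub>FA\<^esub> U_relators) +>\<^bsub>FA\<^esub> term_of 1 [g]"

definition U_scalar :: "qfield \<Rightarrow> (gen list \<Rightarrow> qfield) set" where
  "U_scalar a = (Idl\<^bsub>FA\<^esub> U_relators) +>\<^bsub>FA\<^esub> term_of a []"

definition divided_power :: "gen \<Rightarrow> nat \<Rightarrow> (gen list \<Rightarrow> qfield) set" where
  "divided_power g m = U_scalar (1 / qfact m) \<otimes>\<^bsub>Uq\<^esub> (U_gen g [^]\<^bsub>Uq\<^esub> m)"

text \<open>\<open>kbinom K K' t\<close> is the Gaussian binomial of \<open>K\<close> with shift 0, where \<open>K'\<close> is the inverse
  of \<open>K\<close>; in the step from \<open>t\<close> to \<open>Suc t\<close> the new factor has index \<open>s = Suc t\<close>.\<close>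

primrec kbinom :: "gen \<Rightarrow> gen \<Rightarrow> nat \<Rightarrow> (gen list \<Rightarrow> qfield) set" where
  "kbinom K K' 0 = \<one>\<^bsub>Uq\<^esub>"
| "kbinom K K' (Suc t) = kbinom K K' t \<otimes>\<^bsub>Uq\<^esub>
     (U_scalar (1 / (\<upsilon> ^ Suc t - inverse \<upsilon> ^ Suc t)) \<otimes>\<^bsub>Uq\<^esub>
      (U_scalar (inverse \<upsilon> ^ t) \<otimes>\<^bsub>Uq\<^esub> U_gen K \<ominus>\<^bsub>Uq\<^esub> U_scalar (\<upsilon> ^ t) \<otimes>\<^bsub>Uq\<^esub> U_gen K'))"

section \<open>The integral form and its specialisation\<close>

text \<open>The value at \<open>x\<close> of the integral Laurent polynomial given by \<open>p\<close> divided by the \<open>n\<close>-th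
  power of the indeterminate.\<close>

definition laurent_eval :: "nat \<Rightarrow> int poly \<Rightarrow> 'a :: field \<Rightarrow> 'a" where
  "laurent_eval n p x = inverse x ^ n * poly (map_poly of_int p) x"

definition UZ_carrier :: "(gen list \<Rightarrow> qfield) set set" where
  "UZ_carrier = generate_ring Uq
     ((\<lambda>(n, p). U_scalar (laurent_eval n p \<upsilon>)) ` UNIV \<union>
      range (divided_power GE) \<union> range (divided_power GF) \<union>
      {U_gen GK1, U_gen GK2, U_gen GK1inv, U_gen GK2inv} \<union>
      range (kbinom GK1 GK1inv) \<union> range (kbinom GK2 GK2inv))"

definition UZ :: "(gen list \<Rightarrow> qfield) set ring" where
  "UZ = Uq\<lparr>carrier := UZ_carrier\<rparr>"

definition field_ring :: "'k :: field ring" where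
  "field_ring = \<lparr>carrier = UNIV, mult = (*), one = 1, zero = 0, add = (+)\<rparr>"

text \<open>The ring \<open>UZ \<otimes> k\<close> over the integral Laurent polynomials, these acting on \<open>k\<close> by
  \<open>\<upsilon> \<mapsto> \<epsilon>\<close>. The additive group of \<open>TR\<close> is the free abelian group on the pairs \<open>(x, a)\<close>, and
  its multiplication extends \<open>(x, a) (y, b) = (x y, a b)\<close>. The set of relators of the tensor
  product is stable under multiplication by pairs, so the subgroup it generates is an ideal.\<close>

type_synonym 'k tr = "(gen list \<Rightarrow> qfield) set \<times> 'k \<Rightarrow> int"

definition TR :: "'k :: field tr ring" where
  "TR = monoid_algebra (UZ \<times>\<times> (field_ring :: 'k ring))"

definition tensor_relators :: "'k :: field \<Rightarrow> 'k tr set" where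
  "tensor_relators \<epsilon> =
     {term_of 1 (x \<oplus>\<^bsub>UZ\<^esub> y, a) \<ominus>\<^bsub>TR\<^esub> (term_of 1 (x, a) \<oplus>\<^bsub>TR\<^esub> term_of 1 (y, a)) | x y a.
        x \<in> carrier UZ \<and> y \<in> carrier UZ} \<union>
     {term_of 1 (x, a + b) \<ominus>\<^bsub>TR\<^esub> (term_of 1 (x, a) \<oplus>\<^bsub>TR\<^esub> term_of 1 (x, b)) | x a b.
        x \<in> carrier UZ} \<union>
     {term_of 1 (U_scalar (laurent_eval n p \<upsilon>) \<otimes>\<^bsub>UZ\<^esub> x, a)
        \<ominus>\<^bsub>TR\<^esub> term_of 1 (x, laurent_eval n p \<epsilon> * a) | n p x a. x \<in> carrier UZ}"

definition Uk :: "'k :: field \<Rightarrow> 'k tr set ring" where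
  "Uk \<epsilon> = TR Quot (Idl\<^bsub>TR\<^esub> (tensor_relators \<epsilon>))"

definition pure_tensor :: "'k :: field \<Rightarrow> (gen list \<Rightarrow> qfield) set \<Rightarrow> 'k \<Rightarrow> 'k tr set" where
  "pure_tensor \<epsilon> x a = (Idl\<^bsub>TR\<^esub> (tensor_relators \<epsilon>)) +>\<^bsub>TR\<^esub> term_of 1 (x, a)"

definition Uk_gen :: "'k :: field \<Rightarrow> gen \<Rightarrow> 'k tr set" where
  "Uk_gen \<epsilon> g = pure_tensor \<epsilon> (U_gen g) 1"

definition Uk_scalar :: "'k :: field \<Rightarrow> 'k \<Rightarrow> 'k tr set" where
  "Uk_scalar \<epsilon> a = pure_tensor \<epsilon> \<one>\<^bsub>UZ\<^esub> a"

definition small_u :: "'k :: field \<Rightarrow> 'k tr set set" where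
  "small_u \<epsilon> = generate_ring (Uk \<epsilon>) (range (Uk_scalar \<epsilon>) \<union> range (Uk_gen \<epsilon>))"

section \<open>Tensor powers of the natural module and the little q-Schur algebra\<close>

definition kron :: "'a :: semiring_0 mat \<Rightarrow> 'a mat \<Rightarrow> 'a mat" where
  "kron A B = mat (dim_row A * dim_row B) (dim_col A * dim_col B)
     (\<lambda>(i, j). A $$ (i div dim_row B, j div dim_col B) * B $$ (i mod dim_row B, j mod dim_col B))"

text \<open>The action of the generators on the natural module, in the basis
  \<open>\<omega>\<^sub>1\<close>, \<open>\<omega>\<^sub>2\<close> (matrices act on column vectors).\<close>

primrec natural_rep :: "'k :: field \<Rightarrow> gen \<Rightarrow> 'k mat" where
  "natural_rep \<epsilon> GE = mat_of_rows_list 2 [[0, 1], [0, 0]]"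
| "natural_rep \<epsilon> GF = mat_of_rows_list 2 [[0, 0], [1, 0]]"
| "natural_rep \<epsilon> GK1 = mat_of_rows_list 2 [[\<epsilon>, 0], [0, 1]]"
| "natural_rep \<epsilon> GK2 = mat_of_rows_list 2 [[1, 0], [0, \<epsilon>]]"
| "natural_rep \<epsilon> GK1inv = mat_of_rows_list 2 [[inverse \<epsilon>, 0], [0, 1]]"
| "natural_rep \<epsilon> GK2inv = mat_of_rows_list 2 [[1, 0], [0, inverse \<epsilon>]]"

text \<open>The action of the generators on the tensor product of two modules, through
  \<open>\<Delta>(E) = E \<otimes> K + 1 \<otimes> E\<close>, \<open>\<Delta>(F) = F \<otimes> 1 + K\<^sup>-\<^sup>1 \<otimes> F\<close> and \<open>\<Delta>(K\<^sub>i) = K\<^sub>i \<otimes> K\<^sub>i\<close> with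
  \<open>K = K\<^sub>1 K\<^sub>2\<^sup>-\<^sup>1\<close>.\<close>

primrec tensor_rep :: "(gen \<Rightarrow> 'k :: field mat) \<Rightarrow> (gen \<Rightarrow> 'k mat) \<Rightarrow> gen \<Rightarrow> 'k mat" where
  "tensor_rep \<rho> \<sigma> GE =
     kron (\<rho> GE) (\<sigma> GK1 * \<sigma> GK2inv) + kron (1\<^sub>m (dim_row (\<rho> GE))) (\<sigma> GE)"
| "tensor_rep \<rho> \<sigma> GF =
     kron (\<rho> GF) (1\<^sub>m (dim_row (\<sigma> GF))) + kron (\<rho> GK2 * \<rho> GK1inv) (\<sigma> GF)"
| "tensor_rep \<rho> \<sigma> GK1 = kron (\<rho> GK1) (\<sigma> GK1)"
| "tensor_rep \<rho> \<sigma> GK2 = kron (\<rho> GK2) (\<sigma> GK2)"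
| "tensor_rep \<rho> \<sigma> GK1inv = kron (\<rho> GK1inv) (\<sigma> GK1inv)"
| "tensor_rep \<rho> \<sigma> GK2inv = kron (\<rho> GK2inv) (\<sigma> GK2inv)"

text \<open>The power 0 is the trivial module given by the counit.\<close>

primrec tensor_power_rep :: "'k :: field \<Rightarrow> nat \<Rightarrow> gen \<Rightarrow> 'k mat" where
  "tensor_power_rep \<epsilon> 0 = (\<lambda>g. if g = GE \<or> g = GF then 0\<^sub>m 1 1 else 1\<^sub>m 1)"
| "tensor_power_rep \<epsilon> (Suc r) = tensor_rep (tensor_power_rep \<epsilon> r) (natural_rep \<epsilon>)"

text \<open>\<open>\<zeta>\<close> is a homomorphism of \<open>k\<close>-algebras from \<open>Uk\<close> to the endomorphisms of the \<open>r\<close>-th tensor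
  power of the natural module under which the generators act through the comultiplication.
  These conditions determine \<open>\<zeta>\<close> on \<open>small_u\<close>.\<close>

definition is_zeta :: "'k :: field \<Rightarrow> nat \<Rightarrow> ('k tr set \<Rightarrow> 'k mat) \<Rightarrow> bool" where
  "is_zeta \<epsilon> r \<zeta> \<longleftrightarrow>
     \<zeta> \<in> ring_hom (Uk \<epsilon>) (ring_mat TYPE('k) (2 ^ r) ()) \<and>
     (\<forall>a. \<zeta> (Uk_scalar \<epsilon> a) = a \<cdot>\<^sub>m 1\<^sub>m (2 ^ r)) \<and>
     (\<forall>g. \<zeta> (Uk_gen \<epsilon> g) = tensor_power_rep \<epsilon> r g)"

definition little_q_schur ::
    "'k :: field \<Rightarrow> nat \<Rightarrow> ('k tr set \<Rightarrow> 'k mat) \<Rightarrow> 'k mat ring" where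
  "little_q_schur \<epsilon> r \<zeta> = (ring_mat TYPE('k) (2 ^ r) ())\<lparr>carrier := \<zeta> ` small_u \<epsilon>\<rparr>"

section \<open>Modules, semisimplicity and blocks\<close>

text \<open>Left modules over a ring that need not be commutative, on the module records of the library
  (whose locale \<^locale>\<open>module\<close> is for commutative rings).\<close>

locale left_module = R?: ring R + M?: abelian_group M
    for R :: "('a, 'c) ring_scheme" (structure) and M :: "('a, 'b, 'm) module_scheme" (structure) +
  assumes smult_closed:
      "\<lbrakk>a \<in> carrier R; x \<in> carrier M\<rbrakk> \<Longrightarrow> a \<odot>\<^bsub>M\<^esub> x \<in> carrier M"
    and smult_l_distr:
      "\<lbrakk>a \<in> carrier R; b \<in> carrier R; x \<in> carrier M\<rbrakk> \<Longrightarrow>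
       (a \<oplus>\<^bsub>R\<^esub> b) \<odot>\<^bsub>M\<^esub> x = a \<odot>\<^bsub>M\<^esub> x \<oplus>\<^bsub>M\<^esub> b \<odot>\<^bsub>M\<^esub> x"
    and smult_r_distr:
      "\<lbrakk>a \<in> carrier R; x \<in> carrier M; y \<in> carrier M\<rbrakk> \<Longrightarrow>
       a \<odot>\<^bsub>M\<^esub> (x \<oplus>\<^bsub>M\<^esub> y) = a \<odot>\<^bsub>M\<^esub> x \<oplus>\<^bsub>M\<^esub> a \<odot>\<^bsub>M\<^esub> y"
    and smult_assoc:
      "\<lbrakk>a \<in> carrier R; b \<in> carrier R; x \<in> carrier M\<rbrakk> \<Longrightarrow>
       (a \<otimes>\<^bsub>R\<^esub> b) \<odot>\<^bsub>M\<^esub> x = a \<odot>\<^bsub>M\<^esub> (b \<odot>\<^bsub>M\<^esub> x)"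
    and smult_one:
      "x \<in> carrier M \<Longrightarrow> \<one>\<^bsub>R\<^esub> \<odot>\<^bsub>M\<^esub> x = x"

definition simple_module :: "('a, 'c) ring_scheme \<Rightarrow> ('a, 'b, 'm) module_scheme \<Rightarrow> bool" where
  "simple_module R M \<longleftrightarrow> left_module R M \<and> carrier M \<noteq> {\<zero>\<^bsub>M\<^esub>} \<and>
     (\<forall>N. submodule N R M \<longrightarrow> N = {\<zero>\<^bsub>M\<^esub>} \<or> N = carrier M)"

text \<open>A module is semisimple if it is the sum of its simple submodules, that is, if no proper
  submodule contains all of them.\<close>

definition semisimple_module :: "('a, 'c) ring_scheme \<Rightarrow> ('a, 'b, 'm) module_scheme \<Rightarrow> bool" where
  "semisimple_module R M \<longleftrightarrow> left_module R M \<and>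
     (\<forall>N. submodule N R M \<and>
          (\<forall>S. submodule S R M \<and> simple_module R (M\<lparr>carrier := S\<rparr>) \<longrightarrow> S \<subseteq> N) \<longrightarrow>
        N = carrier M)"

definition regular_module :: "'a ring \<Rightarrow> ('a, 'a) module" where
  "regular_module R = \<lparr>carrier = carrier R, mult = mult R, one = one R,
     zero = zero R, add = add R, smult = mult R\<rparr>"

definition semisimple_ring :: "'a ring \<Rightarrow> bool" where
  "semisimple_ring R \<longleftrightarrow> ring R \<and> semisimple_module R (regular_module R)"

definition central_idempotent :: "'a ring \<Rightarrow> 'a \<Rightarrow> bool" where
  "central_idempotent R e \<longleftrightarrow> e \<in> carrier R \<and> e \<otimes>\<^bsub>R\<^esub> e = e \<and>
     (\<forall>x \<in> carrier R. e \<otimes>\<^bsub>R\<^esub> x = x \<otimes>\<^bsub>R\<^esub> e)"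

definition primitive_central_idempotent :: "'a ring \<Rightarrow> 'a \<Rightarrow> bool" where
  "primitive_central_idempotent R e \<longleftrightarrow> central_idempotent R e \<and> e \<noteq> \<zero>\<^bsub>R\<^esub> \<and>
     (\<forall>f g. central_idempotent R f \<and> central_idempotent R g \<and> f \<otimes>\<^bsub>R\<^esub> g = \<zero>\<^bsub>R\<^esub> \<and>
        e = f \<oplus>\<^bsub>R\<^esub> g \<longrightarrow> f = \<zero>\<^bsub>R\<^esub> \<or> g = \<zero>\<^bsub>R\<^esub>)"

text \<open>Blocks are the block ideals \<open>R e\<close>, taken as rings with identity \<open>e\<close>.\<close>

definition blocks :: "'a ring \<Rightarrow> 'a ring set" where
  "blocks R = {R\<lparr>carrier := (\<lambda>x. x \<otimes>\<^bsub>R\<^esub> e) ` carrier R, one := e\<rparr> | e.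
     primitive_central_idempotent R e}"

definition in_block :: "'a ring \<Rightarrow> ('a, 'b, 'm) module_scheme \<Rightarrow> bool" where
  "in_block B M \<longleftrightarrow> (\<forall>x \<in> carrier M. \<one>\<^bsub>B\<^esub> \<odot>\<^bsub>M\<^esub> x = x)"

definition block_containing :: "'a ring \<Rightarrow> ('a, 'b, 'm) module_scheme \<Rightarrow> 'a ring" where
  "block_containing R M = (THE B. B \<in> blocks R \<and> in_block B M)"

section \<open>Weights, simple modules and their blocks\<close>

definition PD :: "(int \<times> int) set" where
  "PD = {w. 0 \<le> fst w \<and> 0 \<le> snd w}"

definition P1D :: "nat \<Rightarrow> (int \<times> int) set" where
  "P1D l = {w \<in> PD. 0 \<le> fst w - snd w \<and> fst w - snd w \<le> int l - 1 \<and>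
                     0 \<le> snd w \<and> snd w \<le> int l - 1}"

definition Gamma1 :: "nat \<Rightarrow> nat \<Rightarrow> (int \<times> int) set" where
  "Gamma1 l r = {w. fst w + snd w = int r \<and>
     (\<exists>\<mu> \<in> P1D l. \<exists>\<nu> \<in> PD. w = (fst \<mu> + int l * fst \<nu>, snd \<mu> + int l * snd \<nu>))}"

text \<open>The class of a weight modulo \<open>l\<close>, represented by its least nonnegative residues.\<close>

definition bar :: "nat \<Rightarrow> int \<times> int \<Rightarrow> int \<times> int" where
  "bar l w = (fst w mod int l, snd w mod int l)"

definition St :: "nat \<Rightarrow> nat \<Rightarrow> (int \<times> int) set" where
  "St l r = {w \<in> Gamma1 l r. \<exists>m. fst w - snd w + 1 = m * int l}"

definition I_set :: "nat \<Rightarrow> nat \<Rightarrow> (int \<times> int) set" where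
  "I_set l r = {((int r + i) div 2, (int r - i) div 2) | i.
     0 \<le> i \<and> i \<le> int l - 2 \<and> i < 2 * int l - int r - 2 \<and> 0 \<le> int r - i \<and> even (int r - i)}"

definition J_set :: "nat \<Rightarrow> nat \<Rightarrow> (int \<times> int) set" where
  "J_set l r = {((int r + i) div 2, (int r - i) div 2) | i.
     0 \<le> i \<and> i \<le> int l - 2 \<and> 2 * int l - int r - 2 \<le> i \<and> even (int r - i)}"

text \<open>\<open>M\<close> is a simple module of the little q-Schur algebra generated by a nonzero vector \<open>v\<close> with
  \<open>E v = 0\<close> and \<open>K\<^sub>i v = \<epsilon>\<^bsup>\<lambda>\<^sub>i\<^esup> v\<close>. The scalars of \<open>k\<close> act as scalar matrices.\<close>

definition is_L1 :: "'k :: field \<Rightarrow> nat \<Rightarrow> ('k tr set \<Rightarrow> 'k mat) \<Rightarrow> int \<times> int \<Rightarrow>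
    ('k mat, 'b) module \<Rightarrow> bool" where
  "is_L1 \<epsilon> r \<zeta> w M \<longleftrightarrow> simple_module (little_q_schur \<epsilon> r \<zeta>) M \<and>
     (\<exists>v \<in> carrier M. v \<noteq> \<zero>\<^bsub>M\<^esub> \<and>
        (\<forall>N. submodule N (little_q_schur \<epsilon> r \<zeta>) M \<and> v \<in> N \<longrightarrow> N = carrier M) \<and>
        \<zeta> (Uk_gen \<epsilon> GE) \<odot>\<^bsub>M\<^esub> v = \<zero>\<^bsub>M\<^esub> \<and>
        \<zeta> (Uk_gen \<epsilon> GK1) \<odot>\<^bsub>M\<^esub> v = ((\<epsilon> powi fst w) \<cdot>\<^sub>m 1\<^sub>m (2 ^ r)) \<odot>\<^bsub>M\<^esub> v \<and>
        \<zeta> (Uk_gen \<epsilon> GK2) \<odot>\<^bsub>M\<^esub> v = ((\<epsilon> powi snd w) \<cdot>\<^sub>m 1\<^sub>m (2 ^ r)) \<odot>\<^bsub>M\<^esub> v)"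

text \<open>The simple module \<open>L1\<close> is unique up to isomorphism. Every simple module of a ring \<open>R\<close> is
  isomorphic to a quotient of the regular module, whose elements are subsets of \<open>R\<close>; this fixes
  the type of the representative.\<close>

definition L1 :: "'k :: field \<Rightarrow> nat \<Rightarrow> ('k tr set \<Rightarrow> 'k mat) \<Rightarrow> int \<times> int \<Rightarrow>
    ('k mat, 'k mat set) module" where
  "L1 \<epsilon> r \<zeta> w = (SOME M. is_L1 \<epsilon> r \<zeta> w M)"

definition block_of :: "'k :: field \<Rightarrow> nat \<Rightarrow> ('k tr set \<Rightarrow> 'k mat) \<Rightarrow> int \<times> int \<Rightarrow>
    'k mat ring" where
  "block_of \<epsilon> r \<zeta> w = block_containing (little_q_schur \<epsilon> r \<zeta>) (L1 \<epsilon> r \<zeta> w)"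

definition primitive_root :: "nat \<Rightarrow> 'k :: field \<Rightarrow> bool" where
  "primitive_root l \<epsilon> \<longleftrightarrow> 0 < l \<and> \<epsilon> ^ l = 1 \<and> (\<forall>d. 0 < d \<and> d < l \<longrightarrow> \<epsilon> ^ d \<noteq> 1)"

end

theory Submission
  imports Defs
begin

text \<open>The Casimir element \<open>C\<close> is central, and \<open>F E = C - c\<^sub>w\<close> on vectors of weight \<open>w\<close>, where
  \<open>c\<^sub>a = c\<^sub>b\<close> exactly when \<open>b\<close> is \<open>a\<close> or \<open>-2 - a\<close> modulo \<open>l\<close>. The idempotents onto the generalised
  eigenspaces of \<open>C\<close> are therefore central and are indexed by the pairs \<open>{i, l - 2 - i}\<close> and by the
  Steinberg weight \<open>l - 1\<close>; each of them that does not vanish is primitive, because a central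
  idempotent acts on every weight space as a polynomial in \<open>C\<close> and \<open>E\<close> is injective away from the
  weights \<open>i\<close> and \<open>l - 2 - i\<close>. Let \<open>i\<close> be the member of the pair that has the parity of \<open>r\<close>. On the
  tensor power the relation \<open>E\<^sup>p = 0\<close> on the integral weight space \<open>m\<close>, for \<open>m + 2 p > r\<close>, restricts
  the eigenvalues of \<open>C\<close> there to \<open>c\<^sub>n\<close> with \<open>|m| \<le> n \<le> r\<close>. If \<open>i < 2 l - r - 2\<close>, this forces the
  weight space \<open>l - 2 - i\<close> of the block to vanish, whence \<open>C = c\<^sub>i\<close> on the block, which is a sum of simple
  modules of highest weight \<open>i\<close>. If \<open>i \<ge> 2 l - r - 2\<close>, the vector \<open>v\<close> obtained from
  \<open>\<omega>\<^sub>2\<^sup>k \<otimes> \<omega>\<^sub>1\<^sup>s\<close> (\<open>k = l - 1 - i\<close>, \<open>s = l - 1\<close>) satisfies \<open>(C - c\<^sub>i) v \<noteq> 0 = (C - c\<^sub>i)\<^sup>2 v\<close>, so \<open>C - c\<^sub>i\<close> is a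
  nonzero nilpotent central element of the block.\<close>

section \<open>Representations of quantum gl(2) at a root of unity\<close>

text \<open>The algebra separates weights only modulo l. The bound by r enters through projections
  onto integral weight spaces, which need not lie in the algebra but commute with C. Integral
  weights have the parity of r, and since l is odd this turns congruences modulo l into congruences
  modulo 2 l. The threshold 2 l - r - 2 counts tensor factors: with k = l - 1 - i and s = l - 1 the
  vector \<open>\<omega>\<^sub>2\<^sup>k \<otimes> \<omega>\<^sub>1\<^sup>s\<close> has weight s - k
  = i and occupies k + s = 2 l - 2 - i factors. The remaining r - k - s, an even number, are filled
  with copies of the invariant vector \<open>\<omega>\<^sub>2 \<otimes> \<omega>\<^sub>1 - q
  \<omega>\<^sub>1 \<otimes> \<omega>\<^sub>2\<close>. \<open>E ^ k\<close> moves the weight to 2 l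
  - 2 - i, where \<open>cc\<close> has the same value as at i. The field is not assumed
  algebraically closed: \<open>E ^ l = 0\<close> already yields a polynomial in C that kills
  everything and whose roots are values of \<open>cc\<close>, so the idempotents come from Bezout
  identities in the centre. Of the specialised enveloping algebra only the image under
  \<open>\<zeta>\<close> enters. There \<open>K\<^sub>1 K\<^sub>2\<close> is the scalar
  \<open>q ^ r\<close>, so the image is generated by E, F, K, its inverse and the scalars.\<close>

lemma primitive_root_powi_eq_iff:
  fixes q :: "'k :: field"
  assumes "primitive_root l q"
  shows "q powi a = q powi b \<longleftrightarrow> int l dvd a - b"
proof -
  have l: "0 < l" "q ^ l = 1" and pr: "\<And>d. 0 < d \<Longrightarrow> d < l \<Longrightarrow> q ^ d \<noteq> 1"
    using assms by (auto simp: primitive_root_def)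
  have q0: "q \<noteq> 0"
    using l by (metis power_0_left zero_neq_one bot_nat_0.not_eq_extremum)
  have per: "q powi (c + int l * d) = q powi c" for c d
  proof -
    have "q powi (int l * d) = 1"
      using l by (simp add: power_int_mult)
    then show ?thesis
      using q0 by (simp add: power_int_add)
  qed
  have one: "q powi c = 1 \<longleftrightarrow> int l dvd c" for c
  proof -
    have "q powi c = q powi (c mod int l)"
      using per[of "c mod int l" "c div int l"] by (simp add: add.commute)
    also have "\<dots> = q ^ nat (c mod int l)"
      using l by (simp add: power_int_def)
    finally have "q powi c = q ^ nat (c mod int l)" .
    moreover have "nat (c mod int l) < l"
      using l by (simp add: nat_less_iff)
    moreover have "0 < nat (c mod int l) \<longleftrightarrow> \<not> int l dvd c"
      using l pos_mod_sign[of "int l" c]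
      by (metis mod_0_imp_dvd dvd_imp_mod_0 order_less_le of_nat_0_less_iff zero_less_nat_eq)
    ultimately show ?thesis
      using pr[of "nat (c mod int l)"] by (cases "nat (c mod int l) = 0") auto
  qed
  have "q powi a = q powi b \<longleftrightarrow> q powi (a - b) = 1"
    using q0 by (simp add: power_int_diff)
  with one show ?thesis by simp
qed

text \<open>If the characteristic p divided l = p m, then
  \<open>(q ^ m - 1) ^ p = q ^ l - 1 = 0\<close>, so the order of q would be at most m. The
  averaging in \<open>proj\<close> divides by l.\<close>

lemma primitive_root_of_nat_neq_0:
  fixes q :: "'k :: field"
  assumes "primitive_root l q"
  shows "of_nat l \<noteq> (0 :: 'k)"
proof
  assume 0: "of_nat l = (0 :: 'k)"
  have l: "0 < l" "q ^ l = 1" and pr: "\<And>d. 0 < d \<Longrightarrow> d < l \<Longrightarrow> q ^ d \<noteq> 1"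
    using assms by (auto simp: primitive_root_def)
  have "CHAR('k) dvd l" using 0 by (simp add: of_nat_eq_0_iff_char_dvd)
  then obtain m where m: "l = CHAR('k) * m" by blast
  with l have c: "CHAR('k) > 0" "m > 0" by auto
  then have p: "prime CHAR('k)" by (simp add: prime_CHAR_semidom)
  have "(q ^ m - 1 + 1) ^ CHAR('k) = (q ^ m - 1) ^ CHAR('k) + 1"
    by (subst freshmans_dream) (use p in auto)
  moreover have "(q ^ m) ^ CHAR('k) = 1"
    using l m by (metis power_mult mult.commute)
  ultimately have "(q ^ m - 1) ^ CHAR('k) = 0" by simp
  then have "q ^ m = 1" by simp
  moreover have "m < l" using m c p prime_gt_1_nat by simp
  ultimately show False using pr c by blast
qed

text \<open>The relations of the small quantum group of sl(2), with \<open>L\<close> the inverse of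
  \<open>K\<close>, inside a ring that may be larger than the algebra they generate.
  \<open>K\<close> stands for \<open>K\<^sub>1 K\<^sub>2\<^sup>-\<^sup>1\<close>; the two factors
  are recovered later as polynomials in it (\<open>opK1_eq\<close>, \<open>opK2_eq\<close>).\<close>

locale uq = vector_space scale for scale :: "'k :: field \<Rightarrow> 'a :: ring_1 \<Rightarrow> 'a" (infixr "*s" 75) +
  fixes E F K L :: 'a and q :: 'k and l :: nat
  assumes scale_mult_left: "(a *s x) * y = a *s (x * y)"
    and scale_mult_right: "x * (a *s y) = a *s (x * y)"
    and root: "primitive_root l q" and l3: "3 \<le> l" and odd_l: "odd l"
    and KL: "K * L = 1" and LK: "L * K = 1" and K_pow_l: "K ^ l = 1"
    and EK: "K * E = q\<^sup>2 *s (E * K)"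
    and FK: "F * K = q\<^sup>2 *s (K * F)"
    and EF: "E * F = F * E + (1 / (q - 1 / q)) *s (K - L)"
    and E_pow_l: "E ^ l = 0" and F_pow_l: "F ^ l = 0"
begin

lemma q_pow_l: "q ^ l = 1"
  using root by (simp add: primitive_root_def)

lemma q_nz [simp]: "q \<noteq> 0"
  using q_pow_l l3 by (metis power_0_left not_numeral_le_zero zero_neq_one)

lemma powi_eq_iff: "q powi a = q powi b \<longleftrightarrow> int l dvd a - b"
  using primitive_root_powi_eq_iff[OF root] .

lemma l_nz: "of_nat l \<noteq> (0 :: 'k)"
  using primitive_root_of_nat_neq_0[OF root] .

lemma q_sq: "q\<^sup>2 \<noteq> 1"
  using root l3 by (simp add: primitive_root_def)

lemma d_nz [simp]: "q - 1 / q \<noteq> 0"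
  using q_sq by (simp add: field_simps power2_eq_square)

section \<open>The quantum Casimir element\<close>

definition C :: 'a where
  "C = F * E + (1 / (q - 1 / q)\<^sup>2) *s (q *s K + (1 / q) *s L)"

text \<open>The value of \<open>C\<close> on a vector of weight \<open>a\<close> that is annihilated by \<open>E\<close>.\<close>

definition cc :: "int \<Rightarrow> 'k" where
  "cc a = (q powi (a + 1) + q powi (- a - 1)) / (q - 1 / q)\<^sup>2"

lemma odd_dvd: "int l dvd 2 * a \<longleftrightarrow> int l dvd a"
proof -
  have "coprime (int l) 2" using odd_l by simp
  then show ?thesis by (simp add: coprime_dvd_mult_right_iff)
qed

text \<open>With \<open>x = q powi (a + 1)\<close> and \<open>y = q powi (b + 1)\<close> the
  equation x + 1/x = y + 1/y factors as (x - y)(x y - 1) = 0. The second factor is the linkage of a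
  with -2 - a.\<close>

lemma cc_eq_iff: "cc a = cc b \<longleftrightarrow> int l dvd a - b \<or> int l dvd a + b + 2"
proof -
  define x y where "x = q powi (a + 1)" and "y = q powi (b + 1)"
  have nz: "x \<noteq> 0" "y \<noteq> 0" by (simp_all add: x_def y_def)
  have inv: "q powi (- a - 1) = 1 / x" "q powi (- b - 1) = 1 / y"
    using power_int_minus[of q "a + 1"] power_int_minus[of q "b + 1"]
    by (simp_all add: x_def y_def inverse_eq_divide)
  have "cc a = cc b \<longleftrightarrow> x + 1 / x = y + 1 / y"
    unfolding cc_def inv x_def[symmetric] y_def[symmetric] using d_nz
    by (simp only: divide_cancel_right power_eq_0_iff) simp
  also have "\<dots> \<longleftrightarrow> (x - y) * (x * y - 1) = 0"
  proof -
    have "(x - y) * (x * y - 1) = x * y * ((x + 1 / x) - (y + 1 / y))"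
      using nz by (simp add: field_simps)
    then show ?thesis using nz by simp
  qed
  also have "\<dots> \<longleftrightarrow> x = y \<or> x * y = 1" by simp
  also have "x = y \<longleftrightarrow> int l dvd a - b"
    by (simp add: x_def y_def powi_eq_iff)
  also have "x * y = q powi (a + b + 2)"
    unfolding x_def y_def by (subst power_int_add[symmetric]) (auto simp: algebra_simps)
  also have "q powi (a + b + 2) = 1 \<longleftrightarrow> int l dvd a + b + 2"
    using powi_eq_iff[of "a + b + 2" 0] by simp
  finally show ?thesis .
qed

lemma EL: "E * L = q\<^sup>2 *s (L * E)"
proof -
  have "E * L = L * (K * E) * L" by (simp add: mult.assoc[symmetric] LK)
  also have "\<dots> = q\<^sup>2 *s (L * E * (K * L))"
    by (simp add: EK scale_mult_left scale_mult_right mult.assoc)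
  finally show ?thesis by (simp add: KL)
qed

lemma LF: "L * F = q\<^sup>2 *s (F * L)"
proof -
  have "L * F = L * (F * K) * L" by (simp add: mult.assoc KL)
  also have "\<dots> = q\<^sup>2 *s ((L * K) * F * L)"
    by (simp add: FK scale_mult_left scale_mult_right mult.assoc)
  finally show ?thesis by (simp add: LK)
qed

lemma EK': "E * K = (1 / q\<^sup>2) *s (K * E)"
  by (simp add: EK)

lemma C_E: "C * E = E * C"
proof -
  let ?d = "q - 1 / q"
  have "E * C = E * F * E + (1 / ?d\<^sup>2) *s (q *s (E * K) + (1 / q) *s (E * L))"
    by (simp add: C_def distrib_left scale_mult_right mult.assoc)
  also have "E * F * E = F * E * E + (1 / ?d) *s (K * E - L * E)"
    by (simp add: EF distrib_right scale_mult_left left_diff_distrib)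
  also have "\<dots> + (1 / ?d\<^sup>2) *s (q *s (E * K) + (1 / q) *s (E * L))
     = F * E * E + ((1 / ?d + 1 / ?d\<^sup>2 * q * (1 / q\<^sup>2)) *s (K * E) + (1 / ?d\<^sup>2 * (1 / q) * q\<^sup>2 - 1 / ?d) *s (L * E))"
    by (simp add: EK' EL scale_right_distrib scale_left_distrib scale_right_diff_distrib scale_left_diff_distrib algebra_simps)
  \<comment> \<open>Multiplied by the square of d, the two coefficient identities read d + 1/q = q
    and q - d = 1/q.\<close>
  also have "1 / ?d + 1 / ?d\<^sup>2 * q * (1 / q\<^sup>2) = 1 / ?d\<^sup>2 * q"
    using d_nz by (simp add: divide_simps power2_eq_square) (simp add: algebra_simps)
  also have "1 / ?d\<^sup>2 * (1 / q) * q\<^sup>2 - 1 / ?d = 1 / ?d\<^sup>2 * (1 / q)"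
    using d_nz by (simp add: divide_simps power2_eq_square) (simp add: algebra_simps)
  also have "F * E * E + ((1 / ?d\<^sup>2 * q) *s (K * E) + (1 / ?d\<^sup>2 * (1 / q)) *s (L * E)) = C * E"
    by (simp add: C_def distrib_right scale_mult_left scale_right_distrib)
  finally show ?thesis ..
qed

lemma C_F: "C * F = F * C"
proof -
  let ?d = "q - 1 / q"
  have "C * F = F * (E * F) + (1 / ?d\<^sup>2) *s (q *s (K * F) + (1 / q) *s (L * F))"
    by (simp add: C_def distrib_right scale_mult_left mult.assoc)
  also have "F * (E * F) = F * F * E + (1 / ?d) *s (F * K - F * L)"
    by (simp add: EF distrib_left scale_mult_right right_diff_distrib mult.assoc)
  also have "K * F = (1 / q\<^sup>2) *s (F * K)" by (simp add: FK)
  also have "F * F * E + (1 / ?d) *s (F * K - F * L) + (1 / ?d\<^sup>2) *s (q *s ((1 / q\<^sup>2) *s (F * K)) + (1 / q) *s (L * F))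
     = F * F * E + ((1 / ?d + 1 / ?d\<^sup>2 * q * (1 / q\<^sup>2)) *s (F * K) + (1 / ?d\<^sup>2 * (1 / q) * q\<^sup>2 - 1 / ?d) *s (F * L))"
    by (simp add: LF scale_right_distrib scale_left_distrib scale_right_diff_distrib scale_left_diff_distrib algebra_simps)
  also have "1 / ?d + 1 / ?d\<^sup>2 * q * (1 / q\<^sup>2) = 1 / ?d\<^sup>2 * q"
    using d_nz by (simp add: divide_simps power2_eq_square) (simp add: algebra_simps)
  also have "1 / ?d\<^sup>2 * (1 / q) * q\<^sup>2 - 1 / ?d = 1 / ?d\<^sup>2 * (1 / q)"
    using d_nz by (simp add: divide_simps power2_eq_square) (simp add: algebra_simps)
  also have "F * F * E + ((1 / ?d\<^sup>2 * q) *s (F * K) + (1 / ?d\<^sup>2 * (1 / q)) *s (F * L)) = F * C"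
    by (simp add: C_def distrib_left scale_mult_right scale_right_distrib mult.assoc)
  finally show ?thesis .
qed

lemma C_K: "C * K = K * C"
proof -
  have "F * E * K = (1 / q\<^sup>2) *s ((F * K) * E)"
    by (simp add: EK' mult.assoc scale_mult_right)
  also have "\<dots> = K * (F * E)" by (simp add: FK scale_mult_left mult.assoc)
  finally show ?thesis
    by (simp add: C_def distrib_left distrib_right scale_mult_left scale_mult_right KL LK mult.assoc)
qed

lemma C_L: "C * L = L * C"
  by (metis C_K KL LK mult.assoc mult_1_left mult_1_right)

section \<open>Weights modulo l\<close>

text \<open>Ring elements serve as vectors under left multiplication, so a weight space is a right
  ideal, and generators, projections and module elements are handled alike. Only the class of j
  modulo l matters (\<open>wt_cong\<close>).\<close>

definition wt :: "int \<Rightarrow> 'a \<Rightarrow> bool" where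
  "wt j x \<longleftrightarrow> K * x = (q powi j) *s x"

lemma wt_L: "wt j x \<Longrightarrow> L * x = (q powi (- j)) *s x"
proof -
  assume "wt j x"
  then have "x = (q powi j) *s (L * x)"
    by (metis LK wt_def mult.assoc mult_1_left scale_mult_right)
  then have "(q powi (- j)) *s x = (q powi (- j)) *s (q powi j) *s (L * x)" by simp
  then show ?thesis by (simp add: power_int_minus)
qed

lemma wt_0 [simp]: "wt j 0" by (simp add: wt_def)
lemma wt_mult_right: "wt j x \<Longrightarrow> wt j (x * y)"
  by (simp add: wt_def scale_mult_left mult.assoc[symmetric])
lemma wt_commute: "wt j x \<Longrightarrow> z * K = K * z \<Longrightarrow> wt j (z * x)"
  by (metis wt_def scale_mult_right mult.assoc)
lemma wt_cong: "wt j x \<Longrightarrow> int l dvd j - k \<Longrightarrow> wt k x"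
  using powi_eq_iff[of j k] by (simp add: wt_def)

lemma wt_E: "wt j x \<Longrightarrow> wt (j + 2) (E * x)"
  unfolding wt_def mult.assoc[symmetric] EK
  by (simp add: scale_mult_left mult.assoc scale_mult_right power_int_add mult.commute)

lemma wt_F: assumes "wt j x" shows "wt (j - 2) (F * x)"
proof -
  have "q\<^sup>2 *s (K * (F * x)) = (q powi j) *s (F * x)"
    using assms unfolding wt_def
    by (metis FK mult.assoc scale_mult_left scale_mult_right)
  then have "(1 / q\<^sup>2) *s q\<^sup>2 *s (K * (F * x)) = (1 / q\<^sup>2) *s (q powi j) *s (F * x)" by simp
  then show ?thesis by (simp add: wt_def power_int_diff)
qed

lemma wt_E_pow: "wt j x \<Longrightarrow> wt (j + 2 * int m) (E ^ m * x)"
proof (induction m)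
  case (Suc m)
  then show ?case using wt_E[of "j + 2 * int m" "E ^ m * x"] by (simp add: algebra_simps)
qed simp

lemma wt_F_pow: "wt j x \<Longrightarrow> wt (j - 2 * int m) (F ^ m * x)"
proof (induction m)
  case (Suc m)
  then show ?case using wt_F[of "j - 2 * int m" "F ^ m * x"] by (simp add: algebra_simps)
qed simp

lemma wt_unique: "wt j x \<Longrightarrow> wt k x \<Longrightarrow> x \<noteq> 0 \<Longrightarrow> int l dvd j - k"
  using powi_eq_iff[of j k] by (auto simp: wt_def)

definition zz :: "'k \<Rightarrow> 'a" where "zz c = C - c *s 1"

lemma zz_mult: "zz c * x = C * x - c *s x"
  by (simp add: zz_def left_diff_distrib scale_mult_left)

text \<open>The torus part of C first. Replacing F E by E F adds (L - K)/d, which interchanges the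
  coefficients of K and L and so replaces j by -j. The two parts serve \<open>FE_wt\<close> and
  \<open>EF_wt\<close>.\<close>

lemma C_wt: assumes "wt j x"
  shows "(1 / (q - 1 / q)\<^sup>2) *s (q *s K + (1 / q) *s L) * x = cc j *s x"
    and "(1 / (q - 1 / q)\<^sup>2) *s (q *s K + (1 / q) *s L) * x + (1 / (q - 1 / q)) *s ((L - K) * x) = cc (- j) *s x"
proof -
  let ?d = "q - 1 / q"
  have K: "K * x = (q powi j) *s x" and L: "L * x = (q powi (- j)) *s x"
    using assms wt_L by (auto simp: wt_def)
  have "cc j = 1 / ?d\<^sup>2 * q * q powi j + 1 / ?d\<^sup>2 * (1 / q) * q powi (- j)"
    by (simp add: cc_def power_int_add power_int_diff add_divide_distrib mult.commute)
  then show "(1 / ?d\<^sup>2) *s (q *s K + (1 / q) *s L) * x = cc j *s x"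
    by (simp add: distrib_right scale_mult_left K L scale_left_distrib scale_right_distrib)
  have "(1 / ?d\<^sup>2) *s (q *s K + (1 / q) *s L) * x + (1 / ?d) *s ((L - K) * x)
      = ((1 / ?d\<^sup>2 * q - 1 / ?d) * q powi j + (1 / ?d\<^sup>2 * (1 / q) + 1 / ?d) * q powi (- j)) *s x"
    by (simp add: distrib_right left_diff_distrib scale_mult_left K L scale_left_distrib scale_right_distrib
      scale_left_diff_distrib scale_right_diff_distrib algebra_simps)
  also have "1 / ?d\<^sup>2 * q - 1 / ?d = 1 / ?d\<^sup>2 * (1 / q)"
    using d_nz by (simp add: divide_simps power2_eq_square) (simp add: algebra_simps)
  also have "1 / ?d\<^sup>2 * (1 / q) + 1 / ?d = 1 / ?d\<^sup>2 * q"
    using d_nz by (simp add: divide_simps power2_eq_square) (simp add: algebra_simps)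
  also have "1 / ?d\<^sup>2 * (1 / q) * q powi j + 1 / ?d\<^sup>2 * q * q powi (- j) = cc (- j)"
    by (simp add: power_int_minus divide_inverse cc_def power_int_add power_int_diff distrib_right distrib_left mult_ac)
  finally show "(1 / ?d\<^sup>2) *s (q *s K + (1 / q) *s L) * x + (1 / ?d) *s ((L - K) * x) = cc (- j) *s x" .
qed

lemma FE_wt: assumes "wt j x" shows "F * (E * x) = zz (cc j) * x"
  using C_wt(1)[OF assms] by (simp add: zz_mult C_def distrib_right mult.assoc)

lemma EF_wt: assumes "wt j x" shows "E * (F * x) = zz (cc (- j)) * x"
proof -
  have "E * (F * x) = F * E * x + (1 / (q - 1 / q)) *s ((K - L) * x)"
    by (simp add: mult.assoc[symmetric] EF distrib_right scale_mult_left)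
  also have "\<dots> = C * x - ((1 / (q - 1 / q)\<^sup>2) *s (q *s K + (1 / q) *s L) * x + (1 / (q - 1 / q)) *s ((L - K) * x))"
    by (simp add: C_def distrib_right left_diff_distrib scale_right_diff_distrib)
  finally show ?thesis
    by (simp add: C_wt(2)[OF assms] zz_mult)
qed

lemma zz_E: "zz c * E = E * zz c" by (simp add: zz_def left_diff_distrib right_diff_distrib scale_mult_left scale_mult_right C_E)
lemma zz_F: "zz c * F = F * zz c" by (simp add: zz_def left_diff_distrib right_diff_distrib scale_mult_left scale_mult_right C_F)
lemma zz_K: "zz c * K = K * zz c" by (simp add: zz_def left_diff_distrib right_diff_distrib scale_mult_left scale_mult_right C_K)
lemma zz_L: "zz c * L = L * zz c" by (simp add: zz_def left_diff_distrib right_diff_distrib scale_mult_left scale_mult_right C_L)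

section \<open>The generated algebra and its centre\<close>

inductive_set alg :: "'a set" where
  alg_scalar: "a *s 1 \<in> alg"
| alg_E: "E \<in> alg"
| alg_F: "F \<in> alg"
| alg_K: "K \<in> alg"
| alg_L: "L \<in> alg"
| alg_add: "x \<in> alg \<Longrightarrow> y \<in> alg \<Longrightarrow> x + y \<in> alg"
| alg_mult: "x \<in> alg \<Longrightarrow> y \<in> alg \<Longrightarrow> x * y \<in> alg"

lemma alg_0 [simp]: "0 \<in> alg" using alg_scalar[of 0] by simp
lemma alg_1 [simp]: "1 \<in> alg" using alg_scalar[of 1] by simp
lemma alg_scale: "x \<in> alg \<Longrightarrow> a *s x \<in> alg"
  using alg_mult[OF alg_scalar[of a]] by (simp add: scale_mult_left)
lemma alg_uminus: "x \<in> alg \<Longrightarrow> - x \<in> alg"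
  using alg_scale[of x "- 1"] by simp
lemma alg_diff: "x \<in> alg \<Longrightarrow> y \<in> alg \<Longrightarrow> x - y \<in> alg"
  using alg_add[of x "- y"] alg_uminus by simp
lemma alg_pow: "x \<in> alg \<Longrightarrow> x ^ n \<in> alg" by (induction n) (auto intro: alg_mult)
lemma alg_sum: "(\<And>i. i \<in> I \<Longrightarrow> f i \<in> alg) \<Longrightarrow> sum f I \<in> alg"
  by (induction I rule: infinite_finite_induct) (auto intro: alg_add)
lemma alg_C: "C \<in> alg"
  unfolding C_def by (intro alg_add alg_scale alg_mult alg.intros)
lemma alg_zz: "zz c \<in> alg"
  unfolding zz_def by (intro alg_diff alg_C alg_scalar)

text \<open>The centre of \<open>alg\<close>, not of the ambient ring: its elements slide past the
  algebra (\<open>Zc_left\<close>) but need not commute with the vectors on which they act.\<close>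

definition Zc :: "'a set" where
  "Zc = {z \<in> alg. \<forall>a\<in>alg. z * a = a * z}"

lemma Zc_alg: "z \<in> Zc \<Longrightarrow> z \<in> alg" by (simp add: Zc_def)
lemma Zc_comm: "z \<in> Zc \<Longrightarrow> a \<in> alg \<Longrightarrow> z * a = a * z" by (simp add: Zc_def)

lemma ZcI:
  assumes "z \<in> alg" "z * E = E * z" "z * F = F * z" "z * K = K * z" "z * L = L * z"
  shows "z \<in> Zc"
proof -
  have "z * a = a * z" if "a \<in> alg" for a
    using that
  proof induction
    case (alg_mult x y)
    then show ?case by (metis mult.assoc)
  qed (use assms in \<open>auto simp: scale_mult_left scale_mult_right distrib_left distrib_right\<close>)
  with assms show ?thesis by (simp add: Zc_def)
qed

lemma Zc_zz: "zz c \<in> Zc"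
  by (intro ZcI alg_zz zz_E zz_F zz_K zz_L)
lemma Zc_scalar: "c *s 1 \<in> Zc"
  by (intro ZcI alg_scalar) (simp_all add: scale_mult_left scale_mult_right)
lemma Zc_0 [simp]: "0 \<in> Zc" using Zc_scalar[of 0] by simp
lemma Zc_1 [simp]: "1 \<in> Zc" using Zc_scalar[of 1] by simp
lemma Zc_add: "x \<in> Zc \<Longrightarrow> y \<in> Zc \<Longrightarrow> x + y \<in> Zc"
  by (auto simp: Zc_def distrib_left distrib_right intro: alg_add)
lemma Zc_diff: "x \<in> Zc \<Longrightarrow> y \<in> Zc \<Longrightarrow> x - y \<in> Zc"
  by (auto simp: Zc_def left_diff_distrib right_diff_distrib intro: alg_diff)
lemma Zc_mult: "x \<in> Zc \<Longrightarrow> y \<in> Zc \<Longrightarrow> x * y \<in> Zc"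
proof -
  assume "x \<in> Zc" "y \<in> Zc"
  then have "x * y * a = a * (x * y)" if "a \<in> alg" for a
  proof -
    have "x * y * a = x * (a * y)" using that \<open>y \<in> Zc\<close> by (simp add: mult.assoc Zc_comm)
    also have "\<dots> = a * (x * y)" using that \<open>x \<in> Zc\<close> Zc_comm[of x a] by (simp flip: mult.assoc)
    finally show ?thesis .
  qed
  moreover have "x * y \<in> alg"
    using \<open>x \<in> Zc\<close> \<open>y \<in> Zc\<close> by (intro alg_mult Zc_alg)
  ultimately show ?thesis unfolding Zc_def by blast
qed
lemma Zc_scale: "x \<in> Zc \<Longrightarrow> c *s x \<in> Zc"
  using Zc_mult[OF Zc_scalar[of c]] by (simp add: scale_mult_left)
lemma Zc_pow: "x \<in> Zc \<Longrightarrow> x ^ n \<in> Zc" by (induction n) (auto intro: Zc_mult)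
lemma Zc_left: "z \<in> Zc \<Longrightarrow> a \<in> alg \<Longrightarrow> z * (a * x) = a * (z * x)"
  by (metis Zc_comm mult.assoc)
lemma Zc_wt: "z \<in> Zc \<Longrightarrow> wt j x \<Longrightarrow> wt j (z * x)"
  using Zc_comm[OF _ alg_K] wt_commute by blast

text \<open>The polynomial in C with roots g 0, ..., g (n - 1), kept as a product of central
  factors.\<close>

primrec cp :: "(nat \<Rightarrow> 'k) \<Rightarrow> nat \<Rightarrow> 'a" where
  "cp g 0 = 1"
| "cp g (Suc n) = cp g n * zz (g n)"

lemma Zc_cp: "cp g n \<in> Zc"
  by (induction n) (auto intro: Zc_mult Zc_zz)

text \<open>The innermost pair F E meets a vector of weight w + 2 m and acts there as C - cc (w + 2
  m), which is central and slides out. Nilpotency of E thus becomes a polynomial equation for C on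
  each weight space.\<close>

lemma F_pow_E_pow: "wt w x \<Longrightarrow> F ^ m * (E ^ m * x) = cp (\<lambda>s. cc (w + 2 * int s)) m * x"
proof (induction m)
  case (Suc m)
  have "F ^ Suc m * (E ^ Suc m * x) = F ^ m * (F * (E * (E ^ m * x)))"
    by (simp add: power_commutes mult.assoc del: power_Suc add: power_Suc2) (simp add: power_commutes mult.assoc[symmetric])
  also have "\<dots> = F ^ m * (zz (cc (w + 2 * int m)) * (E ^ m * x))"
    using FE_wt[OF wt_E_pow[OF Suc.prems]] by simp
  also have "\<dots> = zz (cc (w + 2 * int m)) * (F ^ m * (E ^ m * x))"
    using Zc_left[OF Zc_zz alg_pow[OF alg_F]] by simp
  also have "\<dots> = cp (\<lambda>s. cc (w + 2 * int s)) m * (zz (cc (w + 2 * int m)) * x)"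
    using Suc Zc_left[OF Zc_zz Zc_alg[OF Zc_cp]] by simp
  finally show ?case by (simp add: mult.assoc)
qed simp

lemma E_pow_F_pow: "wt w x \<Longrightarrow> E ^ m * (F ^ m * x) = cp (\<lambda>s. cc (- w + 2 * int s)) m * x"
proof (induction m)
  case (Suc m)
  have "E ^ Suc m * (F ^ Suc m * x) = E ^ m * (E * (F * (F ^ m * x)))"
    by (simp add: power_commutes mult.assoc del: power_Suc add: power_Suc2) (simp add: power_commutes mult.assoc[symmetric])
  also have "\<dots> = E ^ m * (zz (cc (- (w - 2 * int m))) * (F ^ m * x))"
    using EF_wt[OF wt_F_pow[OF Suc.prems]] by simp
  also have "\<dots> = zz (cc (- w + 2 * int m)) * (E ^ m * (F ^ m * x))"
    using Zc_left[OF Zc_zz alg_pow[OF alg_E]] by simp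
  also have "\<dots> = cp (\<lambda>s. cc (- w + 2 * int s)) m * (zz (cc (- w + 2 * int m)) * x)"
    using Suc Zc_left[OF Zc_zz Zc_alg[OF Zc_cp]] by simp
  finally show ?case by (simp add: mult.assoc)
qed simp

lemma wt_K_pow: "wt j x \<Longrightarrow> K ^ s * x = (q powi (j * int s)) *s x"
proof (induction s)
  case (Suc s)
  have "K ^ Suc s * x = K ^ s * (K * x)" by (simp add: power_commutes flip: mult.assoc)
  also have "\<dots> = (q powi j * q powi (j * int s)) *s x"
    using Suc by (simp add: wt_def scale_mult_right)
  also have "q powi j * q powi (j * int s) = q powi (j * int (Suc s))"
    by (simp add: power_int_add distrib_left)
  finally show ?case .
qed simp

section \<open>Projections onto the weight spaces\<close>

lemma geom_sum: "(\<Sum>s<l. q powi (c * int s)) = (if int l dvd c then of_nat l else 0)"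
proof (cases "int l dvd c")
  case True
  then have "q powi (c * int s) = 1" for s
    using powi_eq_iff[of "c * int s" 0] by simp
  then show ?thesis using True by simp
next
  case False
  define y where "y = q powi c"
  have y: "y \<noteq> 1" using False powi_eq_iff[of c 0] by (simp add: y_def)
  have yl: "y ^ l = 1"
    using powi_eq_iff[of "c * int l" 0] by (simp add: y_def power_int_mult)
  have "(\<Sum>s<l. y ^ s) = 0"
    using power_diff_1_eq[of y l] y yl by simp
  then show ?thesis using False by (simp add: y_def power_int_mult)
qed

text \<open>Discrete Fourier transform over the powers of K. It belongs to \<open>alg\<close>, so
  weight components can be taken inside the algebra.\<close>

definition proj :: "int \<Rightarrow> 'a" where
  "proj j = (1 / of_nat l) *s (\<Sum>s<l. (q powi (- j * int s)) *s K ^ s)"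

lemma alg_proj: "proj j \<in> alg"
  unfolding proj_def by (intro alg_scale alg_sum alg_pow alg_K)

lemma proj_wt: assumes "wt j x"
  shows "proj k * x = (if int l dvd j - k then x else 0)"
proof -
  have "proj k * x = (1 / of_nat l) *s (\<Sum>s<l. (q powi ((j - k) * int s)) *s x)"
  proof -
    have "q powi (- k * int s) * q powi (j * int s) = q powi ((j - k) * int s)" for s
      by (subst power_int_add[symmetric]) (auto simp: algebra_simps)
    then show ?thesis
      by (simp add: proj_def scale_mult_left sum_distrib_right wt_K_pow[OF assms])
  qed
  also have "\<dots> = (1 / of_nat l * (\<Sum>s<l. q powi ((j - k) * int s))) *s x"
    by (simp only: scale_sum_left[symmetric] scale_scale)
  finally show ?thesis using l_nz by (simp add: geom_sum)
qed

lemma proj_wt_same: "wt j x \<Longrightarrow> proj j * x = x"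
  by (simp add: proj_wt)

lemma wt_proj: "wt j (proj j)"
proof -
  let ?g = "\<lambda>s. (q powi (- j * int s)) *s K ^ s"
  have gl: "?g l = ?g 0"
    using powi_eq_iff[of "- j * int l" 0] by (simp add: K_pow_l)
  have l0: "l > 0" using l3 by simp
  \<comment> \<open>Up to the factor \<open>q powi j\<close>, multiplication by K shifts the
    summands cyclically; the last one wraps round because the terms for l and 0 agree.\<close>
  have "(\<Sum>s<l. ?g (Suc s)) = (\<Sum>s<l. ?g s)"
    using sum.lessThan_Suc_shift[of ?g l] sum.lessThan_Suc[of ?g l] gl by simp
  moreover have "K * ?g s = (q powi j) *s ?g (Suc s)" for s
  proof -
    have "q powi (- j * int s) = q powi j * q powi (- j * int (Suc s))"
      by (subst power_int_add[symmetric]) (auto simp: algebra_simps)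
    then show ?thesis by (simp add: scale_mult_right)
  qed
  ultimately show ?thesis
    unfolding wt_def proj_def
    by (simp add: scale_mult_right sum_distrib_left scale_sum_right[symmetric] mult.commute
        del: scale_scale power_Suc) (metis scale_left_commute)
qed

lemma wt_proj_mult: "wt j (proj j * x)"
  using wt_proj wt_mult_right by blast

lemma proj_cong: "int l dvd j - k \<Longrightarrow> proj j = proj k"
proof -
  assume "int l dvd j - k"
  then have "int l dvd - j * int s - - k * int s" for s
    using dvd_mult2[of "int l" "k - j" "int s"] by (simp add: dvd_diff_commute left_diff_distrib)
  then have "q powi (- j * int s) = q powi (- k * int s)" for s
    by (simp only: powi_eq_iff)
  then show ?thesis by (simp add: proj_def)
qed

lemma sum_proj: "(\<Sum>j<l. proj (int j)) = 1"
proof -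
  have "(\<Sum>j<l. proj (int j)) = (1 / of_nat l) *s (\<Sum>s<l. (\<Sum>j<l. q powi (- int s * int j)) *s K ^ s)"
    unfolding proj_def scale_sum_right[symmetric] scale_sum_left
    by (subst sum.swap) (simp add: mult.commute)
  also have "(\<Sum>s<l. (\<Sum>j<l. q powi (- int s * int j)) *s K ^ s) = (\<Sum>s<l. (if s = 0 then of_nat l else 0) *s K ^ s)"
  proof (intro sum.cong refl)
    fix s assume "s \<in> {..<l}"
    then have "int l dvd - int s \<longleftrightarrow> s = 0"
      by (auto dest: zdvd_not_zless[rotated] simp: nat_dvd_not_less)
    then show "(\<Sum>j<l. q powi (- int s * int j)) *s K ^ s = (if s = 0 then of_nat l else 0) *s K ^ s"
      by (subst geom_sum) simp
  qed
  also have "\<dots> = (\<Sum>s<l. (if s = 0 then of_nat l *s 1 else 0))"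
    by (intro sum.cong) auto
  also have "\<dots> = of_nat l *s 1" using l3 by simp
  finally show ?thesis using l_nz by simp
qed

lemma sum_proj_mult: "(\<Sum>j<l. proj (int j) * x) = x"
  by (simp add: sum_distrib_right[symmetric] sum_proj)

lemma E_proj: "E * proj j = proj (j + 2) * E"
proof -
  have "E * proj j = (\<Sum>k<l. proj (j + 2) * (E * (proj (int k) * proj j)))"
  proof -
    have "E * proj j = proj (j + 2) * (E * proj j)"
      by (simp add: proj_wt_same[OF wt_E[OF wt_proj]])
    then show ?thesis
      by (simp add: sum_proj_mult flip: sum_distrib_left)
  qed
  \<comment> \<open>Both summands vanish unless k is congruent to j, and then
    \<open>proj (int k) = proj j\<close>.\<close>
  also have "\<dots> = (\<Sum>k<l. proj (j + 2) * (E * proj (int k)))"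
  proof (intro sum.cong refl)
    fix k
    have "proj (j + 2) * (E * proj (int k)) = (if int l dvd int k - j then E * proj (int k) else 0)"
      by (simp add: proj_wt[OF wt_E[OF wt_proj]])
    moreover have "proj (int k) * proj j = (if int l dvd j - int k then proj j else 0)"
      by (rule proj_wt[OF wt_proj])
    moreover have "int l dvd j - int k \<longleftrightarrow> int l dvd int k - j"
      by (metis dvd_minus_iff minus_diff_eq)
    ultimately show "proj (j + 2) * (E * (proj (int k) * proj j)) = proj (j + 2) * (E * proj (int k))"
      using proj_cong[of "int k" j] by auto
  qed
  also have "\<dots> = proj (j + 2) * E"
    by (simp add: sum_proj flip: sum_distrib_left)
  finally show ?thesis .
qed

section \<open>Generalised eigenspaces of the Casimir element\<close>

lemma Zc_zz_pow: "zz c ^ n \<in> Zc" by (intro Zc_pow Zc_zz)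

lemma Zc_prod_list: "prod_list (map zz xs) \<in> Zc"
  by (induction xs) (auto intro: Zc_mult Zc_zz)

lemma cp_eq_prod_list: "cp g n = prod_list (map zz (map g [0..<n]))"
  by (induction n) auto

text \<open>On weight w the relation \<open>E ^ l = 0\<close> makes the product of the C - cc (w + 2
  s), s < l, vanish (\<open>F_pow_E_pow\<close>). The product over all residues w kills everything,
  and its roots lie in the base field.\<close>

lemma zz_annihilator: "\<exists>xs. set xs \<subseteq> range cc \<and> prod_list (map zz xs) = 0"
proof -
  have "\<exists>xs. set xs \<subseteq> range cc \<and> (\<forall>w<m. prod_list (map zz xs) * proj (int w) = 0)" for m
  proof (induction m)
    case 0
    show ?case by (rule exI[of _ "[]"]) auto
  next
    case (Suc m)
    then obtain xs where xs: "set xs \<subseteq> range cc" "\<And>w. w < m \<Longrightarrow> prod_list (map zz xs) * proj (int w) = 0"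
      by blast
    define ys where "ys = map (\<lambda>s. cc (int m + 2 * int s)) [0..<l]"
    have ys: "prod_list (map zz ys) * proj (int m) = 0"
      using F_pow_E_pow[OF wt_proj[of "int m"], of l] E_pow_l
      by (simp add: cp_eq_prod_list ys_def)
    have "prod_list (map zz (xs @ ys)) * proj (int w) = 0" if "w < Suc m" for w
    proof (cases "w = m")
      case True
      then show ?thesis using ys by (simp add: mult.assoc)
    next
      case False
      then have "prod_list (map zz ys) * (prod_list (map zz xs) * proj (int w)) = 0"
        using that xs by simp
      then show ?thesis
        by (simp add: mult.assoc Zc_left[OF Zc_prod_list Zc_alg[OF Zc_prod_list]])
    qed
    moreover have "set (xs @ ys) \<subseteq> range cc" using xs by (auto simp: ys_def)
    ultimately show ?case by blast
  qed
  from this[of l] obtain xs where xs: "set xs \<subseteq> range cc" "\<And>w. w < l \<Longrightarrow> prod_list (map zz xs) * proj (int w) = 0"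
    by blast
  have "prod_list (map zz xs) = (\<Sum>w<l. prod_list (map zz xs) * proj (int w))"
    by (simp add: sum_proj flip: sum_distrib_left)
  with xs show ?thesis by auto
qed

text \<open>Bezout identities with central coefficients, in place of coprimality of polynomials in
  C.\<close>

definition comax :: "'a \<Rightarrow> 'a \<Rightarrow> bool" where
  "comax a b \<longleftrightarrow> (\<exists>u\<in>Zc. \<exists>w\<in>Zc. u * a + w * b = 1)"

lemma comax_sym: "comax a b \<Longrightarrow> comax b a"
  unfolding comax_def by (metis add.commute)

lemma comax_mult:
  assumes "a \<in> Zc" "b \<in> Zc" "b' \<in> Zc" "comax a b" "comax a b'"
  shows "comax a (b * b')"
proof -
  obtain u w where 1: "u \<in> Zc" "w \<in> Zc" "u * a + w * b = 1" using assms by (auto simp: comax_def)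
  obtain u' w' where 2: "u' \<in> Zc" "w' \<in> Zc" "u' * a + w' * b' = 1" using assms by (auto simp: comax_def)
  have "1 = (u * a + w * b) * (u' * a + w' * b')" using 1 2 by simp
  also have "\<dots> = u * a * u' * a + u * (a * (w' * b')) + w * b * u' * a + w * (b * w') * b'"
    by (simp add: algebra_simps)
  also have "a * (w' * b') = w' * b' * a" using assms 2 by (intro Zc_comm Zc_alg Zc_mult)
  also have "b * w' = w' * b" using assms 2 by (intro Zc_comm Zc_alg)
  also have "u * a * u' * a + u * (w' * b' * a) + w * b * u' * a + w * (w' * b) * b'
    = (u * a * u' + u * w' * b' + w * b * u') * a + (w * w') * (b * b')"
    by (simp add: algebra_simps)
  finally have "(u * a * u' + u * w' * b' + w * b * u') * a + (w * w') * (b * b') = 1" ..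
  moreover have "u * a * u' + u * w' * b' + w * b * u' \<in> Zc" "w * w' \<in> Zc"
    using assms 1 2 by (auto intro!: Zc_add Zc_mult)
  ultimately show ?thesis unfolding comax_def by blast
qed

lemma comax_1: "comax a 1"
  unfolding comax_def by (intro bexI[of _ 0] bexI[of _ 1]) auto

lemma comax_zz: assumes "c \<noteq> c'" shows "comax (zz c) (zz c')"
proof -
  have "(1 / (c' - c)) *s 1 * zz c + (- 1 / (c' - c)) *s 1 * zz c' = (1 / (c' - c)) *s (zz c - zz c')"
    by (simp add: scale_mult_left scale_right_diff_distrib)
  also have "zz c - zz c' = (c' - c) *s 1" by (simp add: zz_def scale_left_diff_distrib)
  also have "(1 / (c' - c)) *s (c' - c) *s 1 = 1" using assms by simp
  finally show ?thesis unfolding comax_def using Zc_scalar by blast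
qed

lemma comax_pow: "a \<in> Zc \<Longrightarrow> b \<in> Zc \<Longrightarrow> comax a b \<Longrightarrow> comax (a ^ n) b"
  by (induction n) (auto intro: comax_sym comax_1 comax_mult Zc_pow)

lemma prod_list_zz_split:
  "\<exists>n b. b \<in> Zc \<and> prod_list (map zz xs) = zz c ^ n * b \<and> comax (zz c) b"
proof (induction xs)
  case Nil
  show ?case by (rule exI[of _ 0], rule exI[of _ 1]) (simp add: comax_1)
next
  case (Cons x xs)
  then obtain n b where b: "b \<in> Zc" "prod_list (map zz xs) = zz c ^ n * b" "comax (zz c) b" by blast
  show ?case
  proof (cases "x = c")
    case True
    with b show ?thesis by (intro exI[of _ "Suc n"] exI[of _ b]) (simp add: mult.assoc)
  next
    case False
    then have "comax (zz c) (zz x * b)" using b by (intro comax_mult comax_zz Zc_zz) auto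
    moreover have "zz x * (zz c ^ n * b) = zz c ^ n * (zz x * b)"
      by (rule Zc_left[OF Zc_zz Zc_alg[OF Zc_zz_pow]])
    ultimately show ?thesis using b
      by (intro exI[of _ n] exI[of _ "zz x * b"]) (auto intro: Zc_mult Zc_zz)
  qed
qed

text \<open>\<open>e\<close> is the idempotent onto the generalised eigenspace of \<open>C\<close> for \<open>c\<close>, which may be 0.\<close>

definition is_e :: "'k \<Rightarrow> 'a \<Rightarrow> bool" where
  "is_e c e \<longleftrightarrow> e \<in> Zc \<and> e * e = e \<and> (\<exists>n. zz c ^ n * e = 0) \<and> (\<exists>u\<in>Zc. 1 - e = u * zz c)"

text \<open>The annihilating product splits into a power of C - c and a factor b comaximal with C -
  c. In the Bezout identity for a power of C - c and b, the multiple of b is the idempotent.\<close>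

lemma ex_is_e: "\<exists>e. is_e c e"
proof -
  obtain xs where xs: "prod_list (map zz xs) = 0" using zz_annihilator by blast
  obtain n b where b: "b \<in> Zc" "zz c ^ n * b = 0" "comax (zz c) b"
    using prod_list_zz_split[of xs c] xs by auto
  \<comment> \<open>The exponent is \<open>Suc n\<close> so that 1 - e keeps a factor
    \<open>zz c\<close> even for n = 0, when c is no root of the annihilating product and e is
    0.\<close>
  have "comax (zz c ^ Suc n) b" using b by (intro comax_pow Zc_zz)
  then obtain u w where u: "u \<in> Zc" "w \<in> Zc" "u * zz c ^ Suc n + w * b = 1"
    by (auto simp: comax_def)
  define e where "e = w * b"
  have eZ: "e \<in> Zc" using b u by (simp add: e_def Zc_mult)
  have 0: "zz c ^ Suc n * e = 0"
  proof -
    have "zz c ^ Suc n * e = w * (zz c ^ Suc n * b)"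
      unfolding e_def by (rule Zc_left[OF Zc_zz_pow Zc_alg[OF u(2)]])
    also have "zz c ^ Suc n * b = zz c * (zz c ^ n * b)" by (simp add: mult.assoc)
    finally show ?thesis using b by simp
  qed
  have e1: "1 - e = u * zz c ^ Suc n" using u(3) by (simp add: e_def algebra_simps)
  have "(1 - e) * e = 0" unfolding e1 using 0 by (simp add: mult.assoc)
  then have "e * e = e" by (simp add: left_diff_distrib)
  moreover have "1 - e = (u * zz c ^ n) * zz c" using e1 by (simp add: mult.assoc power_commutes)
  moreover have "u * zz c ^ n \<in> Zc" using u Zc_zz_pow Zc_mult by blast
  ultimately show ?thesis using eZ 0 unfolding is_e_def by blast
qed

lemma is_e_Zc: "is_e c e \<Longrightarrow> e \<in> Zc" and is_e_idem: "is_e c e \<Longrightarrow> e * e = e"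
  by (auto simp: is_e_def)

lemma Zc_pow_mult: assumes "u \<in> Zc" "z \<in> Zc" shows "(u * z) ^ n = u ^ n * z ^ n"
proof (induction n)
  case (Suc n)
  have "(u * z) ^ Suc n = u * (z * u ^ n) * z ^ n" using Suc by (simp add: mult.assoc)
  also have "z * u ^ n = u ^ n * z" using assms by (intro Zc_comm Zc_alg Zc_pow)
  finally show ?case by (simp add: mult.assoc)
qed simp

text \<open>1 - e is an idempotent multiple of C - c, hence a multiple of every power of C -
  c.\<close>

lemma is_e_fix: assumes "is_e c e" "zz c ^ m * x = 0" shows "e * x = x"
proof -
  obtain u where u: "u \<in> Zc" "1 - e = u * zz c" using assms by (auto simp: is_e_def)
  have "(1 - e) * (1 - e) = 1 - e" using is_e_idem[OF assms(1)] by (simp add: algebra_simps)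
  then have "(1 - e) ^ Suc m = 1 - e"
    by (induction m) auto
  then have "(1 - e) * x = (1 - e) ^ Suc m * x" by simp
  also have "\<dots> = u ^ Suc m * (zz c ^ Suc m * x)"
    using u by (simp only: Zc_pow_mult[OF u(1) Zc_zz] mult.assoc)
  also have "zz c ^ Suc m * x = zz c * (zz c ^ m * x)" by (simp add: mult.assoc)
  finally show ?thesis using assms by (simp add: left_diff_distrib)
qed

lemma zz_pow_eigen: "zz c' * y = 0 \<Longrightarrow> zz c ^ n * y = (c' - c) ^ n *s y"
proof (induction n)
  case (Suc n)
  have "C * y = c' *s y" using Suc.prems by (simp add: zz_mult)
  then have "zz c * y = (c' - c) *s y" by (simp add: zz_mult scale_left_diff_distrib)
  moreover have "zz c ^ Suc n * y = zz c ^ n * (zz c * y)"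
    by (simp add: power_commutes flip: mult.assoc)
  ultimately show ?case using Suc by (simp add: scale_mult_right)
qed simp

lemma is_e_inj: assumes "is_e c e" "e * y = y" "zz c' * y = 0" "c \<noteq> c'" shows "y = 0"
proof -
  obtain n where "zz c ^ n * e = 0" using assms by (auto simp: is_e_def)
  then have "zz c ^ n * y = 0" using assms(2) by (metis mult.assoc mult_zero_left)
  then show ?thesis using zz_pow_eigen[OF assms(3), of c n] assms(4) by simp
qed

lemma is_e_uniq: assumes "is_e c e" "is_e c e'" shows "e = e'"
proof -
  have "e * e' = e'" using is_e_fix[OF assms(1)] assms(2) by (auto simp: is_e_def)
  moreover have "e' * e = e" using is_e_fix[OF assms(2)] assms(1) by (auto simp: is_e_def)
  moreover have "e * e' = e' * e" using assms by (auto simp: is_e_def intro: Zc_comm Zc_alg)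
  ultimately show ?thesis by simp
qed

section \<open>Strings of weights in a block\<close>

lemma not_dvd_small: "0 < a \<Longrightarrow> a < int l \<Longrightarrow> \<not> int l dvd a"
  by (simp add: zdvd_not_zless)

text \<open>The weights i - 2 m are those below the top in the simple module of highest weight i.
  Equality would make l divide 2 m or 2 (i - m + 1); as l is odd, it would divide m or i - m + 1,
  which lie strictly between 0 and l.\<close>

lemma cc_ne_chain:
  assumes "0 < m" "m \<le> i" "i < int l" shows "cc i \<noteq> cc (i - 2 * m)"
proof -
  have "i - (i - 2 * m) = 2 * m" "i + (i - 2 * m) + 2 = 2 * (i - m + 1)" by auto
  then show ?thesis unfolding cc_eq_iff
    using odd_dvd[of m] odd_dvd[of "i - m + 1"] assms not_dvd_small[of m] not_dvd_small[of "i - m + 1"] by auto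
qed

text \<open>Vanishing propagates down the string from its top: E maps each weight space into the one
  above, where f vanishes, so a vector f v there would be an eigenvector of C for a value other than
  cc i, which the block excludes (\<open>is_e_inj\<close>).\<close>

lemma chain:
  assumes e: "is_e (cc i) e" and i: "i < int l"
    and f: "f \<in> Zc" "f * e = f" and 0: "f * proj i = 0" and m: "int m \<le> i"
  shows "f * proj (i - 2 * int m) = 0"
  using m
proof (induction m)
  case (Suc m)
  let ?w = "i - 2 * int (Suc m)"
  let ?y = "f * proj ?w"
  have wt: "wt ?w ?y" using f(1) wt_proj by (rule Zc_wt)
  have "E * ?y = f * (E * proj ?w)" using Zc_left[OF f(1) alg_E] by simp
  also have "\<dots> = f * proj (?w + 2) * E" by (simp only: E_proj mult.assoc)
  also have "?w + 2 = i - 2 * int m" by simp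
  finally have "E * ?y = 0" using Suc by simp
  then have z: "zz (cc ?w) * ?y = 0" using FE_wt[OF wt] by simp
  have "e * ?y = ?y"
    using f Zc_comm[OF f(1) Zc_alg[OF is_e_Zc[OF e]]] by (simp flip: mult.assoc)
  moreover have "cc i \<noteq> cc ?w" using Suc.prems i by (intro cc_ne_chain) auto
  ultimately show ?case using is_e_inj[OF e _ z] by blast
qed (use 0 in simp)

text \<open>With h the inverse of 2 modulo l, every j is i - 2 m for some m with 0 \<le> m < l. For
  m \<le> i this is the string of i; the rest starts at i - 2 (i + 1) = - i - 2, which is l - 2 - i
  modulo l, hence the shift of m by i + 1. For i = l - 1 the second string is empty.\<close>

lemma weights_cover:
  assumes "0 \<le> i" "i < int l"
  obtains m where "int m \<le> i" "int l dvd j - (i - 2 * int m)"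
  | m where "int m \<le> int l - 2 - i" "int l dvd j - (int l - 2 - i - 2 * int m)"
proof -
  define h where "h = (int l + 1) div 2"
  have h: "2 * h = int l + 1" using odd_l unfolding h_def by presburger
  define m where "m = ((i - j) * h) mod int l"
  have m: "0 \<le> m" "m < int l" using l3 by (auto simp: m_def)
  have "int l dvd (i - j) * h - m" unfolding m_def by (simp add: mod_eq_dvd_iff[symmetric])
  then have "int l dvd 2 * ((i - j) * h - m)" by (rule dvd_mult)
  also have "2 * ((i - j) * h - m) = (i - j) * (int l + 1) - 2 * m" by (simp add: h[symmetric])
  also have "\<dots> = int l * (i - j) + (i - j - 2 * m)" by (simp add: algebra_simps)
  finally have d: "int l dvd i - j - 2 * m" by (simp add: dvd_add_right_iff)
  show ?thesis
  proof (cases "m \<le> i")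
    case True
    have "j - (i - 2 * m) = - (i - j - 2 * m)" by simp
    then have "int l dvd j - (i - 2 * m)" using d by (metis dvd_minus_iff)
    then show ?thesis using that(1)[of "nat m"] True m by simp
  next
    case False
    have "j - (int l - 2 - i - 2 * (m - i - 1)) = - (i - j - 2 * m) - int l" by simp
    then have "int l dvd j - (int l - 2 - i - 2 * (m - i - 1))" using d by (metis dvd_diff dvd_minus_iff dvd_refl)
    then show ?thesis using that(2)[of "nat (m - i - 1)"] False m by simp
  qed
qed

text \<open>Both strings of weights of the block begin where f vanishes, and together they exhaust
  all residues.\<close>

lemma Zc_eq_0I:
  assumes e: "is_e (cc i) e" and i: "0 \<le> i" "i < int l"
    and f: "f \<in> Zc" "f * e = f" and 0: "f * proj i = 0"
    and 1: "i = int l - 1 \<or> f * proj (int l - 2 - i) = 0"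
  shows "f = 0"
proof -
  have "f * proj j = 0" for j
    using i
  proof (cases rule: weights_cover[where j = j])
    case (1 m)
    then show ?thesis using chain[OF e i(2) f 0, of m] proj_cong by metis
  next
    case (2 m)
    then have "is_e (cc (int l - 2 - i)) e" "i \<noteq> int l - 1"
      using e cc_eq_iff[of i "int l - 2 - i"] by auto
    moreover have "f * proj (int l - 2 - i) = 0" "int l - 2 - i < int l"
      using 1 i \<open>i \<noteq> int l - 1\<close> by auto
    ultimately have "f * proj (int l - 2 - i - 2 * int m) = 0"
      using chain[of "int l - 2 - i" e f m] f 2 by blast
    then show ?thesis using proj_cong[OF 2(2)] by simp
  qed
  then show ?thesis by (metis (no_types, lifting) mult_1_right sum.neutral sum_distrib_left sum_proj)
qed

section \<open>Primitivity of the block idempotents\<close>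

text \<open>The span of the monomials with F on the left and E on the right; linear independence is
  not claimed. Powers of L are covered because L is a power of K (\<open>L_eq\<close>).\<close>

inductive_set pbw :: "'a set" where
  pbw_0: "0 \<in> pbw"
| pbw_add: "x \<in> pbw \<Longrightarrow> x + c *s (F ^ a * (K ^ b * E ^ d)) \<in> pbw"

lemma pbw_add_closed: "y \<in> pbw \<Longrightarrow> x \<in> pbw \<Longrightarrow> x + y \<in> pbw"
  by (induction y rule: pbw.induct) (auto simp: add.assoc[symmetric] intro: pbw.intros)

lemma pbw_scale: "x \<in> pbw \<Longrightarrow> c *s x \<in> pbw"
  by (induction x rule: pbw.induct) (auto simp: scale_right_distrib intro: pbw.intros)

lemma pbw_monomial: "F ^ a * (K ^ b * E ^ d) \<in> pbw"
  using pbw_add[OF pbw_0, of 1] by simp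

lemma L_eq: "L = K ^ (l - 1)"
proof -
  have "K * K ^ (l - 1) = 1" using K_pow_l l3 by (metis power_eq_if not_numeral_le_zero)
  then show ?thesis by (metis LK mult.assoc mult_1_left mult_1_right)
qed

lemma K_F: "K * F = (1 / q\<^sup>2) *s (F * K)"
  by (simp add: FK)

lemma K_F_pow: "K * F ^ a = (1 / q\<^sup>2) ^ a *s (F ^ a * K)"
proof (induction a)
  case (Suc a)
  have "K * F ^ Suc a = (K * F) * F ^ a" by (simp add: mult.assoc)
  also have "\<dots> = (1 / q\<^sup>2) *s (F * (K * F ^ a))"
    by (simp only: K_F scale_mult_left mult.assoc)
  finally show ?case by (simp only: Suc scale_mult_right scale_scale mult.assoc power_Suc)
qed simp

text \<open>The values of the two coefficients are irrelevant for spanning and stay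
  existential.\<close>

lemma E_F_pow: "\<exists>\<alpha> \<beta>. E * F ^ Suc a = F ^ Suc a * E + \<alpha> *s (F ^ a * K) + \<beta> *s (F ^ a * L)"
proof (induction a)
  case 0
  show ?case
    by (intro exI[of _ "1 / (q - 1 / q)"] exI[of _ "- 1 / (q - 1 / q)"])
       (simp add: EF scale_right_diff_distrib)
next
  case (Suc a)
  then obtain \<alpha> \<beta> where *: "E * F ^ Suc a = F ^ Suc a * E + \<alpha> *s (F ^ a * K) + \<beta> *s (F ^ a * L)" by blast
  let ?k = "1 / (q - 1 / q)"
  have "E * F ^ Suc (Suc a) = E * F ^ Suc a * F"
    by (simp only: power_Suc2[of F "Suc a"] mult.assoc)
  also have "\<dots> = F ^ Suc a * (E * F) + \<alpha> *s (F ^ a * (K * F)) + \<beta> *s (F ^ a * (L * F))"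
    unfolding * by (simp add: distrib_right scale_mult_left mult.assoc)
  also have "\<dots> = F ^ Suc a * F * E + (\<alpha> * (1 / q\<^sup>2)) *s (F ^ a * F * K) + ?k *s (F ^ Suc a * K)
     + (\<beta> * q\<^sup>2) *s (F ^ a * F * L) - ?k *s (F ^ Suc a * L)"
    by (simp add: EF K_F LF distrib_left right_diff_distrib scale_mult_right scale_right_diff_distrib mult.assoc)
  also have "F ^ Suc a * F = F ^ Suc (Suc a)" by (simp only: power_Suc2)
  also have "F ^ a * F = F ^ Suc a" by (simp only: power_Suc2)
  finally show ?case
    by (intro exI[of _ "\<alpha> * (1 / q\<^sup>2) + ?k"] exI[of _ "\<beta> * q\<^sup>2 - ?k"])
       (simp add: scale_left_distrib scale_left_diff_distrib)
qed

lemma E_K_pow: "E * K ^ b = (1 / q\<^sup>2) ^ b *s (K ^ b * E)"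
proof (induction b)
  case (Suc b)
  have "E * K ^ Suc b = (E * K) * K ^ b" by (simp add: mult.assoc)
  also have "\<dots> = (1 / q\<^sup>2) *s (K * (E * K ^ b))"
    by (simp only: EK' scale_mult_left mult.assoc)
  finally show ?case by (simp only: Suc scale_mult_right scale_scale mult.assoc power_Suc)
qed simp

lemma pbw_F: "x \<in> pbw \<Longrightarrow> F * x \<in> pbw"
proof (induction x rule: pbw.induct)
  case (pbw_add x c a b d)
  then show ?case using pbw.pbw_add[of "F * x" c "Suc a" b d]
    by (simp add: distrib_left scale_mult_right mult.assoc)
qed (simp add: pbw_0)

lemma pbw_K: "x \<in> pbw \<Longrightarrow> K * x \<in> pbw"
proof (induction x rule: pbw.induct)
  case (pbw_add x c a b d)
  have "K * (F ^ a * (K ^ b * E ^ d)) = (1 / q\<^sup>2) ^ a *s (F ^ a * (K ^ Suc b * E ^ d))"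
    using K_F_pow[of a] by (metis (no_types, lifting) mult.assoc power_Suc scale_mult_left)
  then show ?case using pbw.pbw_add[OF pbw_add.IH, of "c * (1 / q\<^sup>2) ^ a" a "Suc b" d]
    by (simp only: distrib_left scale_mult_right scale_scale)
qed (simp add: pbw_0)

lemma pbw_K_pow: "x \<in> pbw \<Longrightarrow> K ^ n * x \<in> pbw"
  by (induction n) (auto simp: mult.assoc intro: pbw_K)

lemma pbw_E: "x \<in> pbw \<Longrightarrow> E * x \<in> pbw"
proof (induction x rule: pbw.induct)
  case (pbw_add x c a b d)
  have 0: "E * (K ^ b * E ^ d) = (1 / q\<^sup>2) ^ b *s (K ^ b * E ^ Suc d)" for b d
    using E_K_pow[of b] by (metis (no_types, lifting) mult.assoc power_Suc scale_mult_left)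
  have "E * (F ^ a * (K ^ b * E ^ d)) \<in> pbw"
  proof (cases a)
    case 0
    with \<open>E * (K ^ b * E ^ d) = _\<close> show ?thesis
      using pbw_scale[OF pbw_monomial[of 0 b "Suc d"]] by simp
  next
    case (Suc a')
    obtain \<alpha> \<beta> where *: "E * F ^ Suc a' = F ^ Suc a' * E + \<alpha> *s (F ^ a' * K) + \<beta> *s (F ^ a' * L)"
      using E_F_pow by blast
    have "E * (F ^ Suc a' * (K ^ b * E ^ d)) = (E * F ^ Suc a') * (K ^ b * E ^ d)"
      by (simp only: mult.assoc)
    also have "\<dots> = F ^ Suc a' * (E * (K ^ b * E ^ d)) + \<alpha> *s (F ^ a' * (K ^ Suc b * E ^ d))
       + \<beta> *s (F ^ a' * (K ^ (l - 1 + b) * E ^ d))"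
      unfolding * by (simp add: distrib_right scale_mult_left mult.assoc L_eq power_add)
    finally show ?thesis
      using Suc by (simp only: 0 scale_mult_right) (intro pbw_add_closed pbw_scale pbw_monomial)
  qed
  then show ?case using pbw_add.IH
    by (simp add: distrib_left scale_mult_right pbw_add_closed pbw_scale)
qed (simp add: pbw_0)

lemma alg_pbw: "a \<in> alg \<Longrightarrow> a \<in> pbw"
proof -
  have "\<forall>x\<in>pbw. a * x \<in> pbw" if "a \<in> alg" for a
    using that
  proof induction
    case alg_L
    then show ?case by (simp add: L_eq pbw_K_pow)
  qed (auto simp: scale_mult_left distrib_right mult.assoc pbw_scale pbw_E pbw_F pbw_K pbw_add_closed)
  moreover have "1 \<in> pbw" using pbw_monomial[of 0 0 0] by simp
  ultimately show "a \<in> alg \<Longrightarrow> a \<in> pbw" by force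
qed

section \<open>Idempotents on a single weight space\<close>

lemma cp_Suc_factor: "\<exists>h\<in>Zc. cp g (Suc n) = h * zz (g 0)"
proof (induction n)
  case 0
  show ?case by (rule bexI[of _ 1]) auto
next
  case (Suc n)
  then obtain h where h: "h \<in> Zc" "cp g (Suc n) = h * zz (g 0)" by blast
  then have "cp g (Suc (Suc n)) = h * (zz (g 0) * zz (g (Suc n)))" by (simp add: mult.assoc)
  also have "zz (g 0) * zz (g (Suc n)) = zz (g (Suc n)) * zz (g 0)"
    by (intro Zc_comm Zc_zz alg_zz)
  finally show ?case using h(1)
    by (intro bexI[of _ "h * zz (g (Suc n))"]) (simp_all only: mult.assoc Zc_mult Zc_zz)
qed

text \<open>The weight forces a and d to be congruent modulo l and nilpotency bounds both by l, so a
  nonzero contribution has a = d. For a = 0 it is a scalar; for a > 0 the polynomial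
  \<open>F ^ a * E ^ a\<close> in C contains the factor C - cc j.\<close>

lemma proj_monomial:
  "\<exists>\<gamma>. \<exists>h\<in>Zc. proj j * (F ^ a * (K ^ b * E ^ d) * proj j) = \<gamma> *s proj j + h * (zz (cc j) * proj j)"
proof -
  let ?x = "F ^ a * (E ^ d * proj j)"
  have wtE: "wt (j + 2 * int d) (E ^ d * proj j)" by (rule wt_E_pow[OF wt_proj])
  have wtF: "wt (j + 2 * int d - 2 * int a) ?x" by (rule wt_F_pow[OF wtE])
  let ?s = "q powi ((j + 2 * int d) * int b)"
  have eq: "proj j * (F ^ a * (K ^ b * E ^ d) * proj j) = ?s *s (proj j * ?x)"
    using wt_K_pow[OF wtE, of b] by (simp add: mult.assoc scale_mult_right)
  show ?thesis
  proof (cases "a < l \<and> d < l \<and> int l dvd 2 * (int d - int a)")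
    case False
    have "proj j * ?x = 0"
    proof (cases "a < l \<and> d < l")
      case True
      with False have "\<not> int l dvd j + 2 * int d - 2 * int a - j" by (simp add: algebra_simps)
      then show ?thesis by (simp add: proj_wt[OF wtF])
    next
      case False
      have "x ^ m = 0" if "x ^ l = 0" "\<not> m < l" for x :: 'a and m
        using that by (metis le_add_diff_inverse linorder_not_less mult_zero_left power_add)
      then have "F ^ a = 0 \<or> E ^ d = 0" using False E_pow_l F_pow_l by blast
      then show ?thesis by auto
    qed
    then show ?thesis unfolding eq by (intro exI[of _ 0] bexI[of _ 0]) auto
  next
    case True
    then have "int l dvd int d - int a" using odd_dvd by blast
    moreover have "\<not> int l dvd int d - int a" if "a < d"
      using that True by (intro not_dvd_small) auto
    moreover have "\<not> int l dvd int a - int d" if "d < a"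
      using that True by (intro not_dvd_small) auto
    ultimately have "a = d" by (metis dvd_minus_iff linorder_neqE_nat minus_diff_eq)
    then have px: "proj j * ?x = cp (\<lambda>s. cc (j + 2 * int s)) d * proj j"
      using F_pow_E_pow[OF wt_proj, of d j] proj_wt_same[OF wtF] by simp
    show ?thesis
    proof (cases d)
      case 0
      then show ?thesis unfolding eq px by (intro exI[of _ ?s] bexI[of _ 0]) auto
    next
      case (Suc n)
      then obtain h where h: "h \<in> Zc" "cp (\<lambda>s. cc (j + 2 * int s)) d = h * zz (cc j)"
        using cp_Suc_factor[of "\<lambda>s. cc (j + 2 * int s)" n] by auto
      then show ?thesis unfolding eq px
        by (intro exI[of _ 0] bexI[of _ "?s *s h"]) (auto simp: scale_mult_left mult.assoc intro: Zc_scale)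
    qed
  qed
qed

text \<open>The corner of the algebra at a weight consists of scalars plus multiples of C - cc j. As
  C - cc j is nilpotent on the block, the corner is local there, and a local ring has only trivial
  idempotents.\<close>

lemma proj_alg_proj:
  assumes "a \<in> alg"
  shows "\<exists>\<gamma>. \<exists>h\<in>Zc. proj j * (a * proj j) = \<gamma> *s proj j + h * (zz (cc j) * proj j)"
  using alg_pbw[OF assms]
proof induction
  case pbw_0
  show ?case by (intro exI[of _ 0] bexI[of _ 0]) auto
next
  case (pbw_add x c a b d)
  then obtain \<gamma> h where 1: "h \<in> Zc" "proj j * (x * proj j) = \<gamma> *s proj j + h * (zz (cc j) * proj j)" by blast
  obtain \<gamma>' h' where 2: "h' \<in> Zc" "proj j * (F ^ a * (K ^ b * E ^ d) * proj j) = \<gamma>' *s proj j + h' * (zz (cc j) * proj j)"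
    using proj_monomial by blast
  have "proj j * ((x + c *s (F ^ a * (K ^ b * E ^ d))) * proj j)
      = proj j * (x * proj j) + c *s (proj j * (F ^ a * (K ^ b * E ^ d) * proj j))"
    by (simp only: distrib_left distrib_right scale_mult_left scale_mult_right)
  also have "\<dots> = (\<gamma> + c * \<gamma>') *s proj j + (h + c *s h') * (zz (cc j) * proj j)"
    unfolding 1 2 by (simp add: scale_left_distrib scale_right_distrib distrib_right scale_mult_left)
  finally show ?case using 1 2 Zc_add Zc_scale by blast
qed

text \<open>Nakayama's argument: iterating the equation multiplies D by arbitrarily high powers of C
  - c.\<close>

lemma nilpotent_eq_0:
  assumes "t \<in> Zc" "D = t * (zz c * D)" "zz c ^ n * D = 0"
  shows "D = 0"
proof -
  have "D = (t * zz c) ^ m * D" for m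
  proof (induction m)
    case (Suc m)
    have "(t * zz c) ^ Suc m * D = (t * zz c) ^ m * (t * (zz c * D))"
      by (simp only: power_Suc2 mult.assoc)
    then show ?case using assms(2) Suc by simp
  qed simp
  also have "(t * zz c) ^ n * D = t ^ n * (zz c ^ n * D)"
    by (simp only: Zc_pow_mult[OF assms(1) Zc_zz] mult.assoc)
  finally show ?thesis using assms(3) by simp
qed

text \<open>Modulo C - cc j the idempotent f acts on weight j as a scalar \<gamma>. Multiplying this
  relation by f gives (1 - \<gamma>) D = h (C - cc j) D for D = f proj j, so D = 0 by nilpotency
  unless \<gamma> = 1; for \<gamma> = 1 the same argument applies to e - f.\<close>

lemma idempotent_on_weight:
  assumes e: "is_e (cc j) e" and f: "f \<in> Zc" "f * f = f" "f * e = f"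
  shows "f * proj j = 0 \<or> f * proj j = e * proj j"
proof -
  obtain \<gamma> h where h: "h \<in> Zc" "proj j * (f * proj j) = \<gamma> *s proj j + h * (zz (cc j) * proj j)"
    using proj_alg_proj Zc_alg[OF f(1)] by blast
  have pp: "proj j * proj j = proj j" by (rule proj_wt_same[OF wt_proj])
  have fp: "f * proj j = \<gamma> *s proj j + h * (zz (cc j) * proj j)"
    using h(2) Zc_left[OF f(1) alg_proj, of j "proj j"] pp by simp
  obtain n where n: "zz (cc j) ^ n * e = 0" using e by (auto simp: is_e_def)
  have comm: "g * (h * (zz (cc j) * proj j)) = h * (zz (cc j) * (g * proj j))" if "g \<in> Zc" for g
    using Zc_left[OF that Zc_alg[OF h(1)]] Zc_left[OF that alg_zz] by simp
  have ef: "e * f = f" using f(3) Zc_comm[OF f(1) Zc_alg[OF is_e_Zc[OF e]]] by simp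
  have nil: "zz (cc j) ^ n * (g * proj j) = 0" if "e * g = g" for g
    by (metis n that mult.assoc mult_zero_left)
  show ?thesis
  proof (cases "\<gamma> = 1")
    case False
    let ?D = "f * proj j"
    have "?D = f * ?D" by (simp add: f mult.assoc[symmetric])
    also have "f * ?D = f * (\<gamma> *s proj j + h * (zz (cc j) * proj j))" by (simp only: fp)
    also have "\<dots> = \<gamma> *s ?D + h * (zz (cc j) * ?D)"
      by (simp add: distrib_left scale_mult_right comm[OF f(1)])
    finally have "(1 - \<gamma>) *s ?D = h * (zz (cc j) * ?D)"
      by (simp add: scale_left_diff_distrib diff_eq_eq add.commute)
    then have "(1 / (1 - \<gamma>)) *s (1 - \<gamma>) *s ?D = ((1 / (1 - \<gamma>)) *s h) * (zz (cc j) * ?D)"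
      by (simp add: scale_mult_left)
    then have "?D = ((1 / (1 - \<gamma>)) *s h) * (zz (cc j) * ?D)" using False by simp
    then have "?D = 0" using nilpotent_eq_0[OF Zc_scale[OF h(1)] _ nil[OF ef]] by blast
    then show ?thesis ..
  next
    case True
    let ?g = "e - f"
    let ?D = "?g * proj j"
    have g: "?g \<in> Zc" "e * ?g = ?g" "?g * ?g = ?g" "?g * f = 0"
      using e f ef by (auto simp: is_e_def right_diff_distrib left_diff_distrib intro: Zc_diff)
    have "0 = ?g * (f * proj j)" using g(4) by (simp add: mult.assoc[symmetric])
    also have "\<dots> = ?D + h * (zz (cc j) * ?D)"
      unfolding fp using True by (simp add: distrib_left comm[OF g(1)])
    finally have "?D = (- 1 *s h) * (zz (cc j) * ?D)"
      by (simp add: scale_mult_left eq_neg_iff_add_eq_0)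
    then have "?D = 0" using nilpotent_eq_0[OF Zc_scale[OF h(1)] _ nil[OF g(2)]] by blast
    then show ?thesis by (simp add: left_diff_distrib)
  qed
qed

text \<open>At each of the two top weights f agrees with 0 or with e. If it makes the same choice at
  both, \<open>Zc_eq_0I\<close> applies to f or to e - f. Opposite choices are excluded by the link:
  E would carry a part of weight i that belongs to one of the idempotents into weights that belong
  to the other.\<close>

lemma block_idempotent_primitive:
  assumes e: "is_e (cc i) e" and i: "0 \<le> i" "i < int l"
    and link: "i = int l - 1 \<or> e * proj (int l - 2 - i) = 0 \<or> E * (proj i * e) \<noteq> 0"
    and f: "f \<in> Zc" "f * f = f" "f * e = f"
  shows "f = 0 \<or> f = e"
proof -
  have eZ: "e \<in> Zc" and ee: "e * e = e" using e by (auto simp: is_e_def)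
  have main: "f = 0" if f: "f \<in> Zc" "f * f = f" "f * e = f" and 0: "f * proj i = 0" for f
  proof (cases "i = int l - 1 \<or> f * proj (int l - 2 - i) = 0")
    case True
    then show ?thesis using Zc_eq_0I[OF e i f(1,3) 0] by blast
  next
    case False
    let ?i = "int l - 2 - i"
    have e': "is_e (cc ?i) e" using e cc_eq_iff[of i ?i] by simp
    have i': "0 \<le> ?i" "?i < int l" using False i by auto
    have "f * proj ?i = e * proj ?i" using idempotent_on_weight[OF e' f] False by blast
    then have g0: "(e - f) * proj ?i = 0" by (simp add: left_diff_distrib)
    have g: "e - f \<in> Zc" "(e - f) * e = e - f"
      using eZ f ee by (auto simp: left_diff_distrib intro: Zc_diff)
    have "(e - f) * proj (?i - 2 * int (nat ?i)) = 0"
      by (rule chain[OF e' i'(2) g g0]) (use i' in simp)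
    \<comment> \<open>The bottom of the string of l - 2 - i is -(l - 2 - i), which is i + 2 modulo
      l: E leads from the top of one string to the bottom of the other.\<close>
    moreover have "int l dvd (?i - 2 * int (nat ?i)) - (i + 2)" using i' by simp
    ultimately have g2: "(e - f) * proj (i + 2) = 0" using proj_cong by metis
    have "E * (proj i * e) = E * (e * proj i)" using Zc_comm[OF eZ alg_proj] by simp
    also have "e * proj i = (e - f) * proj i" by (simp add: left_diff_distrib 0)
    also have "E * ((e - f) * proj i) = (e - f) * (E * proj i)"
      using Zc_left[OF g(1) alg_E] by simp
    also have "\<dots> = 0" by (simp add: E_proj g2 mult.assoc[symmetric])
    finally have "e * proj ?i = 0" using link False by auto
    moreover have "f * proj ?i = f * (e * proj ?i)" by (simp add: mult.assoc[symmetric] f)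
    ultimately show ?thesis using False by simp
  qed
  show ?thesis
  proof (cases "f * proj i = 0")
    case True
    then show ?thesis using main[OF f] by blast
  next
    case False
    then have g0: "(e - f) * proj i = 0"
      using idempotent_on_weight[OF e f] by (simp add: left_diff_distrib)
    have ef: "e * f = f" using f(3) Zc_comm[OF f(1) Zc_alg[OF eZ]] by simp
    have "(e - f) * (e - f) = e - f" "(e - f) * e = e - f"
      by (simp_all add: left_diff_distrib right_diff_distrib ee ef f(2,3))
    then have "e - f = 0" using main[OF Zc_diff[OF eZ f(1)]] g0 by blast
    then show ?thesis by simp
  qed
qed

text \<open>If g met no block, then g = g (1 - e) for every root c of the annihilating product, so g
  would be divisible by each factor C - c in turn and finally by the product, which is 0.\<close>

lemma ex_block_of_idempotent:
  assumes g: "g \<in> Zc" "g \<noteq> 0"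
  obtains i e where "0 \<le> i" "i < int l" "is_e (cc i) e" "g * e \<noteq> 0"
proof -
  obtain xs where xs: "set xs \<subseteq> range cc" "prod_list (map zz xs) = 0" using zz_annihilator by blast
  have "\<exists>u\<in>Zc. g = g * (u * prod_list (map zz ys))"
    if "\<And>c e. c \<in> set ys \<Longrightarrow> is_e c e \<Longrightarrow> g * e = 0" for ys
    using that
  proof (induction ys)
    case Nil
    then show ?case by (intro bexI[of _ 1]) auto
  next
    case (Cons c ys)
    then obtain u where u: "u \<in> Zc" "g = g * (u * prod_list (map zz ys))" by auto
    obtain e where e: "is_e c e" using ex_is_e by blast
    then obtain w where w: "w \<in> Zc" "1 - e = w * zz c" by (auto simp: is_e_def)
    have "g = g * (1 - e)" using Cons.prems[of c e] e by (simp add: right_diff_distrib)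
    then have "g = g * (w * zz c)" using w by simp
    then have "g = g * (u * prod_list (map zz ys)) * (w * zz c)" using u(2) by simp
    also have "\<dots> = g * (u * (prod_list (map zz ys) * (w * zz c)))" by (simp only: mult.assoc)
    also have "prod_list (map zz ys) * (w * zz c) = (w * zz c) * prod_list (map zz ys)"
      using w Zc_prod_list by (intro Zc_comm Zc_alg Zc_mult Zc_zz)
    also have "g * (u * (w * zz c * prod_list (map zz ys))) = g * ((u * w) * prod_list (map zz (c # ys)))"
      by (simp add: mult.assoc)
    finally show ?case using u w Zc_mult by blast
  qed
  from this[of xs] obtain c e where c: "c \<in> set xs" "is_e c e" "g * e \<noteq> 0"
    using xs(2) g by auto
  then obtain j where j: "c = cc j" using xs by auto
  have "cc j = cc (j mod int l)" unfolding cc_eq_iff by (simp add: mod_eq_dvd_iff[symmetric])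
  then show ?thesis using that[of "j mod int l" e] c j l3 by simp
qed

section \<open>Blocks with a single highest weight\<close>

text \<open>For i < l - 1 the target weight i + 2 is the bottom of the other string, which is
  absent. For i = l - 1 there is no other string, and nilpotency of E is used instead.\<close>

lemma top_wt_E:
  assumes "is_e (cc i) e" "0 \<le> i" "i < int l" and good: "i = int l - 1 \<or> e * proj (int l - 2 - i) = 0"
  shows "E * (proj i * e) = 0"
proof -
  have eZ: "e \<in> Zc" using assms is_e_Zc by blast
  let ?y = "E * (proj i * e)"
  have y: "?y = e * (proj (i + 2) * E)" using Zc_comm[OF eZ alg_proj] Zc_left[OF eZ alg_E]
    by (metis E_proj)
  show ?thesis
  proof (cases "i = int l - 1")
    case False
    let ?i = "int l - 2 - i"
    have e': "is_e (cc ?i) e" using assms cc_eq_iff[of i ?i] by simp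
    have i': "0 \<le> ?i" "?i < int l" using False assms by auto
    have "e * proj (?i - 2 * int (nat ?i)) = 0"
      by (rule chain[OF e' i'(2) eZ is_e_idem[OF assms(1)]]) (use good False i' in auto)
    moreover have "int l dvd (?i - 2 * int (nat ?i)) - (i + 2)" using i' by simp
    ultimately have "e * proj (i + 2) = 0" using proj_cong by metis
    then show ?thesis unfolding y by (simp add: mult.assoc[symmetric])
  next
    case True
    have wy: "wt (i + 2) ?y" by (rule wt_E[OF wt_proj_mult])
    \<comment> \<open>Downward induction on the exponent of E: once E kills
      \<open>E ^ n * y\<close>, that vector is an eigenvector of C for a value different from cc i,
      so it is already 0.\<close>
    have "E ^ (l - 1 - m) * ?y = 0" if "m < l" for m
      using that
    proof (induction m)
      case 0
      have "E ^ (l - 1) * ?y = E ^ l * (proj i * e)"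
        using l3 by (cases l) (simp_all add: power_commutes mult.assoc[symmetric])
      then show ?case by (simp add: E_pow_l)
    next
      case (Suc m)
      let ?n = "l - 1 - Suc m" and ?z = "E ^ (l - 1 - Suc m) * ?y"
      have "E * ?z = E ^ (l - 1 - m) * ?y"
        using Suc.prems by (simp add: mult.assoc[symmetric] Suc_diff_Suc flip: power_Suc)
      then have Ez: "E * ?z = 0" using Suc by simp
      have w: "wt (i + 2 + 2 * int ?n) ?z" by (rule wt_E_pow[OF wy])
      have z: "zz (cc (i + 2 + 2 * int ?n)) * ?z = 0" using FE_wt[OF w] Ez by simp
      have "e * ?z = ?z"
      proof -
        have "e * ?y = ?y" unfolding y using is_e_idem[OF assms(1)] by (simp add: mult.assoc[symmetric])
        then show ?thesis using Zc_left[OF eZ alg_pow[OF alg_E]] by simp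
      qed
      moreover have "cc i \<noteq> cc (i + 2 + 2 * int ?n)"
      proof -
        have n: "int ?n + 1 = int l - 1 - int m" using Suc.prems by linarith
        have "i - (i + 2 + 2 * int ?n) = - (2 * (int ?n + 1))" by simp
        moreover have "i + (i + 2 + 2 * int ?n) + 2 = 2 * int l + 2 * (int ?n + 1)" using True by simp
        moreover have "\<not> int l dvd int ?n + 1" using n Suc.prems by (intro not_dvd_small) auto
        ultimately show ?thesis unfolding cc_eq_iff
          using odd_dvd[of "int ?n + 1"] by (metis dvd_add_right_iff dvd_minus_iff dvd_triv_right)
      qed
      ultimately show ?case using is_e_inj[OF assms(1) _ z] by blast
    qed
    from this[of "l - 1"] show ?thesis using l3 by simp
  qed
qed

text \<open>Since E kills the top weight space, C - cc i = F E vanishes there. The other top is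
  absent, so C - cc i vanishes on the whole block.\<close>

lemma good_casimir:
  assumes e: "is_e (cc i) e" and i: "0 \<le> i" "i < int l" and good: "i = int l - 1 \<or> e * proj (int l - 2 - i) = 0"
  shows "zz (cc i) * e = 0"
proof (rule Zc_eq_0I[OF e i])
  have eZ: "e \<in> Zc" using e is_e_Zc by blast
  show "zz (cc i) * e \<in> Zc" by (intro Zc_mult Zc_zz eZ)
  show "zz (cc i) * e * e = zz (cc i) * e" using is_e_idem[OF e] by (simp add: mult.assoc)
  have pe: "proj j * e = e * proj j" for j using Zc_comm[OF eZ alg_proj] by simp
  have "zz (cc i) * (proj i * e) = 0"
    using FE_wt[OF wt_proj_mult[of i e]] top_wt_E[OF assms] by simp
  then show "zz (cc i) * e * proj i = 0" by (simp add: pe mult.assoc)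
  show "i = int l - 1 \<or> zz (cc i) * e * proj (int l - 2 - i) = 0"
    using good by (auto simp: mult.assoc)
qed

lemma cp_eigen: "C * u = c *s u \<Longrightarrow> cp g m * u = (\<Prod>s<m. c - g s) *s u"
proof (induction m)
  case (Suc m)
  have "zz (g m) * u = (c - g m) *s u" using Suc.prems by (simp add: zz_mult scale_left_diff_distrib)
  then show ?case using Suc by (simp add: mult.assoc scale_mult_right mult.commute)
qed simp

text \<open>A weight component y of x, of weight i - 2 m, is up to a nonzero scalar
  \<open>F ^ m * u\<close> with the highest weight vector \<open>u = E ^ m * y\<close>. The
  hypothesis \<open>gen\<close> asks N to contain only such u; in the application they generate
  simple submodules.\<close>

lemma good_generation:
  assumes e: "is_e (cc i) e" and i: "0 \<le> i" "i < int l" and good: "i = int l - 1 \<or> e * proj (int l - 2 - i) = 0"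
    and x: "e * x = x"
    and N: "0 \<in> N" "\<And>y z. y \<in> N \<Longrightarrow> z \<in> N \<Longrightarrow> y + z \<in> N" "\<And>a y. a \<in> alg \<Longrightarrow> y \<in> N \<Longrightarrow> a * y \<in> N"
    and gen: "\<And>u. u \<noteq> 0 \<Longrightarrow> wt i u \<Longrightarrow> E * u = 0 \<Longrightarrow> F ^ Suc (nat i) * u = 0 \<Longrightarrow> e * u = u \<Longrightarrow> \<exists>a\<in>alg. u = a * x \<Longrightarrow> u \<in> N"
  shows "x \<in> N"
proof -
  have eZ: "e \<in> Zc" using e is_e_Zc by blast
  have pe: "proj j * e = e * proj j" for j using Zc_comm[OF eZ alg_proj] by simp
  have low0: "proj (int l - 2 - i - 2 * int m) * e = 0" if "int m \<le> int l - 2 - i" for m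
  proof -
    let ?i = "int l - 2 - i"
    have "i \<noteq> int l - 1" using that by auto
    moreover have e': "is_e (cc ?i) e" using e cc_eq_iff[of i ?i] by simp
    ultimately show ?thesis
      using chain[OF e' _ eZ is_e_idem[OF e], of m] good i that by (simp add: pe)
  qed
  have "proj j * x \<in> N" for j
    using i
  proof (cases rule: weights_cover[where j = j])
    case (2 m)
    then have "proj j * e = 0" using low0 proj_cong by metis
    then have "proj j * x = 0" using x by (metis mult.assoc mult_zero_left)
    then show ?thesis using N by simp
  next
    case (1 m)
    define w where "w = i - 2 * int m"
    define y where "y = proj w * x"
    have eq: "proj j * x = y" using proj_cong[OF 1(2)] by (simp add: y_def w_def)
    have wy: "wt w y" unfolding y_def by (rule wt_proj_mult)
    have ey: "e * y = y" unfolding y_def using x pe by (metis mult.assoc)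
    have "zz (cc i) * y = 0" using good_casimir[OF e i good] ey by (metis mult.assoc mult_zero_left)
    then have Cy: "C * y = cc i *s y" by (simp add: zz_mult)
    define u where "u = E ^ m * y"
    have "wt (w + 2 * int m) u" unfolding u_def by (rule wt_E_pow[OF wy])
    then have wu: "wt i u" by (simp add: w_def)
    have eu: "e * u = u" unfolding u_def using Zc_left[OF eZ alg_pow[OF alg_E]] ey by simp
    have pu: "proj i * e * u = u" using proj_wt_same[OF wu] eu by (simp add: mult.assoc)
    have Eu: "E * u = 0" using top_wt_E[OF e i good] pu by (metis mult.assoc mult_zero_left)
    \<comment> \<open>The weight i - 2 (i + 1) is l - 2 - i modulo l, which the block lacks; for i =
      l - 1 the power is \<open>F ^ l\<close>.\<close>
    have Fu: "F ^ Suc (nat i) * u = 0"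
    proof (cases "i = int l - 1")
      case True
      then have "Suc (nat i) = l" using i by simp
      then show ?thesis by (simp add: F_pow_l)
    next
      case False
      let ?v = "F ^ Suc (nat i) * u"
      have "wt (i - 2 * int (Suc (nat i))) ?v" by (rule wt_F_pow[OF wu])
      then have "wt (int l - 2 - i) ?v" using i by (elim wt_cong) simp
      then have "proj (int l - 2 - i) * ?v = ?v" by (rule proj_wt_same)
      moreover have "e * ?v = F ^ Suc (nat i) * (e * u)" by (rule Zc_left[OF eZ alg_pow[OF alg_F]])
      moreover have "proj (int l - 2 - i) * e = 0" using low0[of 0] False i by simp
      ultimately show ?thesis by (metis eu mult.assoc mult_zero_left)
    qed
    have "F ^ m * u = (\<Prod>s<m. cc i - cc (w + 2 * int s)) *s y" (is "_ = ?P *s _")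
      unfolding u_def F_pow_E_pow[OF wy] by (rule cp_eigen[OF Cy])
    moreover have "?P \<noteq> 0"
    proof -
      have "cc i \<noteq> cc (w + 2 * int s)" if "s < m" for s
        using cc_ne_chain[of "int (m - s)" i] that 1 i by (simp add: w_def of_nat_diff algebra_simps)
      then show ?thesis by simp
    qed
    ultimately have "y = (1 / ?P) *s (F ^ m * u)" by simp
    then have yu: "y = ((1 / ?P) *s F ^ m) * u" by (simp add: scale_mult_left)
    have "u = (E ^ m * proj w) * x" by (simp add: u_def y_def mult.assoc)
    then have "\<exists>a\<in>alg. u = a * x" by (intro bexI[of _ "E ^ m * proj w"] alg_mult alg_pow alg_E alg_proj)
    then have "u \<in> N" using gen[of u] N(1) wu Eu Fu eu by (cases "u = 0") auto
    then have "((1 / ?P) *s F ^ m) * u \<in> N" by (intro N(3) alg_scale alg_pow alg_F)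
    then show ?thesis using eq yu by simp
  qed
  then have "(\<Sum>j<m. proj (int j) * x) \<in> N" for m
    by (induction m) (auto intro: N)
  then show ?thesis by (metis sum_proj_mult)
qed

section \<open>Simple modules generated by a highest weight vector\<close>

text \<open>As u is an eigenvector of C, E sends \<open>F ^ Suc k * u\<close> to a multiple of
  \<open>F ^ k * u\<close>; the hypothesis on \<open>F ^ n\<close> closes the span under F.\<close>

lemma Fspan_stable:
  assumes u: "wt i u" "E * u = 0" "F ^ n * u = 0" and a: "a \<in> alg" and x: "x \<in> span ((\<lambda>k. F ^ k * u) ` {..<n})"
  shows "a * x \<in> span ((\<lambda>k. F ^ k * u) ` {..<n})" (is "_ \<in> ?S")
proof -
  have lift: "\<forall>x\<in>?S. b * x \<in> ?S" if "\<And>k. k < n \<Longrightarrow> b * (F ^ k * u) \<in> ?S" for b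
  proof
    fix x assume "x \<in> ?S"
    then show "b * x \<in> ?S"
      by (induction rule: span_induct_alt)
         (use that in \<open>auto simp: distrib_left scale_mult_right intro!: span_add span_scale span_zero\<close>)
  qed
  have base: "F ^ k * u \<in> ?S" if "k < n" for k
    using that by (intro span_base) auto
  have wtk: "wt (i - 2 * int k) (F ^ k * u)" for k by (rule wt_F_pow[OF u(1)])
  have Cu: "zz (cc i) * u = 0" using FE_wt[OF u(1)] u(2) by simp
  have EF: "E * (F ^ Suc k * u) = (cc i - cc (2 * int k - i)) *s (F ^ k * u)" for k
  proof -
    have "E * (F ^ Suc k * u) = E * (F * (F ^ k * u))" by (simp add: mult.assoc)
    also have "\<dots> = zz (cc (- (i - 2 * int k))) * (F ^ k * u)" by (rule EF_wt[OF wtk])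
    also have "\<dots> = F ^ k * (zz (cc (- (i - 2 * int k))) * u)"
      by (rule Zc_left[OF Zc_zz alg_pow[OF alg_F]])
    also have "zz (cc (- (i - 2 * int k))) * u = (cc i - cc (2 * int k - i)) *s u"
      using Cu by (simp add: zz_mult scale_left_diff_distrib)
    finally show ?thesis by (simp add: scale_mult_right)
  qed
  have "\<forall>x\<in>?S. a * x \<in> ?S"
    using a
  proof induction
    case (alg_scalar a)
    then show ?case by (auto simp: scale_mult_left intro: span_scale)
  next
    case alg_E
    show ?case
    proof (rule lift)
      fix k assume "k < n"
      then show "E * (F ^ k * u) \<in> ?S"
        by (cases k) (simp_all only: EF power_0 mult_1_left u span_zero base span_scale Suc_lessD)
    qed
  next
    case alg_F
    show ?case
    proof (rule lift)
      fix k assume "k < n"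
      have "F * (F ^ k * u) = F ^ Suc k * u" by (simp add: mult.assoc)
      moreover have "F ^ Suc k * u \<in> ?S" using \<open>k < n\<close> base[of "Suc k"] u(3)
        by (cases "Suc k = n") (simp_all add: span_zero del: power_Suc)
      ultimately show "F * (F ^ k * u) \<in> ?S" by simp
    qed
  next
    case alg_K
    show ?case by (rule lift) (use wtk in \<open>simp add: wt_def span_scale base\<close>)
  next
    case alg_L
    show ?case by (rule lift) (use wt_L[OF wtk] in \<open>simp add: span_scale base\<close>)
  next
    case (alg_add x y)
    then show ?case by (auto simp: distrib_right intro: span_add)
  next
    case (alg_mult x y)
    then show ?case by (auto simp: mult.assoc)
  qed
  then show ?thesis using x by blast
qed

text \<open>Apply to t the power of E that equals the highest power of F in t: lower terms die and
  the leading one returns a multiple of u. The induction on n discards leading coefficients that are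
  0.\<close>

lemma Fspan_minimal:
  assumes u: "wt i u" "E * u = 0" and i: "i < int l" and n: "int n \<le> i + 1"
    and T: "\<And>a y. a \<in> alg \<Longrightarrow> y \<in> T \<Longrightarrow> a * y \<in> T"
    and t: "t \<in> T" "t \<noteq> 0" "t \<in> span ((\<lambda>k. F ^ k * u) ` {..<n})"
  shows "u \<in> T"
  using n t(3)
proof (induction n)
  case 0
  then show ?case using t by simp
next
  case (Suc n)
  have Cu: "C * u = cc i *s u" using FE_wt[OF u(1)] u(2) by (simp add: zz_mult)
  have EFk: "E ^ m * (F ^ m * u) = (\<Prod>s<m. cc i - cc (- i + 2 * int s)) *s u" for m
    unfolding E_pow_F_pow[OF u(1)] by (rule cp_eigen[OF Cu])
  obtain c where c: "t - c *s (F ^ n * u) \<in> span ((\<lambda>k. F ^ k * u) ` {..<n})"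
    using Suc.prems(2) by (auto simp: lessThan_Suc span_breakdown_eq)
  show ?case
  proof (cases "c = 0")
    case True
    then show ?thesis using Suc c by simp
  next
    case False
    have E0: "E ^ n * y = 0" if "y \<in> span ((\<lambda>k. F ^ k * u) ` {..<n})" for y
      using that
    proof (induction rule: span_induct_alt)
      case (step a x y)
      then obtain k where k: "k < n" "x = F ^ k * u" by auto
      have "E ^ n * x = E ^ (n - Suc k) * (E * (E ^ k * (F ^ k * u)))"
        using k by (simp add: mult.assoc[symmetric] power_add[symmetric] flip: power_Suc power_Suc2)
      also have "\<dots> = 0" unfolding EFk using u by (simp add: scale_mult_right)
      finally show ?case using step by (simp add: distrib_left scale_mult_right)
    qed simp
    let ?P = "\<Prod>s<n. cc i - cc (- i + 2 * int s)"
    have "E ^ n * t = E ^ n * (t - c *s (F ^ n * u)) + c *s (E ^ n * (F ^ n * u))"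
      by (simp add: right_diff_distrib scale_mult_right)
    then have Et: "E ^ n * t = (c * ?P) *s u" using E0[OF c] EFk by simp
    \<comment> \<open>Here - i + 2 s = i - 2 (i - s) with 0 < i - s \<le> i, a weight below the top
      of the string.\<close>
    have "?P \<noteq> 0"
    proof -
      have "cc i \<noteq> cc (- i + 2 * int s)" if "s < n" for s
        using cc_ne_chain[of "i - int s" i] that Suc.prems i by (simp add: algebra_simps)
      then show ?thesis by simp
    qed
    then have "u = (1 / (c * ?P)) *s (E ^ n * t)" using Et False by simp
    then have "u = ((1 / (c * ?P)) *s E ^ n) * t" by (simp add: scale_mult_left)
    then show ?thesis using T[OF _ t(1)] by (metis alg_scale alg_pow alg_E)
  qed
qed

text \<open>The factors of an annihilating product are peeled off one at a time: modulo N nothing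
  changes when g is multiplied by 1 - e, which is a multiple of C - c. In the end g is congruent
  modulo N to a multiple of the full product, which is 0.\<close>

lemma generated_by_blocks:
  assumes g: "g \<in> Zc"
    and N: "0 \<in> N" "\<And>y z. y \<in> N \<Longrightarrow> z \<in> N \<Longrightarrow> y + z \<in> N" "\<And>a y. a \<in> alg \<Longrightarrow> y \<in> N \<Longrightarrow> a * y \<in> N"
    and blocks: "\<And>i e. 0 \<le> i \<Longrightarrow> i < int l \<Longrightarrow> is_e (cc i) e \<Longrightarrow> e * g \<in> N"
  shows "g \<in> N"
proof -
  obtain xs where xs: "set xs \<subseteq> range cc" "prod_list (map zz xs) = 0" using zz_annihilator by blast
  have "\<exists>u\<in>Zc. g - u * prod_list (map zz ys) * g \<in> N" if "set ys \<subseteq> range cc" for ys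
    using that
  proof (induction ys)
    case Nil
    then show ?case using N(1) by (intro bexI[of _ 1]) auto
  next
    case (Cons c ys)
    then obtain u where u: "u \<in> Zc" "g - u * prod_list (map zz ys) * g \<in> N" by auto
    obtain j where j: "c = cc j" using Cons.prems by auto
    have "cc j = cc (j mod int l)" unfolding cc_eq_iff by (simp add: mod_eq_dvd_iff[symmetric])
    then have c: "c = cc (j mod int l)" using j by simp
    obtain e where e: "is_e c e" using ex_is_e by blast
    then obtain w where w: "w \<in> Zc" "1 - e = w * zz c" by (auto simp: is_e_def)
    let ?P = "prod_list (map zz ys)"
    have uP: "u * ?P \<in> Zc" using u Zc_prod_list Zc_mult by blast
    have "e * g \<in> N" using blocks[of "j mod int l" e] e c l3 by simp
    then have 1: "(u * ?P) * (e * g) \<in> N" using N(3) Zc_alg[OF uP] by blast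
    have "w * zz c * (u * ?P) = u * (w * zz c * ?P)"
      using Zc_left[OF u(1) Zc_alg[OF Zc_mult[OF w(1) Zc_zz]]] by (simp add: mult.assoc)
    then have "(u * w) * prod_list (map zz (c # ys)) * g = (1 - e) * (u * ?P) * g"
      using w(2) by (simp add: mult.assoc)
    also have "\<dots> = (u * ?P) * g - (u * ?P) * (e * g)"
      using Zc_left[OF is_e_Zc[OF e] Zc_alg[OF uP], of g] by (simp add: left_diff_distrib mult.assoc)
    finally have "g - (u * w) * prod_list (map zz (c # ys)) * g = (g - u * ?P * g) + (u * ?P) * (e * g)"
      by simp
    then show ?case using N(2)[OF u(2) 1] u w Zc_mult by metis
  qed
  from this[OF xs(1)] show ?thesis using xs(2) by simp
qed

section \<open>Primitive central idempotents\<close>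

text \<open>The counterpart of \<open>primitive_central_idempotent\<close> inside
  \<open>alg\<close>; \<open>primitive_iff\<close> matches the two.\<close>

definition pci :: "'a \<Rightarrow> bool" where
  "pci e \<longleftrightarrow> e \<in> Zc \<and> e * e = e \<and> e \<noteq> 0 \<and>
     (\<forall>f g. f \<in> Zc \<and> f * f = f \<and> g \<in> Zc \<and> g * g = g \<and> f * g = 0 \<and> e = f + g \<longrightarrow> f = 0 \<or> g = 0)"

text \<open>The last alternative provides a vector of weight \<open>i\<close> that \<open>E\<close> carries into the weights of the
  simple module of highest weight \<open>l - 2 - i\<close>, so that the two halves of the block do not separate.\<close>

definition linked :: "int \<Rightarrow> 'a \<Rightarrow> bool" where
  "linked i e \<longleftrightarrow> i = int l - 1 \<or> e * proj (int l - 2 - i) = 0 \<or> E * (proj i * e) \<noteq> 0"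

lemma is_e_pci:
  assumes e: "is_e (cc i) e" "0 \<le> i" "i < int l" "linked i e" "e \<noteq> 0"
  shows "pci e"
proof -
  have "f = 0 \<or> g = 0" if "f \<in> Zc" "f * f = f" "f * g = 0" "e = f + g" for f g
  proof -
    have "f * e = f" using that by (simp add: distrib_left)
    then have "f = 0 \<or> f = e"
      using block_idempotent_primitive[OF e(1-3)] e(4) that unfolding linked_def by blast
    then show ?thesis using that by auto
  qed
  then show ?thesis using e is_e_Zc is_e_idem unfolding pci_def by blast
qed

text \<open>e = e f + (e - e f) is an orthogonal decomposition.\<close>

lemma pci_mult:
  assumes "pci e" "f \<in> Zc" "f * f = f" shows "e * f = 0 \<or> e * f = e"
proof -
  have e: "e \<in> Zc" "e * e = e" using assms by (auto simp: pci_def)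
  have ef: "e * f = f * e" using Zc_comm[OF e(1) Zc_alg[OF assms(2)]] .
  have 1: "e * f * (e * f) = e * f" using ef e assms(3) by (metis mult.assoc)
  have 2: "e * (e * f) = e * f" "e * f * e = e * f" using ef e by (metis mult.assoc)+
  have "(e - e * f) * (e - e * f) = e - e * f" "e * f * (e - e * f) = 0" "e = e * f + (e - e * f)"
    by (simp_all add: left_diff_distrib right_diff_distrib 1 2 e)
  moreover have "e * f \<in> Zc" "e - e * f \<in> Zc" using e assms(2) by (auto intro: Zc_mult Zc_diff)
  ultimately have "e * f = 0 \<or> e - e * f = 0" using assms(1) 1 unfolding pci_def by blast
  then show ?thesis by auto
qed

lemma pci_eq: assumes "pci e" "pci f" "e * f \<noteq> 0" shows "e = f"
proof -
  have ef: "e * f = f * e" using assms Zc_comm Zc_alg unfolding pci_def by blast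
  have "e * f = e" using pci_mult[OF assms(1)] assms(2,3) unfolding pci_def by blast
  moreover have "f * e = f" using pci_mult[OF assms(2), of e] assms(1,3) ef unfolding pci_def by auto
  ultimately show ?thesis using ef by simp
qed

lemma pci_is_e:
  assumes "pci g" and "\<And>i e. 0 \<le> i \<Longrightarrow> i < int l \<Longrightarrow> is_e (cc i) e \<Longrightarrow> e \<noteq> 0 \<Longrightarrow> pci e"
  obtains i where "0 \<le> i" "i < int l" "is_e (cc i) g"
proof -
  obtain i e where i: "0 \<le> i" "i < int l" "is_e (cc i) e" "g * e \<noteq> 0"
    using assms(1) ex_block_of_idempotent[of g] unfolding pci_def by blast
  then have "e \<noteq> 0" by auto
  then have "pci e" using assms(2)[of i e] i by blast
  then have "g = e" using pci_eq assms(1) i by blast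
  then show ?thesis using that i by blast
qed

section \<open>Eigenvectors of the Casimir element and linking\<close>

text \<open>C - c is nilpotent on the block; X is the last nonzero vector among its iterates on Y,
  and central elements preserve weights.\<close>

lemma casimir_eigenvector:
  assumes e: "is_e c e" and Y: "Y \<noteq> 0" "e * Y = Y" "wt j Y"
  obtains X where "X \<noteq> 0" "zz c * X = 0" "wt j X"
proof -
  obtain n where "zz c ^ n * e = 0" using e by (auto simp: is_e_def)
  then have "zz c ^ n * Y = 0" using Y(2) by (metis mult.assoc mult_zero_left)
  then have ex: "\<exists>n. zz c ^ n * Y = 0" by blast
  define m where "m = (LEAST n. zz c ^ n * Y = 0)"
  have m: "zz c ^ m * Y = 0" unfolding m_def using ex by (rule LeastI_ex)
  then have "m \<noteq> 0" using Y(1) by (cases m) auto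
  then obtain k where k: "m = Suc k" by (cases m) auto
  then have "zz c ^ k * Y \<noteq> 0" using not_less_Least[of k "\<lambda>n. zz c ^ n * Y = 0"] m_def by auto
  moreover have "zz c * (zz c ^ k * Y) = 0" using m k by (simp add: mult.assoc)
  moreover have "wt j (zz c ^ k * Y)" using Zc_wt[OF Zc_zz_pow Y(3)] .
  ultimately show ?thesis using that by blast
qed

text \<open>\<open>x = E ^ k * Y\<close> is killed by E and has weight 2 l - 2 - i, so C acts on it,
  and hence on \<open>F ^ k * x\<close>, by cc i. On the other hand \<open>F ^ k * x\<close> is a
  polynomial in C applied to Y that contains the factor C - cc i, so it equals (C - cc i) v for some
  v of weight i. Finally F E v = (C - cc i) v shows that E does not kill v.\<close>

lemma linking:
  assumes e: "is_e (cc i) e" and i: "0 \<le> i" "i \<le> int l - 2" and k: "int k = int l - 1 - i"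
    and Y: "wt i Y" "E ^ Suc k * Y = 0" "F ^ k * (E ^ k * Y) \<noteq> 0"
  shows "zz (cc i) * e \<noteq> 0" and "E * (proj i * e) \<noteq> 0"
proof -
  define x where "x = E ^ k * Y"
  obtain k' where k': "k = Suc k'" using i k by (cases k) auto
  have n: "i + 2 * int k = 2 * int l - 2 - i" using k by simp
  have wx: "wt (2 * int l - 2 - i) x" using wt_E_pow[OF Y(1), of k] unfolding n x_def .
  have Ex: "E * x = 0" using Y(2) by (simp add: x_def mult.assoc)
  have "cc (2 * int l - 2 - i) = cc i" unfolding cc_eq_iff by simp
  then have zx: "zz (cc i) * x = 0" using FE_wt[OF wx] Ex by simp
  have wF: "wt (2 * int l - 2 - i - 2 * int k') (F ^ k' * x)" by (rule wt_F_pow[OF wx])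
  have kk: "2 * int l - 2 - i - 2 * int k' = i + 2" using k k' by simp
  have "cc (- (i + 2)) = cc i" unfolding cc_eq_iff by simp
  then have "E * (F * (F ^ k' * x)) = zz (cc i) * (F ^ k' * x)"
    using EF_wt[OF wF] unfolding kk by simp
  also have "\<dots> = F ^ k' * (zz (cc i) * x)" by (rule Zc_left[OF Zc_zz alg_pow[OF alg_F]])
  finally have EZ: "E * (F ^ k * x) = 0" using zx k' by (simp add: mult.assoc)
  have Z: "F ^ k * x = cp (\<lambda>s. cc (i + 2 * int s)) k * Y"
    unfolding x_def by (rule F_pow_E_pow[OF Y(1)])
  obtain h where h: "h \<in> Zc" "cp (\<lambda>s. cc (i + 2 * int s)) k = h * zz (cc i)"
    using cp_Suc_factor[of "\<lambda>s. cc (i + 2 * int s)" k'] k' by auto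
  \<comment> \<open>v is Y multiplied by all factors of \<open>F ^ k * E ^ k\<close> except C - cc
    i.\<close>
  define v where "v = h * Y"
  have wv: "wt i v" unfolding v_def by (rule Zc_wt[OF h(1) Y(1)])
  have zv: "zz (cc i) * v = F ^ k * x"
    unfolding Z h(2) v_def using Zc_left[OF Zc_zz Zc_alg[OF h(1)]] by (simp add: mult.assoc)
  have "zz (cc i) * (F ^ k * x) = 0"
    using FE_wt[OF Zc_wt[OF Zc_zz wv, of "cc i"]] EZ unfolding zv by simp
  then have "zz (cc i) ^ 2 * v = 0" by (simp add: power2_eq_square mult.assoc zv)
  then have ev: "e * v = v" by (rule is_e_fix[OF e])
  have nz: "zz (cc i) * v \<noteq> 0" using Y(3) unfolding zv x_def .
  then show "zz (cc i) * e \<noteq> 0" using ev by (metis mult.assoc mult_zero_left)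
  show "E * (proj i * e) \<noteq> 0"
  proof
    assume 0: "E * (proj i * e) = 0"
    have "E * v = E * (proj i * e) * v"
      using ev proj_wt_same[OF wv] by (simp add: mult.assoc)
    then show False using 0 FE_wt[OF wv] nz by simp
  qed
qed

end

section \<open>Integral weights\<close>

text \<open>\<open>P m\<close> projects onto the integral weight space m. It need not belong to
  \<open>alg\<close>, but it commutes with C (\<open>P_C\<close>), so an eigenvector of C may be
  replaced by one of its integral components.\<close>

locale uq_graded = uq scale E F K L q l
  for scale :: "'k :: field \<Rightarrow> 'a :: ring_1 \<Rightarrow> 'a" (infixr "*s" 75) and E F K L q l +
  fixes P :: "int \<Rightarrow> 'a" and r :: nat
  assumes E_P: "E * P m = P (m + 2) * E" and F_P: "F * P m = P (m - 2) * F"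
    and K_P: "K * P m = (q powi m) *s P m" and P_K: "P m * K = (q powi m) *s P m"
    and P_outside: "int r < \<bar>m\<bar> \<Longrightarrow> P m = 0" and P_parity: "odd (m - int r) \<Longrightarrow> P m = 0"
    and sum_P: "(\<Sum>m = - int r..int r. P m) = 1"
begin

lemma E_pow_P: "E ^ k * P m = P (m + 2 * int k) * E ^ k"
proof (induction k)
  case (Suc k)
  have "E ^ Suc k * P m = E * P (m + 2 * int k) * E ^ k" by (simp add: mult.assoc Suc)
  then show ?case by (simp add: E_P mult.assoc algebra_simps)
qed simp

lemma F_pow_P: "F ^ k * P m = P (m - 2 * int k) * F ^ k"
proof (induction k)
  case (Suc k)
  have "F ^ Suc k * P m = F * P (m - 2 * int k) * F ^ k" by (simp add: mult.assoc Suc)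
  then show ?case by (simp add: F_P mult.assoc algebra_simps)
qed simp

lemma wt_P: "wt m (P m * x)"
  by (simp add: wt_def K_P scale_mult_left flip: mult.assoc)

lemma P_C: "P m * C = C * P m"
proof -
  have PL: "P m * L = L * P m"
  proof -
    have "P m * L = L * (K * P m) * L" by (simp add: LK flip: mult.assoc)
    also have "\<dots> = L * (P m * K) * L" by (simp add: K_P P_K)
    also have "\<dots> = L * P m" by (simp add: mult.assoc KL)
    finally show ?thesis .
  qed
  have "P m * F = F * P (m + 2)" using F_P[of "m + 2"] by simp
  then have "P m * (F * E) = F * (P (m + 2) * E)" by (simp flip: mult.assoc)
  also have "\<dots> = F * E * P m" by (simp add: E_P mult.assoc)
  finally have "P m * (F * E) = F * E * P m" .
  then show ?thesis
    by (simp add: C_def distrib_left distrib_right scale_mult_left scale_mult_right K_P P_K PL)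
qed

text \<open>Some integral component y of X, of weight m, is nonzero and has the same eigenvalue. For
  m \<ge> 0 the weights m + 2 p beyond r are empty, so \<open>F ^ p * E ^ p\<close> kills y and c is
  a root of the resulting polynomial; for m < 0 the roles of E and F are exchanged.\<close>

lemma casimir_eigenvalue:
  assumes X: "X \<noteq> 0" "zz c * X = 0" and wt: "wt j X"
  obtains m n where "int l dvd m - j" "\<bar>m\<bar> \<le> n" "n \<le> int r" "even (n - int r)" "even (m - int r)" "c = cc n"
proof -
  have "X = (\<Sum>m = - int r..int r. P m * X)" by (simp add: sum_P flip: sum_distrib_right)
  then obtain m where "P m * X \<noteq> 0" using X(1) by (metis sum.neutral)
  define y where "y = P m * X"
  have y: "y \<noteq> 0" and m: "\<bar>m\<bar> \<le> int r" "even (m - int r)"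
    using \<open>P m * X \<noteq> 0\<close> P_outside[of m] P_parity[of m] by (force simp: y_def)+
  have wy: "wt m y" unfolding y_def by (rule wt_P)
  have Cy: "C * y = c *s y"
  proof -
    have "C * X = c *s X" using X(2) by (simp add: zz_mult)
    moreover have "C * y = P m * (C * X)" by (simp add: y_def P_C flip: mult.assoc)
    ultimately show ?thesis by (simp add: y_def scale_mult_right)
  qed
  have "wt j y"
  proof -
    have "K * P m = P m * K" by (simp add: K_P P_K)
    then have "K * y = P m * (K * X)" by (simp add: y_def mult.assoc[symmetric])
    then show ?thesis using wt by (simp add: wt_def y_def scale_mult_right)
  qed
  then have mj: "int l dvd m - j" using wt_unique[OF wy _ y] by blast
  have ex: "\<exists>n. \<bar>m\<bar> \<le> n \<and> n \<le> int r \<and> even (n - int r) \<and> c = cc n"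
  proof -
    \<comment> \<open>The least p for which \<bar>m\<bar> + 2 p exceeds r; by parity 2 p = r -
      \<bar>m\<bar> + 2.\<close>
    define p where "p = Suc (nat ((int r - \<bar>m\<bar>) div 2))"
    have e: "even (int r - \<bar>m\<bar>)" using m by presburger
    then have p: "2 * int p = int r - \<bar>m\<bar> + 2" using m by (auto simp: p_def)
    have "(\<Prod>s<p. c - cc (\<bar>m\<bar> + 2 * int s)) *s y = 0"
    proof (cases "0 \<le> m")
      case True
      then have "E ^ p * P m = 0" using p P_outside[of "m + 2 * int p"] by (simp add: E_pow_P)
      then have "E ^ p * y = 0" by (simp add: y_def flip: mult.assoc)
      then have "cp (\<lambda>s. cc (m + 2 * int s)) p * y = 0" using F_pow_E_pow[OF wy, of p] by simp
      then show ?thesis using True by (simp add: cp_eigen[OF Cy])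
    next
      case False
      then have "F ^ p * P m = 0" using p P_outside[of "m - 2 * int p"] by (simp add: F_pow_P)
      then have "F ^ p * y = 0" by (simp add: y_def flip: mult.assoc)
      then have "cp (\<lambda>s. cc (- m + 2 * int s)) p * y = 0" using E_pow_F_pow[OF wy, of p] by simp
      then show ?thesis using False by (simp add: cp_eigen[OF Cy])
    qed
    then obtain s where s: "s < p" "c = cc (\<bar>m\<bar> + 2 * int s)" using y by auto
    moreover have "even (\<bar>m\<bar> + 2 * int s - int r)" using e by simp
    ultimately show ?thesis using p by (intro exI[of _ "\<bar>m\<bar> + 2 * int s"]) auto
  qed
  then show ?thesis using that mj m by blast
qed

lemma even_dvd: "int l dvd a \<Longrightarrow> even a \<Longrightarrow> 2 * int l dvd a"
  using odd_l by (simp add: divides_mult mult.commute)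

lemma dvd_small: "2 * int l dvd a \<Longrightarrow> \<bar>a\<bar> < 2 * int l \<Longrightarrow> a = 0"
  by (metis dvd_imp_le_int not_less l3 abs_of_nonneg mult_nonneg_nonneg of_nat_0_le_iff zero_le_numeral)

text \<open>Integrally the eigenvalue is cc n with n \<le> r of the parity of i. The bound on i
  gives 0 < i + n + 2 < 2 l, and this even number is not divisible by l; so the reflected solution
  is excluded and n = i.\<close>

lemma eigenvalue_small:
  assumes i: "0 \<le> i" "i \<le> int l - 2" "i < 2 * int l - 2 - int r" "even (int r - i)"
    and X: "X \<noteq> 0" "zz (cc i) * X = 0" "wt j X"
  shows "i \<le> int r \<and> (\<exists>m. int l dvd m - j \<and> \<bar>m\<bar> \<le> i \<and> even (m - i))"
proof -
  obtain m n where mn: "int l dvd m - j" "\<bar>m\<bar> \<le> n" "n \<le> int r" "even (n - int r)" "even (m - int r)" "cc i = cc n"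
    using casimir_eigenvalue[OF X] by blast
  have ev: "even (i - n)" using mn(4) i(4) by presburger
  then have ev': "even (i + n + 2)" by presburger
  have "\<not> int l dvd i + n + 2"
    using even_dvd[of "i + n + 2"] ev' dvd_small[of "i + n + 2"] mn i by auto
  then have "int l dvd i - n" using mn(6) cc_eq_iff by blast
  then have "i - n = 0" using even_dvd[of "i - n"] ev dvd_small[of "i - n"] mn i by auto
  moreover have "even (m - i)" using mn(5) i(4) by presburger
  ultimately show ?thesis using mn by auto
qed

text \<open>An integral weight m in the class of l - 2 - i with \<bar>m\<bar> \<le> i and the parity
  of i would make m + i + 2 a multiple of 2 l, although 0 < m + i + 2 < 2 l.\<close>

lemma good_small:
  assumes e: "is_e (cc i) e" and i: "0 \<le> i" "i \<le> int l - 2" "i < 2 * int l - 2 - int r" "even (int r - i)"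
  shows "e * proj (int l - 2 - i) = 0"
proof (rule ccontr)
  let ?j = "int l - 2 - i"
  assume "e * proj ?j \<noteq> 0"
  then obtain X where X: "X \<noteq> 0" "zz (cc i) * X = 0" "wt ?j X"
  proof (rule casimir_eigenvector[OF e])
    show "e * (e * proj ?j) = e * proj ?j" using is_e_idem[OF e] by (simp flip: mult.assoc)
    show "wt ?j (e * proj ?j)" by (rule Zc_wt[OF is_e_Zc[OF e] wt_proj])
  qed
  obtain m where m: "int l dvd m - ?j" "\<bar>m\<bar> \<le> i" "even (m - i)"
    using eigenvalue_small[OF i X] by blast
  have "m - ?j = (m + i + 2) - int l" by simp
  then have "int l dvd m + i + 2" using m(1) by (metis dvd_diff_right_iff dvd_refl dvd_add_triv_right_iff diff_add_cancel)
  moreover have "even (m + i + 2)" using m(3) by presburger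
  ultimately have "2 * int l dvd m + i + 2" by (rule even_dvd)
  then have "m + i + 2 = 0" by (rule dvd_small) (use m(2) i in arith)
  then show False using m(2) i by arith
qed

lemma ex_weight_vector:
  assumes e: "is_e c e" "e \<noteq> 0"
  obtains X j where "X \<noteq> 0" "zz c * X = 0" "wt j X"
proof -
  have "\<exists>j. e * proj j \<noteq> 0"
  proof (rule ccontr)
    assume "\<nexists>j. e * proj j \<noteq> 0"
    then have "(\<Sum>j<l. e * proj (int j)) = 0" by simp
    then show False using e(2) by (simp add: sum_proj flip: sum_distrib_left)
  qed
  then obtain j where "e * proj j \<noteq> 0" by blast
  then show ?thesis
  proof (rule casimir_eigenvector[OF e(1)])
    show "e * (e * proj j) = e * proj j" using is_e_idem[OF e(1)] by (simp flip: mult.assoc)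
    show "wt j (e * proj j)" by (rule Zc_wt[OF is_e_Zc[OF e(1)] wt_proj])
  qed (use that in blast)
qed

lemma occurs_small:
  assumes e: "is_e (cc i) e" "e \<noteq> 0" and i: "0 \<le> i" "i \<le> int l - 2" "i < 2 * int l - 2 - int r" "even (int r - i)"
  shows "i \<le> int r"
proof -
  obtain X j where "X \<noteq> 0" "zz (cc i) * X = 0" "wt j X" using ex_weight_vector[OF e] by blast
  then show ?thesis using eigenvalue_small[OF i] by blast
qed

lemma occurs_Steinberg:
  assumes e: "is_e (cc (int l - 1)) e" "e \<noteq> 0"
  obtains n where "0 \<le> n" "n \<le> int r" "even (int r - n)" "int l dvd n + 1"
proof -
  obtain X j where "X \<noteq> 0" "zz (cc (int l - 1)) * X = 0" "wt j X" using ex_weight_vector[OF e] by blast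
  then obtain m n where mn: "\<bar>m\<bar> \<le> n" "n \<le> int r" "even (n - int r)" "cc (int l - 1) = cc n"
    using casimir_eigenvalue by metis
  have "int l - 1 - n = int l - (n + 1)" "int l - 1 + n + 2 = int l + (n + 1)" by auto
  then have "int l dvd n + 1" using mn(4) unfolding cc_eq_iff
    by (metis dvd_add_right_iff dvd_refl dvd_diff_commute dvd_diff_left_iff)
  moreover have "even (int r - n)" using mn(3) by presburger
  moreover have "0 \<le> n" using mn(1) by arith
  ultimately show ?thesis using that mn(2) by blast
qed

end

section \<open>Operators and matrices\<close>

text \<open>One type for all tensor powers: the class \<open>ring_1\<close> fixes a unit, which
  matrices of different sizes cannot share. Linear maps on sequences form a single ring into which
  all of them embed.\<close>

typedef (overloaded) ('k :: field) endo =
  "{T :: (nat \<Rightarrow> 'k) \<Rightarrow> nat \<Rightarrow> 'k.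
     (\<forall>f g. T (\<lambda>x. f x + g x) = (\<lambda>x. T f x + T g x)) \<and> (\<forall>c f. T (\<lambda>x. c * f x) = (\<lambda>x. c * T f x))}"
  by (rule exI[of _ "\<lambda>f. f"]) auto

setup_lifting type_definition_endo

lemma endo_add: "Rep_endo T (\<lambda>x. f x + g x) = (\<lambda>x. Rep_endo T f x + Rep_endo T g x)"
  and endo_scale: "Rep_endo T (\<lambda>x. c * f x) = (\<lambda>x. c * Rep_endo T f x)"
  using Rep_endo[of T] by auto

lemma endo_zero: "Rep_endo T (\<lambda>x. 0) = (\<lambda>x. 0)"
  using endo_scale[of T 0 "\<lambda>x. 0"] by simp

instantiation endo :: (field) ring_1
begin
lift_definition zero_endo :: "'a endo" is "\<lambda>f x. 0" by auto
lift_definition one_endo :: "'a endo" is "\<lambda>f. f" by auto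
lift_definition plus_endo :: "'a endo \<Rightarrow> 'a endo \<Rightarrow> 'a endo" is "\<lambda>S T f x. S f x + T f x"
  by (auto simp: algebra_simps)
lift_definition minus_endo :: "'a endo \<Rightarrow> 'a endo \<Rightarrow> 'a endo" is "\<lambda>S T f x. S f x - T f x"
  by (auto simp: algebra_simps)
lift_definition uminus_endo :: "'a endo \<Rightarrow> 'a endo" is "\<lambda>S f x. - S f x"
  by (auto simp: algebra_simps)
lift_definition times_endo :: "'a endo \<Rightarrow> 'a endo \<Rightarrow> 'a endo" is "\<lambda>S T f. S (T f)"
  by auto
instance
proof
  show "(0 :: 'a endo) \<noteq> 1"
    by transfer (metis zero_neq_one)
qed (transfer, auto simp: algebra_simps)+
end

lift_definition scale_endo :: "'k :: field \<Rightarrow> 'k endo \<Rightarrow> 'k endo" is "\<lambda>c S f x. c * S f x"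
  by (auto simp: algebra_simps)

text \<open>Even indices belong to a last tensor factor \<open>\<omega>\<^sub>1\<close>, odd ones to
  \<open>\<omega>\<^sub>2\<close>, and the half of an index describes the other factors. So a block
  matrix over operators for r factors is an operator for r + 1 factors.\<close>

lift_definition block :: "'k :: field endo \<Rightarrow> 'k endo \<Rightarrow> 'k endo \<Rightarrow> 'k endo \<Rightarrow> 'k endo" is
  "\<lambda>A B C D f x. if even x
     then A (\<lambda>y. f (2 * y)) (x div 2) + B (\<lambda>y. f (Suc (2 * y))) (x div 2)
     else C (\<lambda>y. f (2 * y)) (x div 2) + D (\<lambda>y. f (Suc (2 * y))) (x div 2)"
  by (auto simp: algebra_simps fun_eq_iff)

lemma endo_eqI: "(\<And>f x. Rep_endo S f x = Rep_endo T f x) \<Longrightarrow> S = T"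
  by (metis Rep_endo_inject ext)

lemma block_inject: "block A B C D = block A' B' C' D' \<longleftrightarrow> A = A' \<and> B = B' \<and> C = C' \<and> D = D'"
proof
  assume eq: "block A B C D = block A' B' C' D'"
  have main: "Rep_endo A f x = Rep_endo A' f x \<and> Rep_endo B f x = Rep_endo B' f x \<and>
      Rep_endo C f x = Rep_endo C' f x \<and> Rep_endo D f x = Rep_endo D' f x" for f x
  proof -
    define g h where "g = (\<lambda>y. if even y then f (y div 2) else 0)"
      and "h = (\<lambda>y. if even y then 0 else f (y div 2))"
    have g: "(\<lambda>y. g (2 * y)) = f" "(\<lambda>y. g (Suc (2 * y))) = (\<lambda>y. 0)"
      and h: "(\<lambda>y. h (2 * y)) = (\<lambda>y. 0)" "(\<lambda>y. h (Suc (2 * y))) = f"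
      by (auto simp: g_def h_def)
    have e: "Rep_endo (block A B C D) u y = Rep_endo (block A' B' C' D') u y" for u y
      using eq by simp
    show ?thesis
      using e[of g "2 * x"] e[of g "Suc (2 * x)"] e[of h "2 * x"] e[of h "Suc (2 * x)"]
      by (simp add: block.rep_eq g h endo_zero)
  qed
  show "A = A' \<and> B = B' \<and> C = C' \<and> D = D'"
    using main by (auto intro!: endo_eqI)
qed simp

lemma block_mult: "block A B C D * block A' B' C' D' =
    block (A * A' + B * C') (A * B' + B * D') (C * A' + D * C') (C * B' + D * D')"
  by (rule endo_eqI) (simp add: block.rep_eq times_endo.rep_eq plus_endo.rep_eq endo_add algebra_simps)

lemma block_add: "block A B C D + block A' B' C' D' = block (A + A') (B + B') (C + C') (D + D')"
  by (rule endo_eqI) (simp add: block.rep_eq plus_endo.rep_eq algebra_simps)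

lemma block_diff: "block A B C D - block A' B' C' D' = block (A - A') (B - B') (C - C') (D - D')"
  by (rule endo_eqI) (simp add: block.rep_eq minus_endo.rep_eq algebra_simps)

lemma block_scale: "scale_endo c (block A B C D) = block (scale_endo c A) (scale_endo c B) (scale_endo c C) (scale_endo c D)"
  by (rule endo_eqI) (simp add: block.rep_eq scale_endo.rep_eq algebra_simps)

lemma block_0: "block 0 0 0 0 = 0"
  by (rule endo_eqI) (simp add: block.rep_eq zero_endo.rep_eq)

lemma block_1: "block 1 0 0 1 = 1"
  by (rule endo_eqI) (simp add: block.rep_eq one_endo.rep_eq zero_endo.rep_eq)

lemma block_eq_0: "block A B C D = 0 \<longleftrightarrow> A = 0 \<and> B = 0 \<and> C = 0 \<and> D = 0"
  using block_inject[of A B C D 0 0 0 0] by (simp add: block_0)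

interpretation endo: vector_space "scale_endo :: 'k :: field \<Rightarrow> 'k endo \<Rightarrow> 'k endo"
  by unfold_locales (auto intro!: endo_eqI simp: scale_endo.rep_eq plus_endo.rep_eq one_endo.rep_eq algebra_simps)

lemma scale_endo_mult_left: "scale_endo a x * y = scale_endo a (x * y)"
  and scale_endo_mult_right: "x * scale_endo a y = scale_endo a (x * y)"
  by (auto intro!: endo_eqI simp: scale_endo.rep_eq times_endo.rep_eq endo_scale)

text \<open>Matrices act on functions of a natural number blockwise, so that matrices of different sizes
  become elements of one ring and the Kronecker product with a matrix of size 2 becomes a block matrix.\<close>

lift_definition mat_endo :: "nat \<Rightarrow> 'k :: field mat \<Rightarrow> 'k endo" is
  "\<lambda>n A f x. \<Sum>j<n. A $$ (x mod n, j) * f (n * (x div n) + j)"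
  by (auto simp: algebra_simps sum.distrib sum_distrib_left)

context
  fixes n :: nat
  assumes n: "0 < n"
begin

lemma mat_endo_add:
  assumes "A \<in> carrier_mat n n" "B \<in> carrier_mat n n"
  shows "mat_endo n (A + B) = mat_endo n A + mat_endo n B"
  using assms n
  by (intro endo_eqI) (auto simp: mat_endo.rep_eq plus_endo.rep_eq sum.distrib[symmetric] algebra_simps intro!: sum.cong)

lemma mat_endo_scale:
  assumes "A \<in> carrier_mat n n"
  shows "mat_endo n (c \<cdot>\<^sub>m A) = scale_endo c (mat_endo n A)"
  using assms n
  by (intro endo_eqI) (auto simp: mat_endo.rep_eq scale_endo.rep_eq sum_distrib_left algebra_simps intro!: sum.cong)

lemma mat_endo_1: "mat_endo n (1\<^sub>m n) = 1"
proof (rule endo_eqI)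
  fix f :: "nat \<Rightarrow> 'k :: field" and x
  have "Rep_endo (mat_endo n (1\<^sub>m n)) f x = (\<Sum>j<n. if j = x mod n then f (n * (x div n) + j) else 0)"
    unfolding mat_endo.rep_eq using n by (intro sum.cong) auto
  also have "\<dots> = f x" using n by simp
  finally show "Rep_endo (mat_endo n (1\<^sub>m n)) f x = Rep_endo 1 f x" by (simp add: one_endo.rep_eq)
qed

lemma mat_endo_0: "mat_endo n (0\<^sub>m n n) = 0"
  by (rule endo_eqI) (use n in \<open>auto simp: mat_endo.rep_eq zero_endo.rep_eq intro!: sum.neutral\<close>)

lemma mat_endo_mult:
  assumes "A \<in> carrier_mat n n" "B \<in> carrier_mat n n"
  shows "mat_endo n (A * B) = mat_endo n A * mat_endo n B"
proof (rule endo_eqI)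
  fix f x
  have "Rep_endo (mat_endo n A * mat_endo n B) f x =
    (\<Sum>j<n. A $$ (x mod n, j) * (\<Sum>k<n. B $$ (j, k) * f (n * (x div n) + k)))"
    using n by (simp add: times_endo.rep_eq mat_endo.rep_eq)
  also have "\<dots> = (\<Sum>k<n. (\<Sum>j<n. A $$ (x mod n, j) * B $$ (j, k)) * f (n * (x div n) + k))"
    unfolding sum_distrib_left sum_distrib_right by (subst sum.swap) (simp add: mult.assoc)
  also have "\<dots> = (\<Sum>k<n. (A * B) $$ (x mod n, k) * f (n * (x div n) + k))"
    using assms n by (intro sum.cong) (auto simp: scalar_prod_def atLeast0LessThan)
  finally show "Rep_endo (mat_endo n (A * B)) f x = Rep_endo (mat_endo n A * mat_endo n B) f x"
    by (simp add: mat_endo.rep_eq)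
qed

lemma mat_endo_inject:
  assumes "A \<in> carrier_mat n n" "B \<in> carrier_mat n n" "mat_endo n A = mat_endo n B"
  shows "A = B"
proof (rule eq_matI)
  fix i j assume ij: "i < dim_row B" "j < dim_col B"
  have "Rep_endo (mat_endo n M) (\<lambda>x. if x = j then 1 else 0) i = M $$ (i, j)" for M :: "'k :: field mat"
  proof -
    have "Rep_endo (mat_endo n M) (\<lambda>x. if x = j then 1 else 0) i = (\<Sum>k<n. if k = j then M $$ (i, j) else 0)"
      unfolding mat_endo.rep_eq using ij assms by (intro sum.cong) auto
    then show ?thesis using ij assms by simp
  qed
  from this[of A] this[of B] show "A $$ (i, j) = B $$ (i, j)" using assms(3) by simp
qed (use assms in auto)

text \<open>The factor of size 2 stands on the right, so row and column indices split as 2 j + c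
  with c the index of that factor.\<close>

lemma mat_endo_kron:
  assumes A: "A \<in> carrier_mat n n" and B: "B \<in> carrier_mat 2 2"
  shows "mat_endo (n * 2) (kron A B) =
    block (scale_endo (B $$ (0, 0)) (mat_endo n A)) (scale_endo (B $$ (0, 1)) (mat_endo n A))
          (scale_endo (B $$ (1, 0)) (mat_endo n A)) (scale_endo (B $$ (1, 1)) (mat_endo n A))"
proof (rule endo_eqI)
  fix f and x :: nat
  define y b where "y = x div 2" and "b = x mod 2"
  have x: "x = 2 * y + b" "b < 2" by (simp_all add: y_def b_def)
  have mod: "x mod (n * 2) = 2 * (y mod n) + b"
    by (simp only: y_def b_def mult.commute[of n 2] mod_mult2_eq)
  have dvd: "x div (n * 2) = y div n"
    by (simp only: y_def mult.commute[of n 2] div_mult2_eq)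
  let ?g = "\<lambda>c. \<Sum>j<n. A $$ (y mod n, j) * f (2 * (n * (y div n) + j) + c)"
  have "Rep_endo (mat_endo (n * 2) (kron A B)) f x =
      (\<Sum>j<n * 2. kron A B $$ (2 * (y mod n) + b, j) * f (n * 2 * (y div n) + j))"
    by (simp only: mat_endo.rep_eq mod dvd)
  also have "\<dots> = (\<Sum>(j, c)\<in>{..<n} \<times> {..<2}. kron A B $$ (2 * (y mod n) + b, 2 * j + c) * f (n * 2 * (y div n) + (2 * j + c)))"
    by (rule sum.reindex_bij_witness[of _ "\<lambda>(j, c). 2 * j + c" "\<lambda>j. (j div 2, j mod 2)"]) auto
  also have "\<dots> = (\<Sum>j<n. \<Sum>c<2. B $$ (b, c) * (A $$ (y mod n, j) * f (2 * (n * (y div n) + j) + c)))"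
    unfolding sum.cartesian_product[symmetric]
  proof (intro sum.cong refl)
    fix j c assume jc: "j \<in> {..<n}" "c \<in> {..<2::nat}"
    have "2 * (y mod n) + b < n * 2" using x n
      by (metis mod mod_less_divisor nat_0_less_mult_iff pos2)
    moreover have "2 * j + c < n * 2" using jc by auto
    ultimately have "kron A B $$ (2 * (y mod n) + b, 2 * j + c) = A $$ (y mod n, j) * B $$ (b, c)"
      using A B jc x(2) by (simp add: kron_def)
    then show "kron A B $$ (2 * (y mod n) + b, 2 * j + c) * f (n * 2 * (y div n) + (2 * j + c)) =
        B $$ (b, c) * (A $$ (y mod n, j) * f (2 * (n * (y div n) + j) + c))"
      by (simp add: algebra_simps)
  qed
  also have "\<dots> = (\<Sum>c<2. B $$ (b, c) * ?g c)"
    unfolding sum_distrib_left by (rule sum.swap)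
  also have "\<dots> = B $$ (b, 0) * ?g 0 + B $$ (b, 1) * ?g 1"
    by (simp add: numeral_2_eq_2)
  also have "\<dots> = Rep_endo (block (scale_endo (B $$ (0, 0)) (mat_endo n A)) (scale_endo (B $$ (0, 1)) (mat_endo n A))
          (scale_endo (B $$ (1, 0)) (mat_endo n A)) (scale_endo (B $$ (1, 1)) (mat_endo n A))) f x"
    using x(2) unfolding block.rep_eq scale_endo.rep_eq mat_endo.rep_eq
    by (cases b) (auto simp: x(1) less_2_cases_iff)
  finally show "Rep_endo (mat_endo (n * 2) (kron A B)) f x = \<dots>" .
qed

end

section \<open>Operators on tensor powers\<close>

context
  fixes q :: "'k :: field"
begin

text \<open>The generators on the \<open>r\<close>-th tensor power: in an index, the least significant binary digit
  belongs to the last tensor factor, with \<open>0\<close> for \<open>\<omega>\<^sub>1\<close> and \<open>1\<close> for \<open>\<omega>\<^sub>2\<close>. \<open>opL\<close> is the inverse of \<open>opK\<close>,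
  and \<open>opP r m\<close> projects onto the integral weight space \<open>m\<close>.\<close>

primrec opK :: "nat \<Rightarrow> 'k endo" where
  "opK 0 = 1"
| "opK (Suc r) = block (scale_endo q (opK r)) 0 0 (scale_endo (inverse q) (opK r))"

primrec opL :: "nat \<Rightarrow> 'k endo" where
  "opL 0 = 1"
| "opL (Suc r) = block (scale_endo (inverse q) (opL r)) 0 0 (scale_endo q (opL r))"

primrec opE :: "nat \<Rightarrow> 'k endo" where
  "opE 0 = 0"
| "opE (Suc r) = block (scale_endo q (opE r)) 1 0 (scale_endo (inverse q) (opE r))"

primrec opF :: "nat \<Rightarrow> 'k endo" where
  "opF 0 = 0"
| "opF (Suc r) = block (opF r) 0 (opL r) (opF r)"

text \<open>The quantum integer [n] at q, written without division. It is the coefficient that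
  appears when E is raised to the n-th power on one more tensor factor
  (\<open>opE_Suc_pow\<close>).\<close>

primrec qnum :: "nat \<Rightarrow> 'k" where
  "qnum 0 = 0"
| "qnum (Suc n) = q * qnum n + inverse q ^ n"

primrec opP :: "nat \<Rightarrow> int \<Rightarrow> 'k endo" where
  "opP 0 m = (if m = 0 then 1 else 0)"
| "opP (Suc r) m = block (opP r (m - 1)) 0 0 (opP r (m + 1))"

end

section \<open>The relations on tensor powers\<close>

lemmas endo_simps = scale_endo_mult_left scale_endo_mult_right block_mult block_add block_diff block_scale

context
  fixes q :: "'k :: field" and l :: nat
  assumes root: "primitive_root l q" and l3: "3 \<le> l" and odd_l: "odd l"
begin

lemma root_nz: "q \<noteq> 0"
  using root l3 by (metis power_0_left not_numeral_le_zero primitive_root_def zero_neq_one)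

lemma root_sq: "q\<^sup>2 \<noteq> 1" "q * q \<noteq> 1"
  using root l3 by (auto simp: primitive_root_def power2_eq_square[symmetric])

lemma root_inv: "q * inverse q = 1" "inverse q * q = 1" "q * (inverse q * x) = x" "inverse q * (q * x) = x"
  using root_nz by (auto simp flip: mult.assoc)

lemma root_pow_l: "q ^ l = 1" "inverse q ^ l = 1"
  using root by (auto simp: primitive_root_def power_inverse)

lemma opKL: "opK q r * opL q r = 1" "opL q r * opK q r = 1"
  by (induction r) (use root_nz in \<open>auto simp: endo_simps block_1\<close>)

lemma opK_pow: "opK q r ^ l = 1"
proof -
  have "opK q (Suc r) ^ n = block (scale_endo (q ^ n) (opK q r ^ n)) 0 0 (scale_endo (inverse q ^ n) (opK q r ^ n))" for n r
    by (induction n) (auto simp: endo_simps block_1 mult.commute)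
  then show ?thesis
    by (induction r) (auto simp: root_pow_l block_1)
qed

lemma opKE: "opK q r * opE q r = scale_endo (q\<^sup>2) (opE q r * opK q r)"
  by (induction r) (use root_nz in \<open>auto simp: endo_simps power2_eq_square mult_ac\<close>)

lemma opFK: "opF q r * opK q r = scale_endo (q\<^sup>2) (opK q r * opF q r)"
  by (induction r) (use root_nz in \<open>auto simp: endo_simps power2_eq_square mult_ac opKL\<close>)

lemma opEL: "opL q r * opE q r = scale_endo (inverse q * inverse q) (opE q r * opL q r)"
  by (induction r) (auto simp: endo_simps root_inv mult.assoc)

lemma opLF: "opL q r * opF q r = scale_endo (q * q) (opF q r * opL q r)"
  by (induction r) (use root_nz in \<open>auto simp: endo_simps mult_ac\<close>)

lemma opEF: "opE q r * opF q r = opF q r * opE q r + scale_endo (1 / (q - 1 / q)) (opK q r - opL q r)"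
proof (induction r)
  case (Suc r)
  let ?E = "opE q r" and ?F = "opF q r" and ?K = "opK q r" and ?L = "opL q r" and ?k = "1 / (q - 1 / q)"
  have k: "?k * q = ?k * inverse q + 1" "?k * q - 1 = ?k * inverse q"
    using root_nz root_sq by (auto simp: field_simps power2_eq_square)
  have "scale_endo q (?F * ?E + scale_endo ?k (?K - ?L)) + ?L
     = ?F * scale_endo q ?E + scale_endo ?k (scale_endo q ?K - scale_endo (inverse q) ?L)"
    using k(1) by (simp add: scale_endo_mult_right endo.scale_right_distrib endo.scale_right_diff_distrib
      endo.scale_left_distrib mult.commute[of q])
  moreover have "scale_endo (inverse q) (?F * ?E + scale_endo ?k (?K - ?L))
     = ?L + ?F * scale_endo (inverse q) ?E + scale_endo ?k (scale_endo (inverse q) ?K - scale_endo q ?L)"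
    using k(1) by (simp add: scale_endo_mult_right endo.scale_right_distrib endo.scale_right_diff_distrib
      endo.scale_left_distrib mult.commute[of "inverse q"] algebra_simps)
  moreover have "scale_endo (inverse q) (?E * ?L) = scale_endo q (?L * ?E)"
    using root_nz by (simp add: opEL)
  ultimately show ?case
    by (simp add: Suc endo_simps block_inject)
qed simp

lemma opE_Suc_pow: "opE q (Suc r) ^ Suc n = block (scale_endo (q ^ Suc n) (opE q r ^ Suc n))
    (scale_endo (qnum q (Suc n)) (opE q r ^ n)) 0 (scale_endo (inverse q ^ Suc n) (opE q r ^ Suc n))"
proof (induction n)
  case (Suc n)
  show ?case
    unfolding power_Suc[of "opE q (Suc r)" "Suc n"] Suc
    by (simp add: endo_simps block_inject endo.scale_left_distrib endo.scale_right_distrib distrib_left mult_ac)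
qed simp

lemma qnum_eq: "(q - inverse q) * qnum q n = q ^ n - inverse q ^ n"
proof (induction n)
  case (Suc n)
  have "(q - inverse q) * qnum q (Suc n) = q * ((q - inverse q) * qnum q n) + (q - inverse q) * inverse q ^ n"
    by (simp add: algebra_simps)
  also have "\<dots> = q ^ Suc n - inverse q ^ Suc n"
    unfolding Suc by (simp add: algebra_simps)
  finally show ?case .
qed simp

lemma root_diff_nz: "q - inverse q \<noteq> 0"
  using root_nz root_sq by (auto simp: field_simps)

lemma qnum_l: "qnum q l = 0"
  using qnum_eq[of l] root_diff_nz by (simp add: root_pow_l)

lemma qnum_nz: assumes "0 < n" "n < l" shows "qnum q n \<noteq> 0"
proof
  assume "qnum q n = 0"
  then have "q ^ n = inverse q ^ n" using qnum_eq[of n] by simp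
  then have "q powi int n = q powi (- int n)" by (simp add: power_int_minus power_inverse)
  then have "int l dvd int n - - int n" using primitive_root_powi_eq_iff[OF root] by blast
  then have "int l dvd 2 * int n" by simp
  moreover have "coprime (int l) 2" using odd_l by simp
  ultimately have "int l dvd int n" by (simp add: coprime_dvd_mult_right_iff)
  then show False using assms by (auto dest: zdvd_imp_le)
qed

text \<open>Adding a tensor factor produces an off-diagonal entry with coefficient [l], which is 0
  at a primitive l-th root of unity.\<close>

lemma opE_pow: "opE q r ^ l = 0"
proof (induction r)
  case (Suc r)
  then show ?case using opE_Suc_pow[of r "l - 1"] l3 qnum_l by (simp add: block_0)
qed (use l3 in \<open>simp add: power_0_left\<close>)

lemma opF_Suc_pow: "opF q (Suc r) ^ Suc n = block (opF q r ^ Suc n) 0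
    (scale_endo (\<Sum>s\<le>n. (q * q) ^ s) (opF q r ^ n * opL q r)) (opF q r ^ Suc n)"
proof (induction n)
  case (Suc n)
  have "(\<Sum>s\<le>Suc n. (q * q) ^ s) = (\<Sum>s\<le>n. (q * q) ^ s) * (q * q) + 1"
    by (subst sum.atMost_Suc_shift) (simp add: sum_distrib_left mult_ac)
  then show ?case
    unfolding power_Suc2[of "opF q (Suc r)" "Suc n"] Suc
    by (simp add: endo_simps block_inject mult.assoc opLF power_commutes endo.scale_left_distrib)
       (simp add: mult.assoc[symmetric] power_commutes)
qed simp

text \<open>The off-diagonal coefficient is the sum of the first l powers of \<open>q * q\<close>,
  which vanishes since \<open>q * q\<close> is an l-th root of unity other than 1.\<close>

lemma opF_pow: "opF q r ^ l = 0"
proof (induction r)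
  case (Suc r)
  have "(q * q - 1) * (\<Sum>s<l. (q * q) ^ s) = 0"
    using power_diff_1_eq[of "q * q" l] by (simp add: power_mult_distrib root_pow_l)
  then have "(\<Sum>s<l. (q * q) ^ s) = 0" using root_sq by simp
  moreover have "{..l - 1} = {..<l}" using l3 by auto
  ultimately show ?case using opF_Suc_pow[of r "l - 1"] l3 Suc by (simp add: block_0)
qed (use l3 in \<open>simp add: power_0_left\<close>)

lemma uq_op: "uq scale_endo (opE q r) (opF q r) (opK q r) (opL q r) q l"
  by unfold_locales
    (use root l3 odd_l scale_endo_mult_left scale_endo_mult_right opKL opK_pow opKE opFK opEF opE_pow opF_pow in auto)

lemma opE_P: "opE q r * opP r m = opP r (m + 2) * opE q r"
  by (induction r arbitrary: m) (auto simp: endo_simps block_inject algebra_simps)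

lemma opL_P: "opL q r * opP r m = scale_endo (q powi (- m)) (opP r m)"
  "opP r m * opL q r = scale_endo (q powi (- m)) (opP r m)"
  by (induction r arbitrary: m) (use root_nz in \<open>auto simp: endo_simps block_inject power_int_minus power_int_diff power_int_add field_simps\<close>)

lemma opF_P: "opF q r * opP r m = opP r (m - 2) * opF q r"
  by (induction r arbitrary: m) (auto simp: endo_simps block_inject algebra_simps opL_P)

lemma opK_P: "opK q r * opP r m = scale_endo (q powi m) (opP r m)"
  "opP r m * opK q r = scale_endo (q powi m) (opP r m)"
  by (induction r arbitrary: m) (use root_nz in \<open>auto simp: endo_simps block_inject power_int_minus power_int_diff power_int_add field_simps\<close>)

lemma opP_outside: "int r < \<bar>m\<bar> \<Longrightarrow> opP r m = (0 :: 'k endo)"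
  by (induction r arbitrary: m) (auto simp: block_eq_0)

lemma opP_parity: "odd (m - int r) \<Longrightarrow> opP r m = (0 :: 'k endo)"
  by (induction r arbitrary: m) (auto simp: block_eq_0)

lemma sum_block: "(\<Sum>m\<in>I. block (A m) (B m) (C m) (D m)) = block (sum A I) (sum B I) (sum C I) (sum D I)"
  by (induction I rule: infinite_finite_induct) (auto simp: block_0 block_add)

lemma sum_opP: "(\<Sum>m = - int r..int r. opP r m) = (1 :: 'k endo)"
proof (induction r)
  case (Suc r)
  have "(\<Sum>m = - int (Suc r)..int (Suc r). opP r (m - 1)) = (\<Sum>m = - int r - 2..int r. opP r m :: 'k endo)"
    by (rule sum.reindex_bij_witness[of _ "\<lambda>m. m + 1" "\<lambda>m. m - 1"]) auto
  also have "\<dots> = (\<Sum>m = - int r..int r. opP r m)"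
    by (rule sum.mono_neutral_right) (auto intro: opP_outside)
  finally have 1: "(\<Sum>m = - int (Suc r)..int (Suc r). opP r (m - 1)) = (1 :: 'k endo)" using Suc by simp
  have "(\<Sum>m = - int (Suc r)..int (Suc r). opP r (m + 1)) = (\<Sum>m = - int r..int r + 2. opP r m :: 'k endo)"
    by (rule sum.reindex_bij_witness[of _ "\<lambda>m. m - 1" "\<lambda>m. m + 1"]) auto
  also have "\<dots> = (\<Sum>m = - int r..int r. opP r m)"
    by (rule sum.mono_neutral_right) (auto intro: opP_outside)
  finally have 2: "(\<Sum>m = - int (Suc r)..int (Suc r). opP r (m + 1)) = (1 :: 'k endo)" using Suc by simp
  show ?case by (simp only: opP.simps sum_block 1 2 sum.neutral_const block_1)
qed simp

lemma uq_graded_op: "uq_graded scale_endo (opE q r) (opF q r) (opK q r) (opL q r) q l (opP r) r"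
  by (intro uq_graded.intro uq_graded_axioms.intro uq_op opE_P opF_P opK_P opP_outside opP_parity sum_opP)

text \<open>Vectors are represented by operators, on which the algebra acts by left multiplication.\<close>

definition colv :: "'k endo \<Rightarrow> 'k endo \<Rightarrow> 'k endo" where
  "colv x y = block x 0 y 0"

lemma colv_eq_0: "colv x y = 0 \<longleftrightarrow> x = 0 \<and> y = 0"
  by (simp add: colv_def block_eq_0)
lemma scale_colv: "scale_endo c (colv x y) = colv (scale_endo c x) (scale_endo c y)"
  by (simp add: colv_def block_scale)
lemma opE_colv: "opE q (Suc r) * colv x y = colv (scale_endo q (opE q r * x) + y) (scale_endo (inverse q) (opE q r * y))"
  by (simp add: colv_def endo_simps)
lemma opF_colv: "opF q (Suc r) * colv x y = colv (opF q r * x) (opL q r * x + opF q r * y)"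
  by (simp add: colv_def endo_simps)
lemma opK_colv: "opK q (Suc r) * colv x y = colv (scale_endo q (opK q r * x)) (scale_endo (inverse q) (opK q r * y))"
  by (simp add: colv_def endo_simps)

text \<open>Tensoring on the right with the invariant vector of the tensor square of the natural module.\<close>

definition emb :: "'k endo \<Rightarrow> 'k endo" where
  "emb x = colv (colv 0 x) (colv (scale_endo (- q) x) 0)"

lemma emb_eq_0: "emb x = 0 \<longleftrightarrow> x = 0"
  by (auto simp: emb_def colv_eq_0)
lemma emb_0 [simp]: "emb 0 = 0" by (simp add: emb_eq_0)
lemma scale_emb: "scale_endo c (emb x) = emb (scale_endo c x)"
  by (simp add: emb_def scale_colv mult.commute)
text \<open>The appended vector is \<open>\<omega>\<^sub>2 \<otimes> \<omega>\<^sub>1 - q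
  \<omega>\<^sub>1 \<otimes> \<omega>\<^sub>2\<close>; E and F kill it and K fixes it, so appending
  it commutes with all three.\<close>

lemma opE_emb: "opE q (Suc (Suc r)) * emb x = emb (opE q r * x)"
  unfolding emb_def
  by (simp del: opE.simps add: opE_colv scale_colv scale_endo_mult_right root_inv) (simp add: colv_def block_add)
lemma opK_emb: "opK q (Suc (Suc r)) * emb x = emb (opK q r * x)"
  unfolding emb_def
  by (simp del: opK.simps add: opK_colv scale_colv scale_endo_mult_right root_inv)
lemma opF_emb: "opF q (Suc (Suc r)) * emb x = emb (opF q r * x)"
  unfolding emb_def
  by (simp del: opF.simps opL.simps add: opF_colv scale_colv scale_endo_mult_right)
     (simp add: colv_def endo_simps)

lemma opE_pow_emb: "opE q (Suc (Suc r)) ^ n * emb x = emb (opE q r ^ n * x)"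
  by (induction n) (simp_all del: opE.simps add: opE_emb mult.assoc)
lemma opF_pow_emb: "opF q (Suc (Suc r)) ^ n * emb x = emb (opF q r ^ n * x)"
  by (induction n) (simp_all del: opF.simps add: opF_emb mult.assoc)

section \<open>Highest weight vectors and the linking vector\<close>

text \<open>The n-th tensor power of \<open>\<omega>\<^sub>1\<close>; the number 1 stands for the
  basis vector of the trivial module.\<close>

primrec topv :: "nat \<Rightarrow> 'k endo" where
  "topv 0 = 1"
| "topv (Suc n) = colv (topv n) 0"

lemma topv_nz: "topv n \<noteq> 0"
  by (induction n) (auto simp: colv_eq_0)
lemma opE_topv: "opE q n * topv n = 0"
  by (induction n) (auto simp del: opE.simps(2) simp: opE_colv colv_eq_0)
lemma opK_topv: "opK q n * topv n = scale_endo (q powi int n) (topv n)"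
  by (induction n) (use root_nz in \<open>auto simp del: opK.simps(2) simp: opK_colv scale_colv power_int_add mult.commute\<close>)
lemma opP_topv: "opP n (int n) * topv n = topv n"
  by (induction n) (auto simp: colv_def endo_simps)
lemma opF_topv: "opF q n ^ Suc n * topv n = 0"
proof -
  interpret uq_graded scale_endo "opE q n" "opF q n" "opK q n" "opL q n" q l "opP n" n
    by (rule uq_graded_op)
  have "opF q n ^ Suc n * topv n = (opF q n ^ Suc n * opP n (int n)) * topv n"
    by (simp only: mult.assoc opP_topv)
  also have "opF q n ^ Suc n * opP n (int n) = 0"
    by (subst F_pow_P) (simp add: opP_outside)
  finally show ?thesis by simp
qed

text \<open>The vector \<open>\<omega>\<^sub>1\<^sup>n\<close> followed by t invariant vectors,
  which do not change how E, F and K act.\<close>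

lemma ex_primitive_vector:
  "\<exists>X. X \<noteq> 0 \<and> opE q (n + 2 * t) * X = 0 \<and> opK q (n + 2 * t) * X = scale_endo (q powi int n) X \<and>
    opF q (n + 2 * t) ^ Suc n * X = 0"
proof (induction t)
  case 0
  show ?case using topv_nz opE_topv opK_topv opF_topv[of n]
    by (intro exI[of _ "topv n"]) (simp del: power_Suc)
next
  case (Suc t)
  then obtain X where X: "X \<noteq> 0" "opE q (n + 2 * t) * X = 0"
    "opK q (n + 2 * t) * X = scale_endo (q powi int n) X" "opF q (n + 2 * t) ^ Suc n * X = 0" by blast
  have r: "n + 2 * Suc t = Suc (Suc (n + 2 * t))" by simp
  show ?case unfolding r using X
    by (intro exI[of _ "emb X"] conjI) (simp_all only: emb_eq_0 opE_emb opK_emb opF_pow_emb scale_emb emb_0 not_False_eq_True)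
qed

primrec botv :: "nat \<Rightarrow> 'k endo" where
  "botv 0 = 1"
| "botv (Suc n) = colv 0 (botv n)"

lemma opK_botv: "opK q n * botv n = scale_endo (q powi (- int n)) (botv n)"
  by (induction n) (use root_nz in \<open>auto simp del: opK.simps(2) simp: opK_colv scale_colv power_int_diff power_int_minus divide_inverse mult.commute\<close>)

lemma opE_pow_colv: "opE q (Suc r) ^ Suc n * colv x y = colv (scale_endo (q ^ Suc n) (opE q r ^ Suc n * x) +
    scale_endo (qnum q (Suc n)) (opE q r ^ n * y)) (scale_endo (inverse q ^ Suc n) (opE q r ^ Suc n * y))"
  unfolding opE_Suc_pow colv_def by (simp add: endo_simps)

lemma opE_botv: "opE q n ^ n * botv n = scale_endo (\<Prod>j = 1..n. qnum q j) (topv n)"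
proof (induction n)
  case (Suc n)
  have "opE q n ^ Suc n * botv n = 0"
    by (simp only: power_Suc mult.assoc Suc scale_endo_mult_right opE_topv endo.scale_zero_right)
  then have "opE q (Suc n) ^ Suc n * botv (Suc n) =
      colv (scale_endo (qnum q (Suc n)) (scale_endo (\<Prod>j = 1..n. qnum q j) (topv n))) 0"
    by (simp only: botv.simps opE_pow_colv Suc mult_zero_right endo.scale_zero_right add_0_left)
  also have "\<dots> = scale_endo (\<Prod>j = 1..Suc n. qnum q j) (topv (Suc n))"
    by (simp add: scale_colv mult.commute del: qnum.simps)
  finally show ?case .
qed simp

lemma opF_pow_colv: "\<exists>z. opF q (Suc r) ^ n * colv x y = colv (opF q r ^ n * x) z"
  by (induction n) (auto simp del: opF.simps simp: opF_colv mult.assoc)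

text \<open>Y is \<open>\<omega>\<^sub>2\<^sup>k \<otimes> \<omega>\<^sub>1\<^sup>s\<close> followed
  by t invariant vectors. For s = t = 0, \<open>E ^ k\<close> sends Y to the quantum factorial of k
  times \<open>\<omega>\<^sub>1\<^sup>k\<close>, and \<open>F ^ k\<close> does not kill the result
  because \<open>E ^ k * F ^ k\<close> scales it by a product of nonzero differences of
  \<open>cc\<close>; both use k < l.\<close>

lemma ex_linking_vector:
  assumes "k < l"
  shows "\<exists>Y. opK q (k + s + 2 * t) * Y = scale_endo (q powi (int s - int k)) Y \<and>
     opE q (k + s + 2 * t) ^ Suc k * Y = 0 \<and>
     opF q (k + s + 2 * t) ^ k * (opE q (k + s + 2 * t) ^ k * Y) \<noteq> 0"
proof (induction t)
  case 0
  show ?case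
  proof (induction s)
    case 0
    interpret uq scale_endo "opE q k" "opF q k" "opK q k" "opL q k" q l
      by (rule uq_op)
    have w: "wt (int k) (topv k)" by (simp add: wt_def opK_topv)
    have "C * topv k = scale_endo (cc (int k)) (topv k)" using FE_wt[OF w] by (simp add: opE_topv zz_mult)
    then have "opE q k ^ k * (opF q k ^ k * topv k) = scale_endo (\<Prod>s<k. cc (int k) - cc (- int k + 2 * int s)) (topv k)"
      unfolding E_pow_F_pow[OF w] by (rule cp_eigen)
    moreover have "cc (int k) \<noteq> cc (- int k + 2 * int s)" if "s < k" for s
      using cc_ne_chain[of "int k - int s" "int k"] that assms by (simp add: algebra_simps)
    ultimately have "opE q k ^ k * (opF q k ^ k * topv k) \<noteq> 0"
      using topv_nz by simp
    then have "opF q k ^ k * topv k \<noteq> 0" by auto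
    moreover have "(\<Prod>j = 1..k. qnum q j) \<noteq> 0" using assms by (auto simp: qnum_nz Suc_le_eq)
    ultimately have "opF q k ^ k * (opE q k ^ k * botv k) \<noteq> 0"
      by (simp add: opE_botv scale_endo_mult_right)
    moreover have "opE q k ^ Suc k * botv k = 0"
      by (simp only: power_Suc mult.assoc opE_botv scale_endo_mult_right opE_topv endo.scale_zero_right)
    ultimately show ?case using opK_botv[of k]
      by (intro exI[of _ "botv k"]) simp
  next
    case (Suc s)
    then obtain Y where Y: "opK q (k + s) * Y = scale_endo (q powi (int s - int k)) Y"
      "opE q (k + s) ^ Suc k * Y = 0" "opF q (k + s) ^ k * (opE q (k + s) ^ k * Y) \<noteq> 0" by auto
    \<comment> \<open>E kills a last factor \<open>\<omega>\<^sub>1\<close>, on which K acts by q,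
      so E acts on the other factors and is scaled by q.\<close>
    have pow: "opE q (Suc r) ^ n * colv x 0 = colv (scale_endo (q ^ n) (opE q r ^ n * x)) 0" for r n x
      by (induction n) (simp_all del: opE.simps add: opE_colv mult.assoc scale_endo_mult_right)
    have "opK q (Suc (k + s)) * colv Y 0 = scale_endo (q powi (int (Suc s) - int k)) (colv Y 0)"
    proof -
      have "q * q powi (int s - int k) = q powi (int (Suc s) - int k)"
        using root_nz power_int_add[of q 1 "int s - int k"] by (simp add: algebra_simps)
      then show ?thesis
        by (simp only: opK_colv Y scale_colv endo.scale_scale mult_zero_right endo.scale_zero_right)
    qed
    moreover have "opE q (Suc (k + s)) ^ Suc k * colv Y 0 = 0"
      by (simp only: pow Y endo.scale_zero_right colv_eq_0)
    \<comment> \<open>Only the component with last factor \<open>\<omega>\<^sub>1\<close> is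
      followed: F acts on it through the first k + s factors, whatever the other component z
      becomes.\<close>
    moreover have "opF q (Suc (k + s)) ^ k * (opE q (Suc (k + s)) ^ k * colv Y 0) \<noteq> 0"
    proof -
      obtain z where "opF q (Suc (k + s)) ^ k * colv (scale_endo (q ^ k) (opE q (k + s) ^ k * Y)) 0
          = colv (opF q (k + s) ^ k * (scale_endo (q ^ k) (opE q (k + s) ^ k * Y))) z"
        using opF_pow_colv by blast
      then show ?thesis using Y(3) root_nz
        by (simp only: pow colv_eq_0 scale_endo_mult_right endo.scale_eq_0_iff) simp
    qed
    ultimately show ?case by (intro exI[of _ "colv Y 0"]) (simp del: opK.simps opE.simps opF.simps power_Suc)
  qed
next
  case (Suc t)
  have r: "k + s + 2 * Suc t = Suc (Suc (k + s + 2 * t))" by simp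
  from Suc obtain Y where Y: "opK q (k + s + 2 * t) * Y = scale_endo (q powi (int s - int k)) Y"
      "opE q (k + s + 2 * t) ^ Suc k * Y = 0"
      "opF q (k + s + 2 * t) ^ k * (opE q (k + s + 2 * t) ^ k * Y) \<noteq> 0" by blast
  show ?case unfolding r using Y
    by (intro exI[of _ "emb Y"] conjI)
       (simp_all only: opE_pow_emb opF_pow_emb opK_emb scale_emb emb_0 emb_eq_0 not_False_eq_True)
qed

end

section \<open>The six generators as operators\<close>

context
  fixes q :: "'k :: field"
begin

primrec opK1 :: "nat \<Rightarrow> 'k endo" where
  "opK1 0 = 1"
| "opK1 (Suc r) = block (scale_endo q (opK1 r)) 0 0 (opK1 r)"

primrec opK2 :: "nat \<Rightarrow> 'k endo" where
  "opK2 0 = 1"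
| "opK2 (Suc r) = block (opK2 r) 0 0 (scale_endo q (opK2 r))"

primrec opL1 :: "nat \<Rightarrow> 'k endo" where
  "opL1 0 = 1"
| "opL1 (Suc r) = block (scale_endo (inverse q) (opL1 r)) 0 0 (opL1 r)"

primrec opL2 :: "nat \<Rightarrow> 'k endo" where
  "opL2 0 = 1"
| "opL2 (Suc r) = block (opL2 r) 0 0 (scale_endo (inverse q) (opL2 r))"

primrec op_gen :: "nat \<Rightarrow> gen \<Rightarrow> 'k endo" where
  "op_gen r GE = opE q r"
| "op_gen r GF = opF q r"
| "op_gen r GK1 = opK1 r"
| "op_gen r GK2 = opK2 r"
| "op_gen r GK1inv = opL1 r"
| "op_gen r GK2inv = opL2 r"

end

lemma natural_rep_carrier: "natural_rep q g \<in> carrier_mat 2 2"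
  by (cases g) (simp_all add: mat_of_rows_list_def numeral_2_eq_2)

lemma kron_carrier: "A \<in> carrier_mat n n \<Longrightarrow> B \<in> carrier_mat m m \<Longrightarrow> kron A B \<in> carrier_mat (n * m) (n * m)"
  by (auto simp: kron_def)

lemma tensor_rep_carrier:
  assumes "\<And>g. \<rho> g \<in> carrier_mat n n" "\<And>g. \<sigma> g \<in> carrier_mat m m"
  shows "tensor_rep \<rho> \<sigma> g \<in> carrier_mat (n * m) (n * m)"
proof -
  have [simp]: "dim_row (\<rho> g) = n" "dim_row (\<sigma> g) = m" for g using assms by (metis carrier_matD(1))+
  show ?thesis
    by (cases g) (auto intro!: add_carrier_mat kron_carrier mult_carrier_mat assms one_carrier_mat)
qed

lemma tensor_power_rep_carrier: "tensor_power_rep q r g \<in> carrier_mat (2 ^ r) (2 ^ r)"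
proof (induction r arbitrary: g)
  case (Suc r)
  then show ?case using tensor_rep_carrier[of "tensor_power_rep q r" "2 ^ r" "natural_rep q" 2 g, OF _ natural_rep_carrier]
    by (simp add: mult.commute)
qed simp

lemma natural_rep_K: "natural_rep q GK1 * natural_rep q GK2inv = mat_of_rows_list 2 [[q, 0], [0, inverse q]]"
  by (rule eq_matI) (auto simp: mat_of_rows_list_def scalar_prod_def numeral_2_eq_2 less_Suc_eq)

lemma opK_eq: "opK q r = opK1 q r * opL2 q r" and opL_eq: "opL q r = opK2 q r * opL1 q r"
  by (induction r) (auto simp: endo_simps)

text \<open>\<open>mat_endo_kron\<close> turns the Kronecker product with the natural representation
  on the right into a block matrix, so the matrices obey the recursion that defines the
  operators.\<close>

lemma mat_endo_tensor_power_rep: "mat_endo (2 ^ r) (tensor_power_rep q r g) = op_gen q r g"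
proof (induction r arbitrary: g)
  case 0
  have "mat_endo (Suc 0) (0\<^sub>m (Suc 0) (Suc 0)) = (0 :: 'a endo)" "mat_endo (Suc 0) (1\<^sub>m (Suc 0)) = (1 :: 'a endo)"
    using mat_endo_0[of 1] mat_endo_1[of 1] by simp_all
  then show ?case by (cases g) simp_all
next
  case (Suc r)
  let ?n = "2 ^ r :: nat" and ?\<rho> = "tensor_power_rep q r" and ?\<sigma> = "natural_rep q"
  have n: "0 < ?n" by simp
  have c: "?\<rho> g \<in> carrier_mat ?n ?n" "?\<sigma> g \<in> carrier_mat 2 2" for g
    by (rule tensor_power_rep_carrier natural_rep_carrier)+
  have d: "dim_row (?\<rho> g) = ?n" "dim_row (?\<sigma> g) = 2" for g
    using c[of g] by auto
  note k = mat_endo_kron[OF n c(1) c(2)] mat_endo_kron[OF n c(1), of "mat_of_rows_list 2 [[q, 0], [0, inverse q]]"]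
    mat_endo_kron[OF n one_carrier_mat c(2)] mat_endo_kron[OF n c(1) one_carrier_mat]
    mat_endo_kron[OF n mult_carrier_mat[OF c(1) c(1)] c(2)]
  have add: "mat_endo (?n * 2) (A + B) = mat_endo (?n * 2) A + mat_endo (?n * 2) B"
    if "A \<in> carrier_mat (?n * 2) (?n * 2)" "B \<in> carrier_mat (?n * 2) (?n * 2)" for A B :: "'a mat"
    by (rule mat_endo_add) (use that in auto)
  have cm: "mat_of_rows_list 2 [[q, 0], [0, inverse q]] \<in> carrier_mat 2 2" by (simp add: mat_of_rows_list_def numeral_2_eq_2)
  have "mat_endo (?n * 2) (tensor_rep ?\<rho> ?\<sigma> g) = op_gen q (Suc r) g"
  proof (cases g)
    case GE
    have "mat_endo (?n * 2) (tensor_rep ?\<rho> ?\<sigma> GE) =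
      mat_endo (?n * 2) (kron (?\<rho> GE) (mat_of_rows_list 2 [[q, 0], [0, inverse q]])) + mat_endo (?n * 2) (kron (1\<^sub>m ?n) (?\<sigma> GE))"
      unfolding tensor_rep.simps natural_rep_K d
      by (intro add kron_carrier c cm one_carrier_mat)
    then show ?thesis unfolding GE k(2)[OF cm] k(3) Suc mat_endo_1[OF n]
      by (simp add: mat_of_rows_list_def block_add)
  next
    case GF
    have "mat_endo (?n * 2) (tensor_rep ?\<rho> ?\<sigma> GF) =
      mat_endo (?n * 2) (kron (?\<rho> GF) (1\<^sub>m 2)) + mat_endo (?n * 2) (kron (?\<rho> GK2 * ?\<rho> GK1inv) (?\<sigma> GF))"
      unfolding tensor_rep.simps d
      by (intro add kron_carrier c mult_carrier_mat[OF c(1) c(1)] one_carrier_mat)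
    then show ?thesis unfolding GF k(4) k(5) mat_endo_mult[OF n c(1) c(1)] Suc
      by (simp add: mat_of_rows_list_def block_add opL_eq)
  qed (simp_all add: k(1) Suc del: natural_rep.simps, simp_all add: mat_of_rows_list_def)
  then show ?case by (simp only: tensor_power_rep.simps power_Suc mult.commute)
qed

context
  fixes q :: "'k :: field" and l :: nat
  assumes root: "primitive_root l q" and l3: "3 \<le> l" and odd_l: "odd l"
begin

lemma opK1_pow_l: "opK1 q r ^ l = 1"
proof -
  have "opK1 q (Suc r) ^ n = block (scale_endo (q ^ n) (opK1 q r ^ n)) 0 0 (opK1 q r ^ n)" for n r
    by (induction n) (auto simp: endo_simps block_1 mult.commute)
  then show ?thesis
    by (induction r) (use root in \<open>auto simp: primitive_root_def block_1\<close>)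
qed

lemma opK1K2: "opK1 q r * opK2 q r = scale_endo (q ^ r) 1"
proof (induction r)
  case (Suc r)
  have "block (scale_endo c 1) 0 0 (scale_endo c 1) = scale_endo c 1" for c :: 'k
    using block_scale[of c 1 0 0 1] by (simp add: block_1)
  with Suc show ?case by (simp add: endo_simps mult.commute)
qed simp

lemma opK_L_inverse: "opK1 q r * opL1 q r = 1" "opL1 q r * opK1 q r = 1" "opK2 q r * opL2 q r = 1" "opL2 q r * opK2 q r = 1"
  by (induction r) (use root_nz[OF root l3 odd_l] in \<open>auto simp: endo_simps block_1\<close>)

lemma opK_comm: "opK2 q r * opK1 q r = opK1 q r * opK2 q r" "opL2 q r * opK1 q r = opK1 q r * opL2 q r"
  by (induction r) (auto simp: endo_simps)

text \<open>The square of \<open>K\<^sub>1\<close> is \<open>(K\<^sub>1 K\<^sub>2) (K\<^sub>1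
  K\<^sub>2\<^sup>-\<^sup>1) = q\<^sup>r K\<close>. As l + 1 is even and the l-th power of
  \<open>K\<^sub>1\<close> is 1, raising to (l + 1) / 2 extracts the root.\<close>

lemma opK1_eq: "opK1 q r = (scale_endo (q ^ r) (opK q r)) ^ ((l + 1) div 2)"
proof -
  have "opK1 q r * opK1 q r = opK1 q r * (opK2 q r * opL2 q r) * opK1 q r"
    by (simp add: opK_L_inverse)
  also have "\<dots> = (opK1 q r * opK2 q r) * (opL2 q r * opK1 q r)" by (simp only: mult.assoc)
  also have "\<dots> = scale_endo (q ^ r) (opK q r)"
    by (simp add: opK1K2 opK_comm opK_eq scale_endo_mult_left)
  finally have "(scale_endo (q ^ r) (opK q r)) ^ ((l + 1) div 2) = opK1 q r ^ (2 * ((l + 1) div 2))"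
    by (simp add: power_mult power2_eq_square)
  also have "2 * ((l + 1) div 2) = Suc l" using odd_l by simp
  finally show ?thesis by (simp add: opK1_pow_l)
qed

lemma opK2_eq: "opK2 q r = scale_endo (q ^ r) (opK1 q r ^ (l - 1))"
proof -
  have "opK1 q r ^ (l - 1) * opK1 q r = 1"
    using opK1_pow_l[of r] l3 by (metis power_minus_mult not_numeral_le_zero bot_nat_0.not_eq_extremum)
  then have "opK2 q r = opK1 q r ^ (l - 1) * (opK1 q r * opK2 q r)" by (simp flip: mult.assoc)
  then show ?thesis by (simp add: opK1K2 scale_endo_mult_right)
qed

lemma opL1_eq: "opL1 q r = opK1 q r ^ (l - 1)"
proof -
  have "opK1 q r ^ (l - 1) * opK1 q r = 1"
    using opK1_pow_l[of r] l3 by (metis power_minus_mult not_numeral_le_zero bot_nat_0.not_eq_extremum)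
  then have "opL1 q r = opK1 q r ^ (l - 1) * (opK1 q r * opL1 q r)" by (simp flip: mult.assoc)
  then show ?thesis by (simp add: opK_L_inverse)
qed

lemma opL2_eq: "opL2 q r = scale_endo (inverse q ^ r) (opK1 q r)"
proof -
  have "scale_endo (q ^ r) (opL2 q r) = (opK1 q r * opK2 q r) * opL2 q r"
    by (simp add: opK1K2 scale_endo_mult_left)
  also have "\<dots> = opK1 q r" by (simp add: mult.assoc opK_L_inverse)
  finally have "scale_endo (inverse q ^ r) (opK1 q r) = scale_endo (inverse q ^ r * q ^ r) (opL2 q r)"
    by (metis endo.scale_scale)
  then show ?thesis using root_nz[OF root l3 odd_l] by (simp add: power_inverse)
qed

interpretation uq scale_endo "opE q r" "opF q r" "opK q r" "opL q r" q l for r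
  by (rule uq_op[OF root l3 odd_l])

lemma op_gen_in_alg: "op_gen q r g \<in> alg r"
proof -
  have K1: "opK1 q r \<in> alg r" unfolding opK1_eq by (intro alg_pow alg_scale alg_K)
  have "opL1 q r \<in> alg r" "opK2 q r \<in> alg r" "opL2 q r \<in> alg r"
    unfolding opL1_eq opK2_eq opL2_eq by (intro alg_pow alg_scale K1)+
  with K1 show ?thesis by (cases g) (auto intro: alg_E alg_F)
qed

end

section \<open>The specialised quantum enveloping algebra\<close>

lemma monoid_algebra_simps:
  "carrier (monoid_algebra M) = {f. finite {x. f x \<noteq> 0} \<and> {x. f x \<noteq> 0} \<subseteq> carrier M}"
  "f \<oplus>\<^bsub>monoid_algebra M\<^esub> g = (\<lambda>w. f w + g w)"
  "\<zero>\<^bsub>monoid_algebra M\<^esub> = (\<lambda>w. 0)"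
  "\<one>\<^bsub>monoid_algebra M\<^esub> = (\<lambda>w. if w = \<one>\<^bsub>M\<^esub> then 1 else 0)"
  by (simp_all add: monoid_algebra_def)

text \<open>Any finite sets containing the supports are allowed, so that several products can be
  expanded over common index sets.\<close>

lemma monoid_algebra_mult:
  assumes "finite A" "finite B" "{x. f x \<noteq> 0} \<subseteq> A" "{x. g x \<noteq> 0} \<subseteq> B"
  shows "(f \<otimes>\<^bsub>monoid_algebra M\<^esub> g) w = (\<Sum>u\<in>A. \<Sum>v\<in>B. if u \<otimes>\<^bsub>M\<^esub> v = w then f u * g v else 0)"
proof -
  have "(f \<otimes>\<^bsub>monoid_algebra M\<^esub> g) w = (\<Sum>(u, v) \<in> {(u, v). f u \<noteq> 0 \<and> g v \<noteq> 0 \<and> u \<otimes>\<^bsub>M\<^esub> v = w}. f u * g v)"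
    by (simp add: monoid_algebra_def)
  also have "\<dots> = (\<Sum>(u, v) \<in> A \<times> B. if u \<otimes>\<^bsub>M\<^esub> v = w then f u * g v else 0)"
    using assms by (intro sum.mono_neutral_cong_left) (auto split: if_splits)
  finally show ?thesis by (simp add: sum.cartesian_product)
qed

lemma monoid_algebra_mult_support:
  "{w. (f \<otimes>\<^bsub>monoid_algebra M\<^esub> g) w \<noteq> 0} \<subseteq> (\<lambda>(u, v). u \<otimes>\<^bsub>M\<^esub> v) ` ({x. f x \<noteq> 0} \<times> {x. g x \<noteq> 0})"
proof
  fix w assume w: "w \<in> {w. (f \<otimes>\<^bsub>monoid_algebra M\<^esub> g) w \<noteq> 0}"
  then have "{(u, v). f u \<noteq> 0 \<and> g v \<noteq> 0 \<and> u \<otimes>\<^bsub>M\<^esub> v = w} \<noteq> {}"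
    by (auto simp: monoid_algebra_def simp del: Collect_empty_eq)
  then show "w \<in> (\<lambda>(u, v). u \<otimes>\<^bsub>M\<^esub> v) ` ({x. f x \<noteq> 0} \<times> {x. g x \<noteq> 0})" by auto
qed

lemma (in monoid) monoid_algebra_mult_closed:
  assumes "f \<in> carrier (monoid_algebra G)" "g \<in> carrier (monoid_algebra G)"
  shows "f \<otimes>\<^bsub>monoid_algebra G\<^esub> g \<in> carrier (monoid_algebra G)"
proof -
  let ?S = "(\<lambda>(u, v). u \<otimes> v) ` ({x. f x \<noteq> 0} \<times> {x. g x \<noteq> 0})"
  have "finite ?S" "?S \<subseteq> carrier G" using assms by (auto simp: monoid_algebra_simps)
  then show ?thesis
    using monoid_algebra_mult_support[of G f g] finite_subset[of _ ?S] by (auto simp: monoid_algebra_simps)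
qed

text \<open>Pairs a product with a test function; in the proof of associativity \<phi> is the sum
  over the remaining factor.\<close>

lemma monoid_algebra_sum_mult:
  assumes "finite A" "finite B" "{x. f x \<noteq> 0} \<subseteq> A" "{x. g x \<noteq> 0} \<subseteq> B"
    and S: "finite S" "\<And>u v. u \<in> A \<Longrightarrow> v \<in> B \<Longrightarrow> u \<otimes>\<^bsub>M\<^esub> v \<in> S"
  shows "(\<Sum>x\<in>S. (f \<otimes>\<^bsub>monoid_algebra M\<^esub> g) x * \<phi> x) = (\<Sum>u\<in>A. \<Sum>v\<in>B. f u * g v * \<phi> (u \<otimes>\<^bsub>M\<^esub> v))"
proof -
  have "(\<Sum>x\<in>S. (f \<otimes>\<^bsub>monoid_algebra M\<^esub> g) x * \<phi> x)
     = (\<Sum>x\<in>S. \<Sum>u\<in>A. \<Sum>v\<in>B. if u \<otimes>\<^bsub>M\<^esub> v = x then f u * g v * \<phi> x else 0)"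
    unfolding monoid_algebra_mult[OF assms(1-4)] sum_distrib_right by (intro sum.cong) auto
  also have "\<dots> = (\<Sum>u\<in>A. \<Sum>v\<in>B. \<Sum>x\<in>S. if u \<otimes>\<^bsub>M\<^esub> v = x then f u * g v * \<phi> x else 0)"
    by (subst sum.swap, subst (2) sum.swap) simp
  also have "\<dots> = (\<Sum>u\<in>A. \<Sum>v\<in>B. f u * g v * \<phi> (u \<otimes>\<^bsub>M\<^esub> v))"
    using S by (intro sum.cong refl) simp
  finally show ?thesis .
qed

lemma (in monoid) monoid_algebra_assoc:
  assumes f: "f \<in> carrier (monoid_algebra G)" and g: "g \<in> carrier (monoid_algebra G)"
    and h: "h \<in> carrier (monoid_algebra G)"
  shows "f \<otimes>\<^bsub>monoid_algebra G\<^esub> g \<otimes>\<^bsub>monoid_algebra G\<^esub> h = f \<otimes>\<^bsub>monoid_algebra G\<^esub> (g \<otimes>\<^bsub>monoid_algebra G\<^esub> h)"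
proof
  fix w
  define A B D where "A = {x. f x \<noteq> 0}" and "B = {x. g x \<noteq> 0}" and "D = {x. h x \<noteq> 0}"
  have fin: "finite A" "finite B" "finite D" and sub: "A \<subseteq> carrier G" "B \<subseteq> carrier G" "D \<subseteq> carrier G"
    using f g h by (auto simp: A_def B_def D_def monoid_algebra_simps)
  have le: "{x. f x \<noteq> 0} \<subseteq> A" "{x. h x \<noteq> 0} \<subseteq> D" by (auto simp: A_def D_def)
  define S T where "S = (\<lambda>(u, v). u \<otimes> v) ` (A \<times> B)" and "T = (\<lambda>(u, v). u \<otimes> v) ` (B \<times> D)"
  have ST: "finite S" "finite T" using fin by (auto simp: S_def T_def)
  let ?fg = "f \<otimes>\<^bsub>monoid_algebra G\<^esub> g" and ?gh = "g \<otimes>\<^bsub>monoid_algebra G\<^esub> h"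
  have S: "{x. ?fg x \<noteq> 0} \<subseteq> S" and T: "{x. ?gh x \<noteq> 0} \<subseteq> T"
    unfolding S_def T_def A_def B_def D_def by (rule monoid_algebra_mult_support)+
  have "(?fg \<otimes>\<^bsub>monoid_algebra G\<^esub> h) w = (\<Sum>x\<in>S. ?fg x * (\<Sum>c\<in>D. if x \<otimes> c = w then h c else 0))"
    unfolding monoid_algebra_mult[OF ST(1) fin(3) S le(2)] sum_distrib_left
    by (intro sum.cong) auto
  also have "\<dots> = (\<Sum>u\<in>A. \<Sum>v\<in>B. f u * g v * (\<Sum>c\<in>D. if u \<otimes> v \<otimes> c = w then h c else 0))"
    by (rule monoid_algebra_sum_mult) (use fin ST in \<open>auto simp: A_def B_def S_def\<close>)
  also have "\<dots> = (\<Sum>u\<in>A. f u * (\<Sum>v\<in>B. \<Sum>c\<in>D. g v * h c * (if u \<otimes> (v \<otimes> c) = w then 1 else 0)))"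
    unfolding sum_distrib_left
  proof (intro sum.cong refl)
    fix u v c assume "u \<in> A" "v \<in> B" "c \<in> D"
    then have "u \<otimes> v \<otimes> c = u \<otimes> (v \<otimes> c)" using sub by (intro m_assoc) auto
    then show "f u * g v * (if u \<otimes> v \<otimes> c = w then h c else 0) = f u * (g v * h c * (if u \<otimes> (v \<otimes> c) = w then 1 else 0))"
      by (simp add: mult.assoc)
  qed
  also have "\<dots> = (\<Sum>u\<in>A. f u * (\<Sum>y\<in>T. ?gh y * (if u \<otimes> y = w then 1 else 0)))"
    by (intro sum.cong refl arg_cong2[where f = "(*)"] monoid_algebra_sum_mult[symmetric])
       (use fin ST in \<open>auto simp: B_def D_def T_def\<close>)
  also have "\<dots> = (f \<otimes>\<^bsub>monoid_algebra G\<^esub> ?gh) w"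
    unfolding monoid_algebra_mult[OF fin(1) ST(2) le(1) T] sum_distrib_left
    by (intro sum.cong) auto
  finally show "(?fg \<otimes>\<^bsub>monoid_algebra G\<^esub> h) w = (f \<otimes>\<^bsub>monoid_algebra G\<^esub> ?gh) w" .
qed

lemma term_of_carrier: "x \<in> carrier M \<Longrightarrow> term_of c x \<in> carrier (monoid_algebra M)"
  by (auto simp: monoid_algebra_simps term_of_def intro: finite_subset[of _ "{x}"])

lemma (in monoid) monoid_algebra_ring: "ring (monoid_algebra G :: ('a \<Rightarrow> 'c :: comm_ring_1) ring)"
proof (rule ringI)
  let ?R = "monoid_algebra G :: ('a \<Rightarrow> 'c) ring"
  have add_closed: "f \<oplus>\<^bsub>?R\<^esub> g \<in> carrier ?R" if "f \<in> carrier ?R" "g \<in> carrier ?R" for f g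
  proof -
    have "{x. f x + g x \<noteq> 0} \<subseteq> {x. f x \<noteq> 0} \<union> {x. g x \<noteq> 0}" by auto
    then show ?thesis using that by (auto simp: monoid_algebra_simps intro: finite_subset)
  qed
  show "abelian_group ?R"
  proof (rule abelian_groupI)
    fix f assume f: "f \<in> carrier ?R"
    then show "\<exists>y\<in>carrier ?R. y \<oplus>\<^bsub>?R\<^esub> f = \<zero>\<^bsub>?R\<^esub>"
      by (intro bexI[of _ "\<lambda>w. - f w"]) (auto simp: monoid_algebra_simps)
  qed (rule add_closed, assumption, assumption, simp_all add: monoid_algebra_simps algebra_simps)
  have supp: "finite {x. f x \<noteq> 0}" if "f \<in> carrier ?R" for f
    using that by (simp add: monoid_algebra_simps)
  show "Group.monoid ?R"
  proof
    have one: "\<one>\<^bsub>?R\<^esub> = term_of 1 \<one>" by (simp add: monoid_algebra_simps term_of_def fun_eq_iff)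
    then show "\<one>\<^bsub>?R\<^esub> \<in> carrier ?R" by (simp add: term_of_carrier)
    fix f assume f: "f \<in> carrier ?R"
    have fc: "f v \<noteq> 0 \<Longrightarrow> v \<in> carrier G" for v using f by (auto simp: monoid_algebra_simps)
    have s: "{x. term_of (1 :: 'c) \<one> x \<noteq> 0} \<subseteq> {\<one>}" by (auto simp: term_of_def)
    have collapse: "(\<Sum>v\<in>{x. f x \<noteq> 0}. if v = w then f v else 0) = f w" for w
      using supp[OF f] by simp
    show "\<one>\<^bsub>?R\<^esub> \<otimes>\<^bsub>?R\<^esub> f = f"
    proof
      fix w
      have "(\<one>\<^bsub>?R\<^esub> \<otimes>\<^bsub>?R\<^esub> f) w = (\<Sum>v\<in>{x. f x \<noteq> 0}. if \<one> \<otimes> v = w then f v else 0)"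
        unfolding one monoid_algebra_mult[OF finite.insertI[OF finite.emptyI] supp[OF f] s order_refl]
        by (simp add: term_of_def cong: if_cong)
      also have "\<dots> = (\<Sum>v\<in>{x. f x \<noteq> 0}. if v = w then f v else 0)"
        using fc by (intro sum.cong) auto
      finally show "(\<one>\<^bsub>?R\<^esub> \<otimes>\<^bsub>?R\<^esub> f) w = f w" using collapse by simp
    qed
    show "f \<otimes>\<^bsub>?R\<^esub> \<one>\<^bsub>?R\<^esub> = f"
    proof
      fix w
      have "(f \<otimes>\<^bsub>?R\<^esub> \<one>\<^bsub>?R\<^esub>) w = (\<Sum>v\<in>{x. f x \<noteq> 0}. if v \<otimes> \<one> = w then f v else 0)"
        unfolding one monoid_algebra_mult[OF supp[OF f] finite.insertI[OF finite.emptyI] order_refl s]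
        by (simp add: term_of_def cong: if_cong)
      also have "\<dots> = (\<Sum>v\<in>{x. f x \<noteq> 0}. if v = w then f v else 0)"
        using fc by (intro sum.cong) auto
      finally show "(f \<otimes>\<^bsub>?R\<^esub> \<one>\<^bsub>?R\<^esub>) w = f w" using collapse by simp
    qed
  qed (auto intro: monoid_algebra_mult_closed monoid_algebra_assoc)
  fix f g h assume fgh: "f \<in> carrier ?R" "g \<in> carrier ?R" "h \<in> carrier ?R"
  define A where "A = {x. f x \<noteq> 0} \<union> {x. g x \<noteq> 0} \<union> {x. h x \<noteq> 0}"
  have A: "finite A" using supp fgh by (auto simp: A_def)
  have m: "(a \<otimes>\<^bsub>?R\<^esub> b) w = (\<Sum>u\<in>A. \<Sum>v\<in>A. if u \<otimes> v = w then a u * b v else 0)"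
    if "{x. a x \<noteq> 0} \<subseteq> A" "{x. b x \<noteq> 0} \<subseteq> A" for a b :: "'a \<Rightarrow> 'c" and w
    by (rule monoid_algebra_mult[OF A A that])
  have s: "{x. f x \<noteq> 0} \<subseteq> A" "{x. g x \<noteq> 0} \<subseteq> A" "{x. h x \<noteq> 0} \<subseteq> A"
    "{x. f x + g x \<noteq> 0} \<subseteq> A" by (auto simp: A_def)
  show "(f \<oplus>\<^bsub>?R\<^esub> g) \<otimes>\<^bsub>?R\<^esub> h = f \<otimes>\<^bsub>?R\<^esub> h \<oplus>\<^bsub>?R\<^esub> g \<otimes>\<^bsub>?R\<^esub> h"
    unfolding monoid_algebra_simps
    by (rule ext) (auto simp: m s sum.distrib[symmetric] algebra_simps intro!: sum.cong)
  show "h \<otimes>\<^bsub>?R\<^esub> (f \<oplus>\<^bsub>?R\<^esub> g) = h \<otimes>\<^bsub>?R\<^esub> f \<oplus>\<^bsub>?R\<^esub> h \<otimes>\<^bsub>?R\<^esub> g"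
    unfolding monoid_algebra_simps
    by (rule ext) (auto simp: m s sum.distrib[symmetric] algebra_simps intro!: sum.cong)
qed

section \<open>The integral form and its specialisation as rings\<close>

lemma monoid_free_monoid: "Group.monoid (free_monoid :: 'g list monoid)"
  by unfold_locales (auto simp: free_monoid_def)

interpretation FA: ring "FA :: (gen list \<Rightarrow> qfield) ring"
  by (rule monoid.monoid_algebra_ring[OF monoid_free_monoid])

lemma FA_term: "term_of c w \<in> carrier FA"
  by (rule term_of_carrier) (simp add: free_monoid_def)

lemma U_relators_carrier: "U_relators \<subseteq> carrier FA"
  unfolding U_relators_def Let_def
  by (auto intro!: FA.minus_closed FA.m_closed FA_term)

interpretation Uq: ring Uq
  unfolding Uq_def by (rule ideal.quotient_is_ring[OF FA.genideal_ideal[OF U_relators_carrier]])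

lemma coset_carrier: "x \<in> carrier FA \<Longrightarrow> (Idl\<^bsub>FA\<^esub> U_relators) +>\<^bsub>FA\<^esub> x \<in> carrier Uq"
  by (auto simp: Uq_def FactRing_def A_RCOSETS_def' )

lemma U_gen_carrier: "U_gen g \<in> carrier Uq" and U_scalar_carrier: "U_scalar a \<in> carrier Uq"
  unfolding U_gen_def U_scalar_def by (rule coset_carrier[OF FA_term])+

lemma divided_power_carrier: "divided_power g m \<in> carrier Uq"
  unfolding divided_power_def by (intro Uq.m_closed U_scalar_carrier Uq.nat_pow_closed U_gen_carrier)

lemma kbinom_carrier: "kbinom K K' t \<in> carrier Uq"
  by (induction t) (auto intro!: Uq.m_closed Uq.minus_closed U_scalar_carrier U_gen_carrier)

lemma UZ_subring: "subring UZ_carrier Uq"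
  unfolding UZ_carrier_def
  by (rule Uq.generate_ring_is_subring)
     (auto intro: U_gen_carrier U_scalar_carrier divided_power_carrier kbinom_carrier)

interpretation UZ: ring UZ
  unfolding UZ_def by (rule Uq.subring_is_ring[OF UZ_subring])

lemma v_sq_neq_1: "\<upsilon> - inverse \<upsilon> \<noteq> 0"
proof
  assume "\<upsilon> - inverse \<upsilon> = 0"
  then have "\<upsilon> = inverse \<upsilon>" by simp
  then have "Fraction_Field.Fract [:0, 1:] (1 :: rat poly) = Fraction_Field.Fract 1 [:0, 1:]"
    by (simp add: \<upsilon>_def)
  then have "[:0, 1:] * [:0, 1:] = (1 :: rat poly)" by (simp add: eq_fract)
  then show False by (simp add: one_pCons)
qed

lemma U_scalar_1: "U_scalar 1 = \<one>\<^bsub>Uq\<^esub>"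
proof -
  have "term_of (1 :: qfield) [] = \<one>\<^bsub>FA\<^esub>"
    by (simp add: term_of_def monoid_algebra_simps free_monoid_def fun_eq_iff)
  then show ?thesis by (simp add: U_scalar_def Uq_def FactRing_def)
qed

lemma divided_power_1: "divided_power g 1 = U_gen g"
proof -
  have "qint 1 = 1" using v_sq_neq_1 by (simp add: qint_def)
  then have "qfact 1 = 1" by (simp add: qfact_def)
  then show ?thesis
    by (simp add: divided_power_def U_scalar_1 U_gen_carrier del: One_nat_def)
qed

text \<open>E and F occur among the generators of the integral form as their first divided
  powers.\<close>

lemma U_gen_UZ: "U_gen g \<in> carrier UZ"
proof -
  have "U_gen g \<in> range (divided_power GE) \<union> range (divided_power GF) \<union> {U_gen GK1, U_gen GK2, U_gen GK1inv, U_gen GK2inv}"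
    using divided_power_1[of GE] divided_power_1[of GF] by (cases g) (auto simp del: One_nat_def intro: rev_image_eqI)
  then show ?thesis
    unfolding UZ_def UZ_carrier_def by (auto intro!: generate_ring.incl)
qed

lemma U_scalar_laurent_UZ: "U_scalar (laurent_eval n p \<upsilon>) \<in> carrier UZ"
  unfolding UZ_def UZ_carrier_def by (auto intro!: generate_ring.incl)

lemma field_ring_monoid: "Group.monoid (field_ring :: 'k :: field ring)"
  by unfold_locales (auto simp: field_ring_def)

lemma TR_ring: "ring (TR :: 'k :: field tr ring)"
proof -
  have "Group.monoid (UZ \<times>\<times> (field_ring :: 'k ring))"
    by (rule DirProd_monoid[OF UZ.monoid_axioms field_ring_monoid])
  then show ?thesis unfolding TR_def by (rule monoid.monoid_algebra_ring)
qed

lemma TR_term: "x \<in> carrier UZ \<Longrightarrow> term_of c (x, a) \<in> carrier (TR :: 'k :: field tr ring)"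
  unfolding TR_def by (rule term_of_carrier) (simp add: field_ring_def)

lemma tensor_relators_carrier: "tensor_relators \<epsilon> \<subseteq> carrier (TR :: 'k :: field tr ring)"
proof -
  interpret TR: ring "TR :: 'k tr ring" by (rule TR_ring)
  show ?thesis unfolding tensor_relators_def
    by (auto intro!: TR.minus_closed TR.add.m_closed TR_term U_scalar_laurent_UZ)
qed

lemma Uk_ring: "ring (Uk \<epsilon>)"
proof -
  interpret TR: ring "TR :: 'a tr ring" by (rule TR_ring)
  interpret ideal "Idl\<^bsub>TR\<^esub> (tensor_relators \<epsilon>)" TR
    by (rule TR.genideal_ideal[OF tensor_relators_carrier])
  show ?thesis unfolding Uk_def by (rule quotient_is_ring)
qed

lemma pure_tensor_carrier: "x \<in> carrier UZ \<Longrightarrow> pure_tensor \<epsilon> x a \<in> carrier (Uk \<epsilon>)"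
  using TR_term by (auto simp: pure_tensor_def Uk_def FactRing_def A_RCOSETS_def')

lemma Uk_gen_carrier: "Uk_gen \<epsilon> g \<in> carrier (Uk \<epsilon>)" and Uk_scalar_carrier: "Uk_scalar \<epsilon> a \<in> carrier (Uk \<epsilon>)"
  unfolding Uk_gen_def Uk_scalar_def by (intro pure_tensor_carrier U_gen_UZ UZ.one_closed)+

lemma small_u_subring: "subring (small_u \<epsilon>) (Uk \<epsilon>)"
proof -
  interpret ring "Uk \<epsilon>" by (rule Uk_ring)
  show ?thesis unfolding small_u_def
    by (rule generate_ring_is_subring) (auto intro: Uk_gen_carrier Uk_scalar_carrier)
qed

lemma zeta_ring_hom:
  fixes \<zeta> :: "'k :: field tr set \<Rightarrow> 'k mat"
  assumes "is_zeta \<epsilon> r \<zeta>"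
  shows "ring_hom_ring (Uk \<epsilon>) (ring_mat TYPE('k) (2 ^ r) ()) \<zeta>"
  using assms by (intro ring_hom_ringI2 Uk_ring ring_mat) (simp add: is_zeta_def)

lemma zeta_image_subring:
  fixes \<zeta> :: "'k :: field tr set \<Rightarrow> 'k mat"
  assumes "is_zeta \<epsilon> r \<zeta>"
  shows "subring (\<zeta> ` small_u \<epsilon>) (ring_mat TYPE('k) (2 ^ r) ())"
  by (rule ring_hom_ring.img_is_subring[OF zeta_ring_hom[OF assms] small_u_subring])

lemma little_q_schur_ring: "is_zeta \<epsilon> r \<zeta> \<Longrightarrow> ring (little_q_schur \<epsilon> r \<zeta>)"
  unfolding little_q_schur_def by (rule ring.subring_is_ring[OF ring_mat zeta_image_subring])

section \<open>Blocks of the little q-Schur algebra\<close>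

context left_module begin

lemma zero_smult: "x \<in> carrier M \<Longrightarrow> \<zero> \<odot>\<^bsub>M\<^esub> x = \<zero>\<^bsub>M\<^esub>"
  using smult_l_distr[of "\<zero>" "\<zero>" x] smult_closed[of "\<zero>" x] by (simp add: M.r_neg2)

lemma smult_zero: "a \<in> carrier R \<Longrightarrow> a \<odot>\<^bsub>M\<^esub> \<zero>\<^bsub>M\<^esub> = \<zero>\<^bsub>M\<^esub>"
  using smult_r_distr[of a "\<zero>\<^bsub>M\<^esub>" "\<zero>\<^bsub>M\<^esub>"] smult_closed[of a "\<zero>\<^bsub>M\<^esub>"] by (simp add: M.r_neg2)

lemma smult_minus_one: assumes "x \<in> carrier M" shows "(\<ominus> \<one>) \<odot>\<^bsub>M\<^esub> x = \<ominus>\<^bsub>M\<^esub> x"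
proof -
  have "(\<ominus> \<one>) \<odot>\<^bsub>M\<^esub> x \<oplus>\<^bsub>M\<^esub> x = (\<ominus> \<one> \<oplus> \<one>) \<odot>\<^bsub>M\<^esub> x"
    using assms by (simp add: smult_l_distr smult_one)
  also have "\<dots> = \<zero>\<^bsub>M\<^esub>" using assms by (simp add: R.l_neg zero_smult)
  finally show ?thesis using assms by (intro M.minus_equality[symmetric] smult_closed) auto
qed

text \<open>Closure under negatives, required of an additive subgroup, comes from the action of
  -1.\<close>

lemma submodule_iff: "submodule N R M \<longleftrightarrow> N \<subseteq> carrier M \<and> \<zero>\<^bsub>M\<^esub> \<in> N \<and>
    (\<forall>x\<in>N. \<forall>y\<in>N. x \<oplus>\<^bsub>M\<^esub> y \<in> N) \<and> (\<forall>a\<in>carrier R. \<forall>x\<in>N. a \<odot>\<^bsub>M\<^esub> x \<in> N)" (is "_ \<longleftrightarrow> ?P")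
proof
  assume "submodule N R M"
  then interpret submodule N R M .
  show ?P using subset m_closed one_closed smult_closed by auto
next
  assume P: ?P
  show "submodule N R M"
  proof (intro submodule.intro subgroup.intro submodule_axioms.intro)
    fix x assume x: "x \<in> N"
    then have "inv\<^bsub>add_monoid M\<^esub> x = (\<ominus> \<one>) \<odot>\<^bsub>M\<^esub> x"
      using P by (subst smult_minus_one) (auto simp: a_inv_def)
    then show "inv\<^bsub>add_monoid M\<^esub> x \<in> N" using P x by auto
  qed (use P in auto)
qed

lemma left_module_submodule: assumes "submodule N R M" shows "left_module R (M\<lparr>carrier := N\<rparr>)"
proof -
  have P: "N \<subseteq> carrier M" "\<zero>\<^bsub>M\<^esub> \<in> N" "\<And>x y. x \<in> N \<Longrightarrow> y \<in> N \<Longrightarrow> x \<oplus>\<^bsub>M\<^esub> y \<in> N"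
    "\<And>a x. a \<in> carrier R \<Longrightarrow> x \<in> N \<Longrightarrow> a \<odot>\<^bsub>M\<^esub> x \<in> N"
    using assms unfolding submodule_iff by auto
  have "abelian_group (M\<lparr>carrier := N\<rparr>)"
  proof (rule abelian_groupI)
    fix x assume "x \<in> carrier (M\<lparr>carrier := N\<rparr>)"
    then have x: "x \<in> N" "x \<in> carrier M" using P by auto
    then have "(\<ominus> \<one>) \<odot>\<^bsub>M\<^esub> x \<in> N" using P by auto
    moreover have "(\<ominus> \<one>) \<odot>\<^bsub>M\<^esub> x \<oplus>\<^bsub>M\<^esub> x = \<zero>\<^bsub>M\<^esub>"
      using x by (simp add: smult_minus_one M.l_neg)
    ultimately show "\<exists>y\<in>carrier (M\<lparr>carrier := N\<rparr>). y \<oplus>\<^bsub>M\<lparr>carrier := N\<rparr>\<^esub> x = \<zero>\<^bsub>M\<lparr>carrier := N\<rparr>\<^esub>" by auto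
  qed (use P in \<open>auto simp: M.a_ac subset_iff\<close>)
  then show ?thesis
    using P by (intro left_module.intro left_module_axioms.intro R.ring_axioms)
      (auto simp: subset_iff smult_l_distr smult_r_distr smult_assoc smult_one)
qed

lemma submodule_of_submodule:
  assumes "submodule T R M"
  shows "submodule N R (M\<lparr>carrier := T\<rparr>) \<longleftrightarrow> submodule N R M \<and> N \<subseteq> T"
proof -
  interpret T: left_module R "M\<lparr>carrier := T\<rparr>" by (rule left_module_submodule[OF assms])
  show ?thesis unfolding submodule_iff T.submodule_iff using assms unfolding submodule_iff by auto
qed

lemma simple_submodule_iff:
  assumes "submodule T R M"
  shows "simple_module R (M\<lparr>carrier := T\<rparr>) \<longleftrightarrow>
    T \<noteq> {\<zero>\<^bsub>M\<^esub>} \<and> (\<forall>N. submodule N R M \<and> N \<subseteq> T \<longrightarrow> N = {\<zero>\<^bsub>M\<^esub>} \<or> N = T)"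
  unfolding simple_module_def submodule_of_submodule[OF assms]
  using left_module_submodule[OF assms] by simp

end

lemma regular_module_left_module: assumes "ring R" shows "left_module R (regular_module R)"
proof -
  interpret ring R by fact
  have "abelian_group (regular_module R)"
    by (rule abelian_groupI) (auto simp: regular_module_def a_ac l_neg intro: bexI[of _ "\<ominus>\<^bsub>R\<^esub> _"])
  then show ?thesis
    by (intro left_module.intro left_module_axioms.intro)
       (auto simp: regular_module_def l_distr r_distr m_assoc ring_axioms)
qed

section \<open>Transfer from matrices to operators\<close>

locale schur_rep =
  fixes q :: "'k :: field" and l r :: nat and \<zeta> :: "'k tr set \<Rightarrow> 'k mat"
  assumes l3: "3 \<le> l" and odd_l: "odd l" and root: "primitive_root l q" and zeta: "is_zeta q r \<zeta>"
begin

sublocale uq_graded scale_endo "opE q r" "opF q r" "opK q r" "opL q r" q l "opP r" r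
  by (rule uq_graded_op[OF root l3 odd_l])

definition S :: "'k mat set" where "S = \<zeta> ` small_u q"

definition \<Phi> :: "'k mat \<Rightarrow> 'k endo" where "\<Phi> = mat_endo (2 ^ r)"

abbreviation A :: "'k mat ring" where "A \<equiv> little_q_schur q r \<zeta>"

lemma A_simps: "carrier A = S" "mult A = (*)" "add A = (+)" "one A = 1\<^sub>m (2 ^ r)" "zero A = 0\<^sub>m (2 ^ r) (2 ^ r)"
  by (simp_all add: little_q_schur_def S_def ring_mat_simps)

lemma S_subring: "subring S (ring_mat TYPE('k) (2 ^ r) ())"
  unfolding S_def by (rule zeta_image_subring[OF zeta])

lemma S_carrier: "x \<in> S \<Longrightarrow> x \<in> carrier_mat (2 ^ r) (2 ^ r)"
  using subringE(1)[OF S_subring] by (auto simp: ring_mat_simps)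

lemma S_closed: "0\<^sub>m (2 ^ r) (2 ^ r) \<in> S" "1\<^sub>m (2 ^ r) \<in> S" "x \<in> S \<Longrightarrow> y \<in> S \<Longrightarrow> x + y \<in> S"
  "x \<in> S \<Longrightarrow> y \<in> S \<Longrightarrow> x * y \<in> S"
  using subringE[OF S_subring] by (auto simp: ring_mat_simps)

lemma zeta_scalar: "\<zeta> (Uk_scalar q a) = a \<cdot>\<^sub>m 1\<^sub>m (2 ^ r)" and zeta_gen: "\<zeta> (Uk_gen q g) = tensor_power_rep q r g"
  using zeta by (auto simp: is_zeta_def)

lemma S_scalar: "a \<cdot>\<^sub>m 1\<^sub>m (2 ^ r) \<in> S"
proof -
  have "Uk_scalar q a \<in> small_u q" unfolding small_u_def by (rule generate_ring.incl) auto
  then show ?thesis unfolding S_def zeta_scalar[symmetric] by (rule imageI)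
qed

lemma S_gen: "\<zeta> (Uk_gen q g) \<in> S"
  unfolding S_def small_u_def by (rule imageI, rule generate_ring.incl) auto

lemma \<Phi>_hom: "x \<in> S \<Longrightarrow> y \<in> S \<Longrightarrow> \<Phi> (x + y) = \<Phi> x + \<Phi> y" "x \<in> S \<Longrightarrow> y \<in> S \<Longrightarrow> \<Phi> (x * y) = \<Phi> x * \<Phi> y"
  "\<Phi> (1\<^sub>m (2 ^ r)) = 1" "\<Phi> (0\<^sub>m (2 ^ r) (2 ^ r)) = 0" "\<Phi> (a \<cdot>\<^sub>m 1\<^sub>m (2 ^ r)) = scale_endo a 1"
  "\<Phi> (\<zeta> (Uk_gen q g)) = op_gen q r g"
  unfolding \<Phi>_def zeta_gen mat_endo_tensor_power_rep
  by (auto intro!: mat_endo_add mat_endo_mult mat_endo_1 mat_endo_0 S_carrier simp: mat_endo_scale mat_endo_1)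

lemma \<Phi>_inj: "x \<in> S \<Longrightarrow> y \<in> S \<Longrightarrow> \<Phi> x = \<Phi> y \<longleftrightarrow> x = y"
  unfolding \<Phi>_def using mat_endo_inject[of "2 ^ r" x y] S_carrier by auto

text \<open>With \<open>\<Phi>_surj\<close> and \<open>\<Phi>_inj\<close> this identifies the little
  q-Schur algebra with \<open>alg\<close>. The induction follows the generation of
  \<open>small_u\<close>, since \<zeta> is prescribed only on scalars and generators.\<close>

lemma \<Phi>_alg: "x \<in> S \<Longrightarrow> \<Phi> x \<in> alg"
proof -
  interpret Z: ring_hom_ring "Uk q" "ring_mat TYPE('k) (2 ^ r) ()" \<zeta> by (rule zeta_ring_hom[OF zeta])
  have sub: "x \<in> carrier (Uk q)" if "x \<in> small_u q" for x
    using subringE(1)[OF small_u_subring] that by blast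
  have z: "\<zeta> x \<in> S" if "x \<in> small_u q" for x using that by (auto simp: S_def)
  have "\<Phi> (\<zeta> x) \<in> alg" if "x \<in> small_u q" for x
    using that unfolding small_u_def
  proof induction
    case one
    then show ?case by (simp add: ring_mat_simps \<Phi>_hom)
  next
    case (incl h)
    then show ?case using op_gen_in_alg[OF root l3 odd_l] alg_scalar by (auto simp: zeta_scalar \<Phi>_hom)
  next
    case (a_inv h)
    then have h: "h \<in> small_u q" by (simp add: small_u_def)
    then have mh: "\<ominus>\<^bsub>Uk q\<^esub> h \<in> small_u q" using subringE(5)[OF small_u_subring] by blast
    have "\<zeta> (\<ominus>\<^bsub>Uk q\<^esub> h) + \<zeta> h = \<zeta> (\<ominus>\<^bsub>Uk q\<^esub> h \<oplus>\<^bsub>Uk q\<^esub> h)"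
      using sub[OF h] sub[OF mh] by (simp add: ring_mat_simps)
    also have "\<dots> = 0\<^sub>m (2 ^ r) (2 ^ r)" using sub[OF h] by (simp add: Z.R.l_neg ring_mat_simps)
    finally have "\<Phi> (\<zeta> (\<ominus>\<^bsub>Uk q\<^esub> h)) + \<Phi> (\<zeta> h) = 0"
      by (simp add: \<Phi>_hom flip: \<Phi>_hom(1)[OF z[OF mh] z[OF h]])
    then have "\<Phi> (\<zeta> (\<ominus>\<^bsub>Uk q\<^esub> h)) = - \<Phi> (\<zeta> h)" by (simp add: eq_neg_iff_add_eq_0)
    then show ?case using a_inv alg_uminus by simp
  next
    case (eng_add x y)
    then have "x \<in> small_u q" "y \<in> small_u q" by (auto simp: small_u_def)
    then show ?case using eng_add sub z by (simp add: ring_mat_simps \<Phi>_hom alg_add)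
  next
    case (eng_mult x y)
    then have "x \<in> small_u q" "y \<in> small_u q" by (auto simp: small_u_def)
    then show ?case using eng_mult sub z by (simp add: ring_mat_simps \<Phi>_hom alg_mult)
  qed
  then show "x \<in> S \<Longrightarrow> \<Phi> x \<in> alg" by (auto simp: S_def)
qed

lemma \<Phi>_surj: "a \<in> alg \<Longrightarrow> \<exists>x\<in>S. \<Phi> x = a"
proof (induction rule: alg.induct)
  case (alg_scalar a)
  show ?case using S_scalar[of a] \<Phi>_hom(5)[of a] by blast
next
  case alg_E
  show ?case using S_gen[of GE] \<Phi>_hom(6)[of GE] by auto
next
  case alg_F
  show ?case using S_gen[of GF] \<Phi>_hom(6)[of GF] by auto
next
  case alg_K
  have "\<Phi> (\<zeta> (Uk_gen q GK1) * \<zeta> (Uk_gen q GK2inv)) = opK q r"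
    using \<Phi>_hom(2)[OF S_gen S_gen, of GK1 GK2inv] by (simp add: \<Phi>_hom opK_eq)
  then show ?case using S_closed(4)[OF S_gen S_gen] by blast
next
  case alg_L
  have "\<Phi> (\<zeta> (Uk_gen q GK2) * \<zeta> (Uk_gen q GK1inv)) = opL q r"
    using \<Phi>_hom(2)[OF S_gen S_gen, of GK2 GK1inv] by (simp add: \<Phi>_hom opL_eq)
  then show ?case using S_closed(4)[OF S_gen S_gen] by blast
next
  case (alg_add x y)
  then show ?case using \<Phi>_hom(1) S_closed(3) by metis
next
  case (alg_mult x y)
  then show ?case using \<Phi>_hom(2) S_closed(4) by metis
qed

lemma A_ring: "ring A" by (rule little_q_schur_ring[OF zeta])

lemma central_idempotent_iff: "central_idempotent A e \<longleftrightarrow> e \<in> S \<and> \<Phi> e \<in> Zc \<and> \<Phi> e * \<Phi> e = \<Phi> e"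
proof (cases "e \<in> S")
  case True
  have "e * e = e \<longleftrightarrow> \<Phi> e * \<Phi> e = \<Phi> e"
    using True by (simp add: S_closed \<Phi>_inj flip: \<Phi>_hom)
  moreover have "e * x = x * e \<longleftrightarrow> \<Phi> e * \<Phi> x = \<Phi> x * \<Phi> e" if "x \<in> S" for x
    using True that by (simp add: S_closed \<Phi>_inj flip: \<Phi>_hom)
  moreover have "\<Phi> e \<in> Zc \<longleftrightarrow> (\<forall>x\<in>S. \<Phi> e * \<Phi> x = \<Phi> x * \<Phi> e)"
    unfolding Zc_def using \<Phi>_alg \<Phi>_surj True by blast
  ultimately show ?thesis using True by (simp add: central_idempotent_def A_simps) blast
qed (simp add: central_idempotent_def A_simps)

lemma primitive_iff: "primitive_central_idempotent A e \<longleftrightarrow> e \<in> S \<and> pci (\<Phi> e)"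
proof (cases "e \<in> S")
  case True
  have z: "x = 0\<^sub>m (2 ^ r) (2 ^ r) \<longleftrightarrow> \<Phi> x = 0" if "x \<in> S" for x
    using \<Phi>_inj[OF that S_closed(1)] by (simp add: \<Phi>_hom)
  have m: "x * y = 0\<^sub>m (2 ^ r) (2 ^ r) \<longleftrightarrow> \<Phi> x * \<Phi> y = 0" if "x \<in> S" "y \<in> S" for x y
    using that by (simp add: z S_closed \<Phi>_hom)
  have a: "e = x + y \<longleftrightarrow> \<Phi> e = \<Phi> x + \<Phi> y" if "x \<in> S" "y \<in> S" for x y
    using that True \<Phi>_inj[OF True S_closed(3)[OF that]] by (simp add: \<Phi>_hom)
  show ?thesis
  proof
    assume L: "primitive_central_idempotent A e"
    have "f = 0 \<or> g = 0" if fg: "f \<in> Zc" "f * f = f" "g \<in> Zc" "g * g = g" "f * g = 0" "\<Phi> e = f + g" for f g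
    proof -
      obtain x y where xy: "x \<in> S" "\<Phi> x = f" "y \<in> S" "\<Phi> y = g"
        using \<Phi>_surj[OF Zc_alg[OF fg(1)]] \<Phi>_surj[OF Zc_alg[OF fg(3)]] by blast
      then have "central_idempotent A x" "central_idempotent A y" using fg by (auto simp: central_idempotent_iff)
      moreover have "x * y = 0\<^sub>m (2 ^ r) (2 ^ r)" "e = x + y" using xy fg m a by auto
      ultimately have "x = 0\<^sub>m (2 ^ r) (2 ^ r) \<or> y = 0\<^sub>m (2 ^ r) (2 ^ r)"
        using L unfolding primitive_central_idempotent_def A_simps by blast
      then show ?thesis using xy z by blast
    qed
    then show "e \<in> S \<and> pci (\<Phi> e)"
      using L True z[OF True] unfolding primitive_central_idempotent_def pci_def central_idempotent_iff A_simps by blast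
  next
    assume Rr: "e \<in> S \<and> pci (\<Phi> e)"
    have "x = 0\<^sub>m (2 ^ r) (2 ^ r) \<or> y = 0\<^sub>m (2 ^ r) (2 ^ r)"
      if "central_idempotent A x" "central_idempotent A y" "x * y = 0\<^sub>m (2 ^ r) (2 ^ r)" "e = x + y" for x y
    proof -
      have xy: "x \<in> S" "y \<in> S" using that by (auto simp: central_idempotent_iff)
      then have "\<Phi> x * \<Phi> y = 0" "\<Phi> e = \<Phi> x + \<Phi> y" using that m a by auto
      then have "\<Phi> x = 0 \<or> \<Phi> y = 0"
        using Rr that unfolding pci_def central_idempotent_iff by blast
      then show ?thesis using xy z by blast
    qed
    then show "primitive_central_idempotent A e"
      using Rr z[OF True] unfolding primitive_central_idempotent_def pci_def central_idempotent_iff A_simps by blast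
  qed
qed (simp add: primitive_central_idempotent_def central_idempotent_iff)

section \<open>Block ideals and their left ideals\<close>

definition blk :: "'k mat \<Rightarrow> 'k mat ring" where
  "blk e = A\<lparr>carrier := (\<lambda>x. x \<otimes>\<^bsub>A\<^esub> e) ` carrier A, one := e\<rparr>"

lemma blocks_eq: "blocks A = {blk e | e. primitive_central_idempotent A e}"
  unfolding blocks_def blk_def ..

text \<open>Treats the whole algebra as the ideal of the central idempotent 1, so that one
  semisimplicity criterion serves blocks and the full algebra.\<close>

lemma blk_one: "blk (1\<^sub>m (2 ^ r)) = A"
proof -
  have "(\<lambda>x. x * 1\<^sub>m (2 ^ r)) ` S = S" using S_carrier by force
  then have "blk (1\<^sub>m (2 ^ r)) = A\<lparr>carrier := carrier A, one := one A\<rparr>"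
    unfolding blk_def by (simp add: A_simps)
  then show ?thesis by simp
qed

lemma blk_simps: "mult (blk e) = (*)" "add (blk e) = (+)" "one (blk e) = e" "zero (blk e) = 0\<^sub>m (2 ^ r) (2 ^ r)"
  by (simp_all add: blk_def A_simps)

lemma blk_carrier:
  assumes "central_idempotent A e" shows "carrier (blk e) = {x \<in> S. \<Phi> x * \<Phi> e = \<Phi> x}"
proof -
  have e: "e \<in> S" "\<Phi> e * \<Phi> e = \<Phi> e" using assms by (auto simp: central_idempotent_iff)
  show ?thesis
  proof (intro equalityI subsetI)
    fix x assume "x \<in> carrier (blk e)"
    then obtain y where "y \<in> S" "x = y * e" by (auto simp: blk_def A_simps)
    then show "x \<in> {x \<in> S. \<Phi> x * \<Phi> e = \<Phi> x}" using e by (simp add: S_closed \<Phi>_hom mult.assoc)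
  next
    fix x assume x: "x \<in> {x \<in> S. \<Phi> x * \<Phi> e = \<Phi> x}"
    then have "\<Phi> (x * e) = \<Phi> x" using e by (simp add: \<Phi>_hom)
    then have "x * e = x" using x e \<Phi>_inj[OF S_closed(4)] by blast
    then show "x \<in> carrier (blk e)" using x by (force simp: blk_def A_simps)
  qed
qed

lemma blk_ring: assumes c: "central_idempotent A e" shows "ring (blk e)"
proof (rule ringI)
  note C = blk_carrier[OF c]
  have e: "e \<in> S" "\<Phi> e * \<Phi> e = \<Phi> e" "\<Phi> e \<in> Zc" using c by (auto simp: central_idempotent_iff)
  have inS: "x \<in> S" if "x \<in> carrier (blk e)" for x using that by (simp add: C)
  have eqI: "x = y" if "x \<in> S" "y \<in> S" "\<Phi> x = \<Phi> y" for x y using that \<Phi>_inj by blast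
  have left: "\<Phi> e * \<Phi> x = \<Phi> x" if "x \<in> carrier (blk e)" for x
    using that Zc_comm[OF e(3) \<Phi>_alg] by (auto simp: C)
  show "abelian_group (blk e)"
  proof (rule abelian_groupI)
    fix x assume x: "x \<in> carrier (blk e)"
    have "- \<Phi> x \<in> alg" using x by (intro alg_uminus \<Phi>_alg inS)
    then obtain y where y: "y \<in> S" "\<Phi> y = - \<Phi> x" using \<Phi>_surj by metis
    then have "y + x = 0\<^sub>m (2 ^ r) (2 ^ r)" using inS[OF x] by (intro eqI S_closed) (auto simp: \<Phi>_hom)
    then show "\<exists>y\<in>carrier (blk e). y \<oplus>\<^bsub>blk e\<^esub> x = \<zero>\<^bsub>blk e\<^esub>"
      using y x by (intro bexI[of _ y]) (auto simp: blk_simps C)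
  qed (auto simp: blk_simps C S_closed \<Phi>_hom distrib_right intro!: eqI)
  show "Group.monoid (blk e)"
  proof
    fix x assume x: "x \<in> carrier (blk e)"
    show "\<one>\<^bsub>blk e\<^esub> \<otimes>\<^bsub>blk e\<^esub> x = x"
      using left[OF x] inS[OF x] e by (intro eqI) (auto simp: blk_simps S_closed \<Phi>_hom)
    show "x \<otimes>\<^bsub>blk e\<^esub> \<one>\<^bsub>blk e\<^esub> = x"
      using x e by (intro eqI) (auto simp: blk_simps S_closed \<Phi>_hom C)
  qed (use e in \<open>auto simp: blk_simps C S_closed \<Phi>_hom mult.assoc intro!: eqI\<close>)
qed (auto simp: blk_simps blk_carrier[OF c] S_closed \<Phi>_hom distrib_left distrib_right \<Phi>_inj[symmetric])

lemma regular_simps: "carrier (regular_module (blk e)) = carrier (blk e)" "zero (regular_module (blk e)) = 0\<^sub>m (2 ^ r) (2 ^ r)"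
  "add (regular_module (blk e)) = (+)" "smult (regular_module (blk e)) = (*)"
  by (simp_all add: regular_module_def blk_simps)

definition stable :: "'k endo set \<Rightarrow> bool" where
  "stable T \<longleftrightarrow> 0 \<in> T \<and> (\<forall>x\<in>T. \<forall>y\<in>T. x + y \<in> T) \<and> (\<forall>a\<in>alg. \<forall>x\<in>T. a * x \<in> T)"

lemma submodule_blk_iff:
  assumes c: "central_idempotent A e"
  shows "submodule N (blk e) (regular_module (blk e)) \<longleftrightarrow>
    N \<subseteq> carrier (blk e) \<and> stable (\<Phi> ` N)" (is "?L \<longleftrightarrow> ?R")
proof -
  interpret left_module "blk e" "regular_module (blk e)" by (rule regular_module_left_module[OF blk_ring[OF c]])
  note C = blk_carrier[OF c]
  have e: "e \<in> S" "\<Phi> e * \<Phi> e = \<Phi> e" "\<Phi> e \<in> Zc" using c by (auto simp: central_idempotent_iff)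
  show ?thesis
  proof
    assume L: ?L
    then have N: "N \<subseteq> carrier (blk e)" and N0: "0\<^sub>m (2 ^ r) (2 ^ r) \<in> N" and add: "\<And>x y. x \<in> N \<Longrightarrow> y \<in> N \<Longrightarrow> x + y \<in> N"
      and sm: "\<And>a x. a \<in> carrier (blk e) \<Longrightarrow> x \<in> N \<Longrightarrow> a * x \<in> N"
      unfolding submodule_iff regular_simps by auto
    have NS: "x \<in> S" if "x \<in> N" for x using N that C by auto
    have "stable (\<Phi> ` N)" unfolding stable_def
    proof (intro conjI ballI)
      show "0 \<in> \<Phi> ` N" using N0 \<Phi>_hom(4) by force
    next
      fix x y assume "x \<in> \<Phi> ` N" "y \<in> \<Phi> ` N"
      then obtain m n where mn: "m \<in> N" "n \<in> N" "x = \<Phi> m" "y = \<Phi> n" by blast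
      then have "x + y = \<Phi> (m + n)" using \<Phi>_hom(1)[OF NS NS] by simp
      then show "x + y \<in> \<Phi> ` N" using add[OF mn(1,2)] by (rule image_eqI)
    next
      fix a x assume a: "a \<in> alg" and "x \<in> \<Phi> ` N"
      then obtain n where n: "n \<in> N" "x = \<Phi> n" by auto
      \<comment> \<open>a e lies in the block ring and acts on the block as a does, so stability
        under the block ring is stability under all of \<open>alg\<close>.\<close>
      obtain m where m: "m \<in> S" "\<Phi> m = a * \<Phi> e" using \<Phi>_surj alg_mult[OF a Zc_alg[OF e(3)]] by metis
      then have "m \<in> carrier (blk e)" using e by (simp add: C mult.assoc)
      then have "m * n \<in> N" using sm n by blast
      moreover have "\<Phi> (m * n) = a * x"
      proof -
        have "n \<in> S" "\<Phi> n * \<Phi> e = \<Phi> n" using n N by (auto simp only: C)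
        then have "\<Phi> e * \<Phi> n = \<Phi> n" using Zc_comm[OF e(3) \<Phi>_alg, of n] by simp
        then show ?thesis using m n NS by (simp add: \<Phi>_hom mult.assoc)
      qed
      ultimately show "a * x \<in> \<Phi> ` N" by force
    qed
    then show ?R using N by blast
  next
    assume R: ?R
    then have N: "N \<subseteq> carrier (blk e)" and NS: "\<And>x. x \<in> N \<Longrightarrow> x \<in> S" using C by auto
    have mem: "x \<in> N" if "x \<in> S" "\<Phi> x \<in> \<Phi> ` N" for x
      using that NS \<Phi>_inj by (metis imageE)
    have st: "0 \<in> \<Phi> ` N" "\<And>x y. x \<in> \<Phi> ` N \<Longrightarrow> y \<in> \<Phi> ` N \<Longrightarrow> x + y \<in> \<Phi> ` N"
      "\<And>a x. a \<in> alg \<Longrightarrow> x \<in> \<Phi> ` N \<Longrightarrow> a * x \<in> \<Phi> ` N"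
      using R by (auto simp only: stable_def)
    have "0\<^sub>m (2 ^ r) (2 ^ r) \<in> N" using st(1) by (intro mem S_closed) (simp only: \<Phi>_hom)
    moreover have "x + y \<in> N" if "x \<in> N" "y \<in> N" for x y
    proof (rule mem)
      show "x + y \<in> S" by (rule S_closed(3)[OF NS NS, OF that])
      show "\<Phi> (x + y) \<in> \<Phi> ` N"
        unfolding \<Phi>_hom(1)[OF NS NS, OF that] by (rule st(2)[OF imageI imageI, OF that])
    qed
    moreover have "a * x \<in> N" if "a \<in> carrier (blk e)" "x \<in> N" for a x
    proof (rule mem)
      have a: "a \<in> S" using that(1) unfolding C by simp
      show "a * x \<in> S" by (rule S_closed(4)[OF a NS[OF that(2)]])
      show "\<Phi> (a * x) \<in> \<Phi> ` N"
        unfolding \<Phi>_hom(2)[OF a NS[OF that(2)]] by (rule st(3)[OF \<Phi>_alg[OF a] imageI[OF that(2)]])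
    qed
    ultimately show ?L unfolding submodule_iff regular_simps using N by blast
  qed
qed

text \<open>Simplicity in the form that every nonzero element generates. T may consist of operators
  outside \<open>alg\<close>, so the notion covers left ideals of a block as well as submodules of
  the tensor power.\<close>

definition minimal :: "'k endo set \<Rightarrow> bool" where
  "minimal T \<longleftrightarrow> stable T \<and> T \<noteq> {0} \<and> (\<forall>t\<in>T. t \<noteq> 0 \<longrightarrow> (\<forall>T'. stable T' \<and> t \<in> T' \<longrightarrow> T \<subseteq> T'))"

lemma minimal_simple:
  assumes c: "central_idempotent A e" and T: "minimal T" "T \<subseteq> {y \<in> alg. y * \<Phi> e = y}"
  defines "N \<equiv> {m \<in> S. \<Phi> m \<in> T}"
  shows "submodule N (blk e) (regular_module (blk e)) \<and> simple_module (blk e) ((regular_module (blk e))\<lparr>carrier := N\<rparr>)"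
proof -
  interpret left_module "blk e" "regular_module (blk e)" by (rule regular_module_left_module[OF blk_ring[OF c]])
  note C = blk_carrier[OF c]
  have img: "\<Phi> ` N = T" using T(2) \<Phi>_surj unfolding N_def by blast
  have sub: "submodule N (blk e) (regular_module (blk e))"
    using T img unfolding submodule_blk_iff[OF c] minimal_def by (auto simp: N_def C)
  have "N \<noteq> {0\<^sub>m (2 ^ r) (2 ^ r)}" using img T(1) by (auto simp: minimal_def \<Phi>_hom)
  moreover have "M = {0\<^sub>m (2 ^ r) (2 ^ r)} \<or> M = N"
    if M: "submodule M (blk e) (regular_module (blk e))" "M \<subseteq> N" for M
  proof (cases "M \<subseteq> {0\<^sub>m (2 ^ r) (2 ^ r)}")
    case True
    moreover have "0\<^sub>m (2 ^ r) (2 ^ r) \<in> M" using M(1) unfolding submodule_iff regular_simps by blast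
    ultimately show ?thesis by blast
  next
    case False
    then obtain m where m: "m \<in> M" "m \<noteq> 0\<^sub>m (2 ^ r) (2 ^ r)" by blast
    then have "\<Phi> m \<noteq> 0" using \<Phi>_inj[OF _ S_closed(1), of m] M(2) by (auto simp: \<Phi>_hom N_def)
    moreover have "stable (\<Phi> ` M)" using M(1) submodule_blk_iff[OF c] by blast
    ultimately have "T \<subseteq> \<Phi> ` M" using T(1) m M(2) unfolding minimal_def N_def by blast
    then have "N \<subseteq> M" using M(2) \<Phi>_inj unfolding N_def by blast
    then show ?thesis using M(2) by blast
  qed
  ultimately have "simple_module (blk e) ((regular_module (blk e))\<lparr>carrier := N\<rparr>)"
    unfolding simple_submodule_iff[OF sub] regular_simps by blast
  then show ?thesis using sub by blast
qed

lemma Fspan_is_minimal: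
  assumes u: "u \<noteq> 0" "wt i u" "opE q r * u = 0" "opF q r ^ Suc (nat i) * u = 0" and i: "0 \<le> i" "i < int l"
  shows "minimal (endo.span ((\<lambda>k. opF q r ^ k * u) ` {..<Suc (nat i)}))" (is "minimal ?T")
proof -
  have uT: "u \<in> ?T" by (rule endo.span_base) force
  have st: "stable ?T" unfolding stable_def
    using endo.span_zero endo.span_add Fspan_stable[OF u(2-4)] by blast
  have "?T \<subseteq> T'" if t: "t \<in> ?T" "t \<noteq> 0" "stable T'" "t \<in> T'" for t T'
  proof
    fix x assume x: "x \<in> ?T"
    have "u \<in> T'"
      by (rule Fspan_minimal[OF u(2,3) i(2) _ _ t(4,2,1)]) (use i t(3) in \<open>auto simp: stable_def\<close>)
    have 0: "0 \<in> T'" "\<And>x y. x \<in> T' \<Longrightarrow> y \<in> T' \<Longrightarrow> x + y \<in> T'" "\<And>a x. a \<in> alg \<Longrightarrow> x \<in> T' \<Longrightarrow> a * x \<in> T'"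
      using t(3) by (auto simp: stable_def)
    show "x \<in> T'" using x
    proof (induction rule: endo.span_induct_alt)
      case (step c x y)
      then obtain k where "x = opF q r ^ k * u" by auto
      then have "scale_endo c x = scale_endo c (opF q r ^ k) * u" by (simp add: scale_mult_left)
      then have "scale_endo c x \<in> T'" using 0(3)[OF alg_scale[OF alg_pow[OF alg_F]] \<open>u \<in> T'\<close>] by simp
      then show ?case using 0(2) step by blast
    qed (rule 0)
  qed
  then show ?thesis unfolding minimal_def using st uT u(1) by blast
qed

section \<open>Criteria for semisimplicity\<close>

text \<open>A submodule containing all simple ones contains the simple modules generated by highest
  weight vectors, hence each component e e0 (\<open>good_generation\<close>), hence e0 itself
  (\<open>generated_by_blocks\<close>), and so everything.\<close>

lemma semisimple_blk:
  assumes c: "central_idempotent A e0"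
    and good: "\<And>i e. 0 \<le> i \<Longrightarrow> i < int l \<Longrightarrow> is_e (cc i) e \<Longrightarrow> e * \<Phi> e0 \<noteq> 0 \<Longrightarrow>
      \<exists>j. 0 \<le> j \<and> j < int l \<and> is_e (cc j) e \<and> (j = int l - 1 \<or> e * proj (int l - 2 - j) = 0)"
  shows "semisimple_ring (blk e0)"
proof -
  interpret left_module "blk e0" "regular_module (blk e0)" by (rule regular_module_left_module[OF blk_ring[OF c]])
  note C = blk_carrier[OF c]
  have g: "e0 \<in> S" "\<Phi> e0 * \<Phi> e0 = \<Phi> e0" "\<Phi> e0 \<in> Zc" using c by (auto simp: central_idempotent_iff)
  have "N = carrier (regular_module (blk e0))"
    if N: "submodule N (blk e0) (regular_module (blk e0))"
      and simples: "\<And>T. submodule T (blk e0) (regular_module (blk e0)) \<and>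
        simple_module (blk e0) ((regular_module (blk e0))\<lparr>carrier := T\<rparr>) \<Longrightarrow> T \<subseteq> N" for N
  proof -
    have NC: "N \<subseteq> carrier (blk e0)" and st: "stable (\<Phi> ` N)" using N submodule_blk_iff[OF c] by auto
    have N3: "0 \<in> \<Phi> ` N" "\<And>y z. y \<in> \<Phi> ` N \<Longrightarrow> z \<in> \<Phi> ` N \<Longrightarrow> y + z \<in> \<Phi> ` N"
      "\<And>a y. a \<in> alg \<Longrightarrow> y \<in> \<Phi> ` N \<Longrightarrow> a * y \<in> \<Phi> ` N" using st by (auto simp: stable_def)
    have "\<Phi> e0 \<in> \<Phi> ` N"
    proof (rule generated_by_blocks[OF g(3) N3])
      fix i e assume i: "0 \<le> i" "i < int l" "is_e (cc i) e"
      show "e * \<Phi> e0 \<in> \<Phi> ` N"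
      proof (cases "e * \<Phi> e0 = 0")
        case True
        then show ?thesis using N3 by simp
      next
        case False
        obtain j where j: "0 \<le> j" "j < int l" "is_e (cc j) e" "j = int l - 1 \<or> e * proj (int l - 2 - j) = 0"
          using good[OF i False] by blast
        show ?thesis
        proof (rule good_generation[OF j(3,1,2,4) _ N3])
          show "e * (e * \<Phi> e0) = e * \<Phi> e0" using is_e_idem[OF i(3)] by (simp flip: mult.assoc)
          fix u assume u: "u \<noteq> 0" "wt j u" "opE q r * u = 0" "opF q r ^ Suc (nat j) * u = 0" "\<exists>a\<in>alg. u = a * (e * \<Phi> e0)"
          let ?T = "endo.span ((\<lambda>k. opF q r ^ k * u) ` {..<Suc (nat j)})"
          have m: "minimal ?T" by (rule Fspan_is_minimal[OF u(1-4) j(1,2)])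
          obtain a where a: "a \<in> alg" "u = a * (e * \<Phi> e0)" using u(5) by blast
          have ualg: "u \<in> alg" using a g is_e_Zc[OF i(3)] Zc_alg alg_mult by metis
          have ug: "u * \<Phi> e0 = u" using a g by (simp add: mult.assoc)
          have "?T \<subseteq> {y \<in> alg. y * \<Phi> e0 = y}"
          proof
            fix y assume "y \<in> ?T"
            then show "y \<in> {y \<in> alg. y * \<Phi> e0 = y}"
            proof (induction rule: endo.span_induct_alt)
              case (step c x y)
              then obtain k where "x = opF q r ^ k * u" by auto
              then have "x \<in> alg" "x * \<Phi> e0 = x" using ualg ug by (auto simp: mult.assoc intro: alg_mult alg_pow alg_F)
              then show ?case using step by (auto simp: distrib_right scale_mult_left intro: alg_add alg_scale)
            qed simp
          qed
          from simples[OF minimal_simple[OF c m this]]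
          have "{m \<in> S. \<Phi> m \<in> ?T} \<subseteq> N" .
          moreover have "u \<in> ?T" by (rule endo.span_base) force
          ultimately show "u \<in> \<Phi> ` N" using \<Phi>_surj[OF ualg] by blast
        qed
      qed
    qed
    then obtain n where n: "n \<in> N" "\<Phi> n = \<Phi> e0" by auto
    moreover have "n \<in> S" using n(1) NC C by auto
    ultimately have "e0 \<in> N" using \<Phi>_inj g(1) by metis
    have "x \<in> N" if x: "x \<in> carrier (blk e0)" for x
    proof -
      have "x * e0 \<in> N" using N x \<open>e0 \<in> N\<close> unfolding submodule_iff regular_simps by blast
      moreover have "x \<in> S" "\<Phi> (x * e0) = \<Phi> x" using x g by (simp_all add: C \<Phi>_hom)
      then have "x * e0 = x" using g(1) \<Phi>_inj[OF S_closed(4)] by blast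
      ultimately show ?thesis by simp
    qed
    then show ?thesis using NC unfolding regular_simps by blast
  qed
  then show ?thesis unfolding semisimple_ring_def semisimple_module_def
    using blk_ring[OF c] left_module_axioms by blast
qed

text \<open>The kernel N of C - c on the block is proper because C - c is not 0 on e. It contains
  every simple submodule: C - c is nilpotent and commutes with the algebra, so its kernel in a
  simple module is a nonzero submodule.\<close>

lemma not_semisimple_blk:
  assumes c: "central_idempotent A e0" and e: "is_e c e" and z: "zz c * e \<noteq> 0" and e0: "\<Phi> e0 = e"
  shows "\<not> semisimple_ring (blk e0)"
proof
  assume ss: "semisimple_ring (blk e0)"
  interpret left_module "blk e0" "regular_module (blk e0)" by (rule regular_module_left_module[OF blk_ring[OF c]])
  note C = blk_carrier[OF c]
  define N where "N = {x \<in> carrier (blk e0). zz c * \<Phi> x = 0}"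
  have g: "e0 \<in> S" using c by (auto simp: central_idempotent_iff)
  have sub: "submodule {x \<in> T. zz c * \<Phi> x = 0} (blk e0) (regular_module (blk e0))"
    if T: "submodule T (blk e0) (regular_module (blk e0))" for T
  proof -
    have TS: "x \<in> S" if "x \<in> T" for x using T that unfolding submodule_iff regular_simps C by auto
    show ?thesis using T TS unfolding submodule_iff regular_simps
      by (auto simp: C \<Phi>_hom distrib_left Zc_left[OF Zc_zz \<Phi>_alg])
  qed
  have full: "submodule (carrier (blk e0)) (blk e0) (regular_module (blk e0))"
    unfolding submodule_iff regular_simps C by (auto simp: S_closed \<Phi>_hom distrib_right mult.assoc)
  have Nsub: "submodule N (blk e0) (regular_module (blk e0))" unfolding N_def by (rule sub[OF full])
  have "T \<subseteq> N" if T: "submodule T (blk e0) (regular_module (blk e0))"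
      "simple_module (blk e0) ((regular_module (blk e0))\<lparr>carrier := T\<rparr>)" for T
  proof -
    let ?T = "{x \<in> T. zz c * \<Phi> x = 0}"
    have TC: "T \<subseteq> carrier (blk e0)" and T0: "0\<^sub>m (2 ^ r) (2 ^ r) \<in> T"
      using T(1) unfolding submodule_iff regular_simps by auto
    have stT: "stable (\<Phi> ` T)" using T(1) submodule_blk_iff[OF c] by blast
    have "?T = {0\<^sub>m (2 ^ r) (2 ^ r)} \<or> ?T = T"
      using T(2) sub[OF T(1)] unfolding simple_submodule_iff[OF T(1)] regular_simps by blast
    moreover have "?T \<noteq> {0\<^sub>m (2 ^ r) (2 ^ r)}"
    proof
      assume eq: "?T = {0\<^sub>m (2 ^ r) (2 ^ r)}"
      have inj: "y = 0" if y: "y \<in> \<Phi> ` T" "zz c * y = 0" for y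
      proof -
        obtain x where x: "x \<in> T" "y = \<Phi> x" using y(1) by blast
        then have "x \<in> ?T" using y(2) by simp
        then have "x = 0\<^sub>m (2 ^ r) (2 ^ r)" unfolding eq by simp
        then show "y = 0" using x(2) by (simp add: \<Phi>_hom)
      qed
      have "T \<noteq> {0\<^sub>m (2 ^ r) (2 ^ r)}" using T(2) unfolding simple_submodule_iff[OF T(1)] regular_simps by blast
      then obtain x where x: "x \<in> T" "x \<noteq> 0\<^sub>m (2 ^ r) (2 ^ r)" using T0 by blast
      then have xn: "\<Phi> x \<noteq> 0" using TC \<Phi>_inj[OF _ S_closed(1)] by (auto simp: C \<Phi>_hom)
      \<comment> \<open>Were C - c injective on T, none of its powers would kill x, against
        nilpotency on the block.\<close>
      have pw: "zz c ^ n * \<Phi> x \<in> \<Phi> ` T \<and> zz c ^ n * \<Phi> x \<noteq> 0" for n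
      proof (induction n)
        case 0
        then show ?case using x xn by simp
      next
        case (Suc n)
        then have "zz c * (zz c ^ n * \<Phi> x) \<in> \<Phi> ` T" using stT alg_zz unfolding stable_def by blast
        then show ?case using Suc inj[of "zz c ^ n * \<Phi> x"] by (auto simp: mult.assoc)
      qed
      obtain n where n: "zz c ^ n * e = 0" using e by (auto simp: is_e_def)
      have "x \<in> carrier (blk e0)" using x TC by blast
      then have "x \<in> S" "\<Phi> x * e = \<Phi> x" by (simp_all only: C e0 mem_Collect_eq)
      then have "e * \<Phi> x = \<Phi> x" using Zc_comm[OF is_e_Zc[OF e] \<Phi>_alg, of x] by simp
      then have "zz c ^ n * \<Phi> x = zz c ^ n * e * \<Phi> x" by (simp only: mult.assoc)
      then show False using pw[of n] n by simp
    qed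
    ultimately show ?thesis using TC unfolding N_def by blast
  qed
  then have "N = carrier (regular_module (blk e0))"
    using ss Nsub unfolding semisimple_ring_def semisimple_module_def by blast
  moreover have "e0 \<in> carrier (blk e0)" using g is_e_idem[OF e] by (simp add: C e0)
  ultimately show False using z e0 unfolding N_def regular_simps by auto
qed

end

section \<open>Simple modules and the classification\<close>

context schur_rep begin

section \<open>Simple modules of given highest weight\<close>

text \<open>\<open>K\<^sub>1 K\<^sub>2\<close> is \<open>q\<^sup>r\<close> and 2 has the inverse h
  modulo l, so the weight i for K determines the eigenvalues of both factors.\<close>

lemma opK1_wt:
  assumes X: "wt i X" and w: "int l dvd w1 + w2 - int r" "int l dvd w1 - w2 - i"
  shows "opK1 q r * X = scale_endo (q powi w1) X" and "opK2 q r * X = scale_endo (q powi w2) X"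
proof -
  have pow: "x ^ n * X = scale_endo (c ^ n) X" if "x * X = scale_endo c X" for x :: "'k endo" and c n
    by (induction n) (simp_all add: mult.assoc that scale_mult_right mult.commute)
  define h where "h = (l + 1) div 2"
  have h: "2 * int h = int l + 1" using odd_l unfolding h_def by presburger
  have "scale_endo (q ^ r) (opK q r) * X = scale_endo (q powi (int r + i)) X"
    using X by (simp add: wt_def scale_mult_left power_int_add)
  then have "opK1 q r * X = scale_endo ((q powi (int r + i)) ^ h) X"
    unfolding opK1_eq[OF root l3 odd_l] h_def[symmetric] by (rule pow)
  also have "(q powi (int r + i)) ^ h = q powi ((int r + i) * int h)" by (simp add: power_int_mult)
  also have "\<dots> = q powi w1"
    unfolding powi_eq_iff
  proof -
    have "int l dvd (w1 + w2 - int r) + (w1 - w2 - i)" using w by (rule dvd_add)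
    also have "(w1 + w2 - int r) + (w1 - w2 - i) = - (int r + i - 2 * w1)" by simp
    finally have "int l dvd int r + i - 2 * w1" by (simp only: dvd_minus_iff)
    then have "int l dvd (int r + i - 2 * w1) * int h + int l * w1"
      by (intro dvd_add dvd_mult2 dvd_triv_left)
    also have "(int r + i - 2 * w1) * int h + int l * w1 = (int r + i) * int h - w1 * (2 * int h) + int l * w1"
      by (simp add: algebra_simps)
    also have "\<dots> = (int r + i) * int h - w1" unfolding h by (simp add: algebra_simps)
    finally show "int l dvd (int r + i) * int h - w1" .
  qed
  finally show K1: "opK1 q r * X = scale_endo (q powi w1) X" .
  have "opK2 q r * X = scale_endo (q ^ r) (opK1 q r ^ (l - 1) * X)"
    unfolding opK2_eq[OF root l3 odd_l] by (simp add: scale_mult_left)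
  also have "\<dots> = scale_endo (q ^ r * (q powi w1) ^ (l - 1)) X" by (simp add: pow[OF K1])
  also have "q ^ r * (q powi w1) ^ (l - 1) = q powi (int r + w1 * int (l - 1))"
    by (simp add: power_int_mult power_int_add)
  also have "\<dots> = q powi w2"
    unfolding powi_eq_iff
  proof -
    have "int r + w1 * int (l - 1) - w2 = int l * w1 - (w1 + w2 - int r)"
      using l3 by (simp add: of_nat_diff algebra_simps)
    then show "int l dvd int r + w1 * int (l - 1) - w2"
      using dvd_diff[OF dvd_triv_left[of "int l" w1] w(1)] by (simp only:)
  qed
  finally show "opK2 q r * X = scale_endo (q powi w2) X" .
qed

lemma stable_uminus: "stable T \<Longrightarrow> x \<in> T \<Longrightarrow> - x \<in> T"
  unfolding stable_def using alg_uminus[OF alg_1] by (metis mult_minus_left mult_1_left)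

text \<open>A simple module of operators, transported to sets of matrices: the operator \<open>y = a u\<close>
  becomes the coset of the annihilator of \<open>u\<close> that contains \<open>a\<close>.\<close>

lemma ex_L1:
  assumes u: "u \<noteq> 0" "wt i u" "opE q r * u = 0" "opF q r ^ Suc (nat i) * u = 0" and i: "0 \<le> i" "i < int l"
    and w: "int l dvd fst w + snd w - int r" "int l dvd fst w - snd w - i"
  shows "\<exists>M :: ('k mat, 'k mat set) module. is_L1 q r \<zeta> w M"
proof -
  define T where "T = endo.span ((\<lambda>k. opF q r ^ k * u) ` {..<Suc (nat i)})"
  have min: "minimal T" unfolding T_def by (rule Fspan_is_minimal[OF u i])
  have uT: "u \<in> T" unfolding T_def by (rule endo.span_base) force
  have st: "stable T" using min by (simp add: minimal_def)
  then have T0: "0 \<in> T" and Tadd: "\<And>x y. x \<in> T \<Longrightarrow> y \<in> T \<Longrightarrow> x + y \<in> T"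
    and Tmul: "\<And>a x. a \<in> alg \<Longrightarrow> x \<in> T \<Longrightarrow> a * x \<in> T" by (auto simp: stable_def)
  \<comment> \<open>Minimality gives T = alg u. So the set of matrices attached to each element of T
    is nonempty, which makes that assignment injective.\<close>
  have gen: "\<exists>a\<in>alg. x = a * u" if xT: "x \<in> T" for x
  proof -
    have "stable ((\<lambda>a. a * u) ` alg)" unfolding stable_def
    proof (intro conjI ballI)
      show "0 \<in> (\<lambda>a. a * u) ` alg" by (rule image_eqI[of _ _ 0]) auto
      show "x + y \<in> (\<lambda>a. a * u) ` alg" if "x \<in> (\<lambda>a. a * u) ` alg" "y \<in> (\<lambda>a. a * u) ` alg" for x y
        using that by (auto simp: distrib_right[symmetric] intro!: imageI alg_add)
      show "a * x \<in> (\<lambda>a. a * u) ` alg" if "a \<in> alg" "x \<in> (\<lambda>a. a * u) ` alg" for a x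
        using that by (auto simp: mult.assoc[symmetric] intro!: imageI alg_mult)
    qed
    moreover have "u \<in> (\<lambda>a. a * u) ` alg" by (rule image_eqI[of _ _ 1]) auto
    ultimately have "T \<subseteq> (\<lambda>a. a * u) ` alg" using min uT u(1) unfolding minimal_def by blast
    then show ?thesis using xT by auto
  qed
  define \<psi> where "\<psi> y = {m \<in> S. \<Phi> m * u = y}" for y
  have inj: "inj_on \<psi> T"
  proof (rule inj_onI)
    fix x y assume xy: "x \<in> T" "y \<in> T" "\<psi> x = \<psi> y"
    obtain a m where "a \<in> alg" "x = a * u" "m \<in> S" "\<Phi> m = a" using gen[OF xy(1)] \<Phi>_surj by metis
    then have "m \<in> \<psi> x" by (simp add: \<psi>_def)
    then show "x = y" using xy(3) by (auto simp: \<psi>_def)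
  qed
  define \<phi> where "\<phi> = inv_into T \<psi>"
  have \<phi>: "\<phi> (\<psi> y) = y" if "y \<in> T" for y unfolding \<phi>_def using inj that by (rule inv_into_f_f)
  define M :: "('k mat, 'k mat set) module" where
    "M = \<lparr>carrier = \<psi> ` T, mult = (\<lambda>P Q. {}), one = {}, zero = \<psi> 0,
      add = (\<lambda>P Q. \<psi> (\<phi> P + \<phi> Q)), smult = (\<lambda>a P. \<psi> (\<Phi> a * \<phi> P))\<rparr>"
  have M: "carrier M = \<psi> ` T" "\<zero>\<^bsub>M\<^esub> = \<psi> 0"
    "\<And>x y. x \<in> T \<Longrightarrow> y \<in> T \<Longrightarrow> \<psi> x \<oplus>\<^bsub>M\<^esub> \<psi> y = \<psi> (x + y)"
    "\<And>a x. x \<in> T \<Longrightarrow> a \<odot>\<^bsub>M\<^esub> \<psi> x = \<psi> (\<Phi> a * x)"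
    by (simp_all add: M_def \<phi>)
  have "abelian_group M"
  proof (rule abelian_groupI)
    fix x assume "x \<in> carrier M"
    then obtain y where "y \<in> T" "x = \<psi> y" unfolding M by blast
    then show "\<exists>y\<in>carrier M. y \<oplus>\<^bsub>M\<^esub> x = \<zero>\<^bsub>M\<^esub>"
      using stable_uminus[OF st] by (intro bexI[of _ "\<psi> (- y)"]) (auto simp: M)
  qed (auto simp: M T0 Tadd add_ac)
  then have LM: "left_module A M"
    by (intro left_module.intro left_module_axioms.intro A_ring)
       (auto simp: M A_simps Tadd Tmul \<Phi>_alg \<Phi>_hom distrib_left distrib_right mult.assoc)
  interpret left_module A M by (rule LM)
  have simple: "N = {\<psi> 0} \<or> N = carrier M" if N: "submodule N A M" for N
  proof (cases "N \<subseteq> {\<psi> 0}")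
    case True
    then show ?thesis using N unfolding submodule_iff M by auto
  next
    case False
    define T' where "T' = {y \<in> T. \<psi> y \<in> N}"
    have NM: "N \<subseteq> \<psi> ` T" using N unfolding submodule_iff M by blast
    then obtain t where t: "t \<in> T" "\<psi> t \<in> N" "t \<noteq> 0" using False by auto
    have "stable T'" unfolding stable_def T'_def
    proof (intro conjI ballI)
      show "0 \<in> {y \<in> T. \<psi> y \<in> N}" using N T0 unfolding submodule_iff M by simp
      show "x + y \<in> {y \<in> T. \<psi> y \<in> N}" if "x \<in> {y \<in> T. \<psi> y \<in> N}" "y \<in> {y \<in> T. \<psi> y \<in> N}" for x y
      proof -
        have "\<psi> x \<oplus>\<^bsub>M\<^esub> \<psi> y \<in> N" using N that unfolding submodule_iff by blast
        then show ?thesis using that by (simp add: M Tadd)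
      qed
      show "a * x \<in> {y \<in> T. \<psi> y \<in> N}" if "a \<in> alg" "x \<in> {y \<in> T. \<psi> y \<in> N}" for a x
      proof -
        from \<Phi>_surj[OF that(1)] obtain m where m: "m \<in> S" "\<Phi> m = a" by blast
        then have "m \<odot>\<^bsub>M\<^esub> \<psi> x \<in> N" using N that(2) unfolding submodule_iff A_simps by blast
        then show ?thesis using that m by (simp add: M Tmul)
      qed
    qed
    then have "T \<subseteq> T'" using min t unfolding minimal_def T'_def by blast
    then have "N = \<psi> ` T" using NM by (auto simp: T'_def)
    then show ?thesis by (simp add: M)
  qed
  have nz: "\<psi> u \<noteq> \<psi> 0" using inj_onD[OF inj _ uT T0] u(1) by blast
  have "simple_module A M"
    unfolding simple_module_def using LM simple nz uT by (auto simp: M)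
  moreover have "\<exists>v \<in> carrier M. v \<noteq> \<zero>\<^bsub>M\<^esub> \<and>
        (\<forall>N. submodule N A M \<and> v \<in> N \<longrightarrow> N = carrier M) \<and>
        \<zeta> (Uk_gen q GE) \<odot>\<^bsub>M\<^esub> v = \<zero>\<^bsub>M\<^esub> \<and>
        \<zeta> (Uk_gen q GK1) \<odot>\<^bsub>M\<^esub> v = ((q powi fst w) \<cdot>\<^sub>m 1\<^sub>m (2 ^ r)) \<odot>\<^bsub>M\<^esub> v \<and>
        \<zeta> (Uk_gen q GK2) \<odot>\<^bsub>M\<^esub> v = ((q powi snd w) \<cdot>\<^sub>m 1\<^sub>m (2 ^ r)) \<odot>\<^bsub>M\<^esub> v"
  proof (intro bexI conjI allI impI)
    show "\<psi> u \<in> carrier M" using uT by (simp add: M)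
    show "\<psi> u \<noteq> \<zero>\<^bsub>M\<^esub>" using nz by (simp add: M)
    show "N = carrier M" if "submodule N A M \<and> \<psi> u \<in> N" for N using simple[of N] that nz by blast
    show "\<zeta> (Uk_gen q GE) \<odot>\<^bsub>M\<^esub> \<psi> u = \<zero>\<^bsub>M\<^esub>" using u(3) by (simp add: M uT \<Phi>_hom)
    show "\<zeta> (Uk_gen q GK1) \<odot>\<^bsub>M\<^esub> \<psi> u = ((q powi fst w) \<cdot>\<^sub>m 1\<^sub>m (2 ^ r)) \<odot>\<^bsub>M\<^esub> \<psi> u"
      "\<zeta> (Uk_gen q GK2) \<odot>\<^bsub>M\<^esub> \<psi> u = ((q powi snd w) \<cdot>\<^sub>m 1\<^sub>m (2 ^ r)) \<odot>\<^bsub>M\<^esub> \<psi> u"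
      using opK1_wt[OF u(2) w] by (simp_all add: M uT \<Phi>_hom scale_mult_left)
  qed
  ultimately show ?thesis unfolding is_L1_def by blast
qed

text \<open>1 - e is a multiple of C - cc i, and C - cc i lies in the left ideal generated by the
  operators that kill a highest weight vector of weight (w1, w2). This makes e fix such a vector in
  an arbitrary module over the algebra.\<close>

lemma one_minus_e:
  assumes e: "is_e (cc i) e" and w: "int l dvd w1 - w2 - i"
  obtains a b d where "a \<in> alg" "b \<in> alg" "d \<in> alg"
    "1 = e + a * opE q r + b * (opK1 q r + scale_endo (- (q powi w1)) 1) + d * (opK2 q r + scale_endo (- (q powi w2)) 1)"
proof -
  let ?K = "opK q r" and ?L = "opL q r" and ?\<kappa> = "1 / (q - 1 / q)\<^sup>2"
  obtain z where z: "z \<in> Zc" "1 - e = z * zz (cc i)" using e by (auto simp: is_e_def)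
  \<comment> \<open>The torus part of C - cc i is a Laurent polynomial in K vanishing at
    \<open>q powi i\<close>; t is its cofactor of K - q powi i.\<close>
  define t where "t = scale_endo ?\<kappa> (scale_endo q 1 - scale_endo (q powi (- i - 1)) ?L)"
  have t: "t \<in> alg" unfolding t_def by (intro alg_scale alg_diff alg_1 alg_L)
  have qi: "q powi i = q powi (w1 - w2)" using powi_eq_iff[of "w1 - w2" i] w by simp
  have 1: "q powi (- i - 1) * q powi i = 1 / q"
    by (simp add: power_int_add[symmetric] power_int_minus inverse_eq_divide)
  have 2: "q * q powi i = q powi (i + 1)" by (simp add: power_int_add)
  have zz: "zz (cc i) = opF q r * opE q r + t * (?K - scale_endo (q powi i) 1)"
  proof -
    have "(scale_endo q 1 - scale_endo c ?L) * (?K - scale_endo d 1)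
        = scale_endo q ?K - scale_endo (q * d) 1 - scale_endo c 1 + scale_endo (c * d) ?L" for c d
      by (simp add: left_diff_distrib right_diff_distrib scale_mult_left scale_mult_right LK endo.scale_right_diff_distrib mult.commute)
    then have "t * (?K - scale_endo (q powi i) 1)
        = scale_endo ?\<kappa> (scale_endo q ?K - scale_endo (q powi (i + 1)) 1 - scale_endo (q powi (- i - 1)) 1 + scale_endo (1 / q) ?L)"
      unfolding t_def scale_mult_left by (simp only: 1 2)
    moreover have "scale_endo (cc i) 1 = scale_endo ?\<kappa> (scale_endo (q powi (i + 1)) 1 + scale_endo (q powi (- i - 1)) 1)"
      by (simp add: cc_def endo.scale_left_distrib[symmetric] endo.scale_right_distrib[symmetric]
          add_divide_distrib)
    ultimately show ?thesis
      unfolding zz_def C_def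
      by (simp add: endo.scale_right_distrib endo.scale_right_diff_distrib del: endo.scale_scale)
  qed
  have KL12: "?K - scale_endo (q powi i) 1 = opL2 q r * (opK1 q r + scale_endo (- (q powi w1)) 1)
      + scale_endo (- (q powi (w1 - w2))) (opL2 q r) * (opK2 q r + scale_endo (- (q powi w2)) 1)"
  proof -
    have "opL2 q r * opK1 q r = ?K" by (simp add: opK_eq opK_comm[OF root l3 odd_l])
    moreover have "opL2 q r * opK2 q r = 1" by (rule opK_L_inverse[OF root l3 odd_l])
    moreover have "q powi w2 * q powi (w1 - w2) = q powi w1"
      by (simp add: power_int_add[symmetric])
    ultimately show ?thesis unfolding qi
      by (simp add: right_diff_distrib endo.scale_right_diff_distrib scale_mult_left scale_mult_right)
  qed
  have L2: "opL2 q r \<in> alg" using op_gen_in_alg[OF root l3 odd_l, of r GK2inv] by simp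
  show ?thesis
  proof (rule that)
    show "z * opF q r \<in> alg" by (intro alg_mult Zc_alg z alg_F)
    show "z * (t * opL2 q r) \<in> alg" by (intro alg_mult Zc_alg z t L2)
    show "z * (t * scale_endo (- (q powi (w1 - w2))) (opL2 q r)) \<in> alg"
      by (intro alg_mult Zc_alg z t L2 alg_scale)
    have "1 = e + z * zz (cc i)" using z(2) by (simp add: algebra_simps)
    then show "1 = e + z * opF q r * opE q r + z * (t * opL2 q r) * (opK1 q r + scale_endo (- (q powi w1)) 1)
       + z * (t * scale_endo (- (q powi (w1 - w2))) (opL2 q r)) * (opK2 q r + scale_endo (- (q powi w2)) 1)"
      unfolding zz KL12 by (simp only: distrib_left mult.assoc add.assoc)
  qed
qed

section \<open>The block of a simple module\<close>

text \<open>m fixes the highest weight vector v, and the vectors fixed by a central element form a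
  submodule, so m fixes M. If another block idempotent n did so too, n m v = v would be nonzero, and
  primitive central idempotents with nonzero product coincide.\<close>

lemma L1_block:
  assumes M: "is_L1 q r \<zeta> w M" and e: "is_e (cc i) (\<Phi> m)" "pci (\<Phi> m)" "m \<in> S"
    and w: "int l dvd fst w - snd w - i"
  shows "block_containing A M = blk m"
proof -
  have simple: "simple_module A M" using M by (simp add: is_L1_def)
  then interpret left_module A M by (simp add: simple_module_def)
  obtain v where v: "v \<in> carrier M" "v \<noteq> \<zero>\<^bsub>M\<^esub>" "\<And>N. submodule N A M \<Longrightarrow> v \<in> N \<Longrightarrow> N = carrier M"
    "\<zeta> (Uk_gen q GE) \<odot>\<^bsub>M\<^esub> v = \<zero>\<^bsub>M\<^esub>"
    "\<zeta> (Uk_gen q GK1) \<odot>\<^bsub>M\<^esub> v = ((q powi fst w) \<cdot>\<^sub>m 1\<^sub>m (2 ^ r)) \<odot>\<^bsub>M\<^esub> v"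
    "\<zeta> (Uk_gen q GK2) \<odot>\<^bsub>M\<^esub> v = ((q powi snd w) \<cdot>\<^sub>m 1\<^sub>m (2 ^ r)) \<odot>\<^bsub>M\<^esub> v"
    using M unfolding is_L1_def by blast
  have act_add: "(x + y) \<odot>\<^bsub>M\<^esub> x' = x \<odot>\<^bsub>M\<^esub> x' \<oplus>\<^bsub>M\<^esub> y \<odot>\<^bsub>M\<^esub> x'"
    and act_mult: "(x * y) \<odot>\<^bsub>M\<^esub> x' = x \<odot>\<^bsub>M\<^esub> (y \<odot>\<^bsub>M\<^esub> x')" if "x \<in> S" "y \<in> S" "x' \<in> carrier M" for x y x'
    using smult_l_distr[of x y x'] smult_assoc[of x y x'] that by (simp_all add: A_simps)
  have act_0: "0\<^sub>m (2 ^ r) (2 ^ r) \<odot>\<^bsub>M\<^esub> x = \<zero>\<^bsub>M\<^esub>" if "x \<in> carrier M" for x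
    using zero_smult[OF that] by (simp add: A_simps)
  have eqI: "x = y" if "x \<in> S" "y \<in> S" "\<Phi> x = \<Phi> y" for x y using that \<Phi>_inj by blast
  have kill: "(\<zeta> (Uk_gen q g) + (- (q powi j)) \<cdot>\<^sub>m 1\<^sub>m (2 ^ r)) \<odot>\<^bsub>M\<^esub> v = \<zero>\<^bsub>M\<^esub>"
    if g: "\<zeta> (Uk_gen q g) \<odot>\<^bsub>M\<^esub> v = ((q powi j) \<cdot>\<^sub>m 1\<^sub>m (2 ^ r)) \<odot>\<^bsub>M\<^esub> v" for g j
  proof -
    have "(\<zeta> (Uk_gen q g) + (- (q powi j)) \<cdot>\<^sub>m 1\<^sub>m (2 ^ r)) \<odot>\<^bsub>M\<^esub> v
        = ((q powi j) \<cdot>\<^sub>m 1\<^sub>m (2 ^ r) + (- (q powi j)) \<cdot>\<^sub>m 1\<^sub>m (2 ^ r)) \<odot>\<^bsub>M\<^esub> v"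
      by (simp add: act_add S_gen S_scalar v(1) g)
    also have "(q powi j) \<cdot>\<^sub>m 1\<^sub>m (2 ^ r) + (- (q powi j)) \<cdot>\<^sub>m 1\<^sub>m (2 ^ r) = 0\<^sub>m (2 ^ r) (2 ^ r)"
      by (rule eqI) (simp_all add: S_closed S_scalar \<Phi>_hom)
    finally show ?thesis by (simp add: act_0 v(1))
  qed
  obtain a b d where abd: "a \<in> alg" "b \<in> alg" "d \<in> alg"
    "1 = \<Phi> m + a * opE q r + b * (opK1 q r + scale_endo (- (q powi fst w)) 1) + d * (opK2 q r + scale_endo (- (q powi snd w)) 1)"
    using one_minus_e[OF e(1) w] by blast
  obtain x y z where xyz: "x \<in> S" "\<Phi> x = a" "y \<in> S" "\<Phi> y = b" "z \<in> S" "\<Phi> z = d"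
    using \<Phi>_surj abd(1-3) by metis
  let ?k1 = "\<zeta> (Uk_gen q GK1) + (- (q powi fst w)) \<cdot>\<^sub>m 1\<^sub>m (2 ^ r)"
  let ?k2 = "\<zeta> (Uk_gen q GK2) + (- (q powi snd w)) \<cdot>\<^sub>m 1\<^sub>m (2 ^ r)"
  have kS: "?k1 \<in> S" "?k2 \<in> S" by (intro S_closed S_gen S_scalar)+
  have "1\<^sub>m (2 ^ r) = m + x * \<zeta> (Uk_gen q GE) + y * ?k1 + z * ?k2"
    by (rule eqI) (use abd(4) in \<open>simp_all add: S_closed S_gen S_scalar xyz e(3) \<Phi>_hom\<close>)
  then have "v = (m + x * \<zeta> (Uk_gen q GE) + y * ?k1 + z * ?k2) \<odot>\<^bsub>M\<^esub> v"
    using smult_one[OF v(1)] by (simp add: A_simps)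
  also have "\<dots> = m \<odot>\<^bsub>M\<^esub> v \<oplus>\<^bsub>M\<^esub> x \<odot>\<^bsub>M\<^esub> (\<zeta> (Uk_gen q GE) \<odot>\<^bsub>M\<^esub> v) \<oplus>\<^bsub>M\<^esub> y \<odot>\<^bsub>M\<^esub> (?k1 \<odot>\<^bsub>M\<^esub> v) \<oplus>\<^bsub>M\<^esub> z \<odot>\<^bsub>M\<^esub> (?k2 \<odot>\<^bsub>M\<^esub> v)"
    using kS by (simp only: act_add act_mult S_closed S_gen xyz e(3) v(1))
  also have "\<dots> = m \<odot>\<^bsub>M\<^esub> v"
    unfolding kill[OF v(5)] kill[OF v(6)] v(4)
    using smult_zero[of x] smult_zero[of y] smult_zero[of z] smult_closed[of m v] xyz e(3) v(1)
    by (simp add: A_simps)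
  finally have mv: "m \<odot>\<^bsub>M\<^esub> v = v" by simp
  have c: "central_idempotent A m" using e unfolding pci_def central_idempotent_iff by blast
  have "submodule {x \<in> carrier M. m \<odot>\<^bsub>M\<^esub> x = x} A M"
    unfolding submodule_iff
  proof (intro conjI ballI)
    show "\<zero>\<^bsub>M\<^esub> \<in> {x \<in> carrier M. m \<odot>\<^bsub>M\<^esub> x = x}" using smult_zero[of m] e(3) by (simp add: A_simps)
    show "x \<oplus>\<^bsub>M\<^esub> y \<in> {x \<in> carrier M. m \<odot>\<^bsub>M\<^esub> x = x}"
      if "x \<in> {x \<in> carrier M. m \<odot>\<^bsub>M\<^esub> x = x}" "y \<in> {x \<in> carrier M. m \<odot>\<^bsub>M\<^esub> x = x}" for x y
      using that smult_r_distr[of m x y] e(3) by (simp add: A_simps)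
    show "a \<odot>\<^bsub>M\<^esub> x \<in> {x \<in> carrier M. m \<odot>\<^bsub>M\<^esub> x = x}"
      if "a \<in> carrier A" "x \<in> {x \<in> carrier M. m \<odot>\<^bsub>M\<^esub> x = x}" for a x
    proof -
      have aS: "a \<in> S" using that(1) by (simp add: A_simps)
      have "m \<odot>\<^bsub>M\<^esub> (a \<odot>\<^bsub>M\<^esub> x) = (m * a) \<odot>\<^bsub>M\<^esub> x" using act_mult[OF e(3) aS] that by simp
      also have "m * a = a * m" using c that(1) by (simp add: central_idempotent_def A_simps)
      also have "(a * m) \<odot>\<^bsub>M\<^esub> x = a \<odot>\<^bsub>M\<^esub> x" using act_mult[OF aS e(3)] that by simp
      finally show ?thesis using that smult_closed by simp
    qed
  qed auto
  then have fixed: "m \<odot>\<^bsub>M\<^esub> x = x" if "x \<in> carrier M" for x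
    using v(3)[of "{x \<in> carrier M. m \<odot>\<^bsub>M\<^esub> x = x}"] v(1) mv that by auto
  have prim: "primitive_central_idempotent A m" using e by (simp add: primitive_iff)
  show ?thesis unfolding block_containing_def
  proof (rule the_equality)
    show "blk m \<in> blocks A \<and> in_block (blk m) M"
      using prim fixed unfolding blocks_eq in_block_def blk_simps by blast
  next
    fix B assume B: "B \<in> blocks A \<and> in_block B M"
    then obtain n where n: "B = blk n" "primitive_central_idempotent A n" unfolding blocks_eq by blast
    then have nS: "n \<in> S" "pci (\<Phi> n)" by (auto simp: primitive_iff)
    have "n \<odot>\<^bsub>M\<^esub> v = v" using B v(1) unfolding in_block_def n(1) blk_simps by blast
    then have "(n * m) \<odot>\<^bsub>M\<^esub> v = v" using act_mult[OF nS(1) e(3) v(1)] mv by simp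
    then have "n * m \<noteq> 0\<^sub>m (2 ^ r) (2 ^ r)" using act_0[OF v(1)] v(2) by auto
    then have "\<Phi> n * \<Phi> m \<noteq> 0"
      using \<Phi>_inj[OF S_closed(4)[OF nS(1) e(3)] S_closed(1)] by (simp add: \<Phi>_hom nS e)
    then have "\<Phi> n = \<Phi> m" using pci_eq nS(2) e(2) by blast
    then show "B = blk m" using n nS e(3) \<Phi>_inj by blast
  qed
qed

lemma L1_block_of:
  assumes u: "u \<noteq> 0" "wt i u" "opE q r * u = 0" "opF q r ^ Suc (nat i) * u = 0" and i: "0 \<le> i" "i < int l"
    and w: "int l dvd fst w + snd w - int r" "int l dvd fst w - snd w - i"
    and e: "is_e (cc i) (\<Phi> m)" "pci (\<Phi> m)" "m \<in> S"
  shows "block_of q r \<zeta> w = blk m"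
proof -
  have "is_L1 q r \<zeta> w (L1 q r \<zeta> w)"
    unfolding L1_def by (rule someI_ex[OF ex_L1[OF u i w]])
  then show ?thesis unfolding block_of_def using L1_block e w(2) by blast
qed

section \<open>The kinds of blocks\<close>

text \<open>The index conditions of \<open>I_set\<close> and \<open>J_set\<close>. Here i \<le> r is
  left out; for a block that does not vanish \<open>occurs_small\<close> supplies it, and for
  \<open>large\<close> it follows from the bounds.\<close>

definition small :: "int \<Rightarrow> bool" where
  "small i \<longleftrightarrow> 0 \<le> i \<and> i \<le> int l - 2 \<and> even (int r - i) \<and> i < 2 * int l - int r - 2"

definition large :: "int \<Rightarrow> bool" where
  "large i \<longleftrightarrow> 0 \<le> i \<and> i \<le> int l - 2 \<and> even (int r - i) \<and> 2 * int l - int r - 2 \<le> i"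

text \<open>For k = l - 1 - i and s = l - 1 the condition in \<open>large\<close> says exactly that
  k + s = 2 l - 2 - i is at most r. The difference is even and leaves room for t invariant
  vectors.\<close>

lemma large_linking:
  assumes "large i" "is_e (cc i) e"
  shows "zz (cc i) * e \<noteq> 0" and "opE q r * (proj i * e) \<noteq> 0"
proof -
  have i: "0 \<le> i" "i \<le> int l - 2" "even (int r - i)" "2 * int l - int r - 2 \<le> i" using assms(1) by (auto simp: large_def)
  define k where "k = nat (int l - 1 - i)"
  have k: "int k = int l - 1 - i" "k < l" using i by (auto simp: k_def)
  define s where "s = nat (int k + i)"
  have s: "int s = int l - 1" using i k by (simp add: s_def)
  define t where "t = nat ((int r - (int k + int s)) div 2)"
  have "even (int r - (int k + int s))" using i(3) k s by presburger
  then have t: "2 * int t = int r - (int k + int s)" using i k s by (simp add: t_def)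
  then have r: "k + s + 2 * t = r" by linarith
  have ik: "int s - int k = i" using k s by simp
  obtain Y where "opK q r * Y = scale_endo (q powi i) Y" "opE q r ^ Suc k * Y = 0" "opF q r ^ k * (opE q r ^ k * Y) \<noteq> 0"
    using ex_linking_vector[OF root l3 odd_l k(2), of s t] unfolding r ik by blast
  then show "zz (cc i) * e \<noteq> 0" and "opE q r * (proj i * e) \<noteq> 0"
    using linking[OF assms(2) i(1,2) k(1), of Y] by (auto simp: wt_def)
qed

text \<open>As l is odd, i and l - 2 - i have opposite parities, so exactly one of them has the
  parity of r.\<close>

lemma right_parity:
  assumes "0 \<le> i" "i < int l" "is_e (cc i) e"
  obtains "i = int l - 1" | j where "small j" "is_e (cc j) e" | j where "large j" "is_e (cc j) e"
proof (cases "i = int l - 1")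
  case False
  define j where "j = (if even (int r - i) then i else int l - 2 - i)"
  have "even (int r - j)" using odd_l by (auto simp: j_def)
  moreover have "0 \<le> j" "j \<le> int l - 2" using assms False by (auto simp: j_def)
  moreover have "is_e (cc j) e" using assms(3) cc_eq_iff[of i j] by (auto simp: j_def)
  ultimately show ?thesis using that unfolding small_def large_def by (metis linorder_not_less)
qed (use that in blast)

lemma e_pci:
  assumes "0 \<le> i" "i < int l" "is_e (cc i) e" "e \<noteq> 0"
  shows "pci e"
  using assms(1-3)
proof (cases rule: right_parity)
  case 1
  then show ?thesis using is_e_pci assms by (auto simp: linked_def)
next
  case (2 j)
  then have "e * proj (int l - 2 - j) = 0" using good_small[of j e] by (auto simp: small_def)
  then show ?thesis using is_e_pci[of j e] 2 assms by (auto simp: linked_def small_def)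
next
  case (3 j)
  then show ?thesis using is_e_pci[of j e] large_linking[of j e] assms by (auto simp: linked_def large_def)
qed

lemma good_semisimple:
  assumes e: "is_e (cc j) (\<Phi> m)" "pci (\<Phi> m)" "m \<in> S" and j: "j = int l - 1 \<or> small j"
  shows "semisimple_ring (blk m)"
proof (rule semisimple_blk)
  show "central_idempotent A m" using e unfolding pci_def central_idempotent_iff by blast
  fix i f assume f: "0 \<le> i" "i < int l" "is_e (cc i) f" "f * \<Phi> m \<noteq> 0"
  then have "f \<noteq> 0" by auto
  then have "pci f" using e_pci f by blast
  then have "f = \<Phi> m" using pci_eq f(4) e(2) by blast
  moreover have "0 \<le> j" "j < int l" using j l3 by (auto simp: small_def)
  moreover have "j = int l - 1 \<or> \<Phi> m * proj (int l - 2 - j) = 0"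
    using j good_small[OF e(1)] by (auto simp: small_def)
  ultimately show "\<exists>j. 0 \<le> j \<and> j < int l \<and> is_e (cc j) f \<and> (j = int l - 1 \<or> f * proj (int l - 2 - j) = 0)"
    using e(1) by blast
qed

lemma semisimple_of_less: assumes "r < l" shows "semisimple_ring A"
proof -
  have "semisimple_ring (blk (1\<^sub>m (2 ^ r)))"
  proof (rule semisimple_blk)
    show "central_idempotent A (1\<^sub>m (2 ^ r))" by (simp add: central_idempotent_iff S_closed \<Phi>_hom)
    fix i e assume i: "0 \<le> i" "i < int l" "is_e (cc i) e"
    show "\<exists>j. 0 \<le> j \<and> j < int l \<and> is_e (cc j) e \<and> (j = int l - 1 \<or> e * proj (int l - 2 - j) = 0)"
      using i
    proof (cases rule: right_parity)
      case (2 j)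
      then have "e * proj (int l - 2 - j) = 0" using good_small[of j e] by (auto simp: small_def)
      then show ?thesis using 2 by (auto simp: small_def)
    next
      \<comment> \<open>A large index needs r \<ge> 2 l - 2 - j \<ge> l.\<close>
      case (3 j)
      then show ?thesis using assms by (simp add: large_def)
    qed (use i in blast)
  qed
  then show ?thesis by (simp add: blk_one)
qed

lemma primitive_vector:
  assumes n: "0 \<le> n" "n \<le> int r" "even (int r - n)"
  obtains u where "u \<noteq> 0" "wt n u" "opE q r * u = 0" "opF q r ^ Suc (nat n) * u = 0"
proof -
  define t where "t = nat ((int r - n) div 2)"
  have "2 * int t = int r - n" using n by (simp add: t_def)
  then have "nat n + 2 * t = r" using n(1) by linarith
  then show ?thesis
    using ex_primitive_vector[OF root l3 odd_l, of "nat n" t] n(1) that by (auto simp: wt_def)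
qed

lemma ex_block:
  assumes u: "u \<noteq> 0" "wt i u" "opE q r * u = 0" "opF q r ^ Suc (nat i) * u = 0" and i: "0 \<le> i" "i < int l"
  obtains m where "m \<in> S" "is_e (cc i) (\<Phi> m)" "pci (\<Phi> m)"
    "\<And>w. int l dvd fst w + snd w - int r \<Longrightarrow> int l dvd fst w - snd w - i \<Longrightarrow> block_of q r \<zeta> w = blk m"
proof -
  obtain e where e: "is_e (cc i) e" using ex_is_e by blast
  obtain m where m: "m \<in> S" "\<Phi> m = e" using \<Phi>_surj[OF Zc_alg[OF is_e_Zc[OF e]]] by blast
  have "zz (cc i) ^ 1 * u = 0" using FE_wt[OF u(2)] u(3) by simp
  then have "e * u = u" by (rule is_e_fix[OF e])
  then have "e \<noteq> 0" using u(1) by auto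
  then have "pci (\<Phi> m)" using e_pci i e m by blast
  then show ?thesis using that[of m] L1_block_of[OF u i] m e by blast
qed

lemma block_in_blocks: "m \<in> S \<Longrightarrow> pci (\<Phi> m) \<Longrightarrow> blk m \<in> blocks A"
  unfolding blocks_eq using primitive_iff by blast

lemma bar_congruences:
  "int l dvd fst (bar l w) + snd (bar l w) - int r \<longleftrightarrow> int l dvd fst w + snd w - int r"
  "int l dvd fst (bar l w) - snd (bar l w) - i \<longleftrightarrow> int l dvd fst w - snd w - i"
proof -
  have D: "int l dvd a - int l * b \<longleftrightarrow> int l dvd a" for a b
    using dvd_add_left_iff[of "int l" "int l * b" "a - int l * b"] by simp
  have "fst (bar l w) + snd (bar l w) - int r
      = (fst w + snd w - int r) - int l * (fst w div int l + snd w div int l)"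
    by (simp add: bar_def minus_mult_div_eq_mod[symmetric] algebra_simps)
  then show "int l dvd fst (bar l w) + snd (bar l w) - int r \<longleftrightarrow> int l dvd fst w + snd w - int r"
    by (simp only: D)
  have "fst (bar l w) - snd (bar l w) - i
      = (fst w - snd w - i) - int l * (fst w div int l - snd w div int l)"
    by (simp add: bar_def minus_mult_div_eq_mod[symmetric] algebra_simps)
  then show "int l dvd fst (bar l w) - snd (bar l w) - i \<longleftrightarrow> int l dvd fst w - snd w - i"
    by (simp only: D)
qed

lemma small_or_large_block:
  assumes "small i \<and> i \<le> int r \<or> large i"
  obtains m where "m \<in> S" "is_e (cc i) (\<Phi> m)" "pci (\<Phi> m)"
    "block_of q r \<zeta> (bar l ((int r + i) div 2, (int r - i) div 2)) = blk m"
proof -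
  have i: "0 \<le> i" "i \<le> int r" "even (int r - i)" "i < int l" using assms by (auto simp: small_def large_def)
  obtain u where u: "u \<noteq> 0" "wt i u" "opE q r * u = 0" "opF q r ^ Suc (nat i) * u = 0"
    using primitive_vector[OF i(1-3)] by blast
  obtain m where m: "m \<in> S" "is_e (cc i) (\<Phi> m)" "pci (\<Phi> m)"
    "\<And>w. int l dvd fst w + snd w - int r \<Longrightarrow> int l dvd fst w - snd w - i \<Longrightarrow> block_of q r \<zeta> w = blk m"
    using ex_block[OF u i(1,4)] by blast
  have "(int r + i) div 2 + (int r - i) div 2 = int r" "(int r + i) div 2 - (int r - i) div 2 = i"
    using i(3) by presburger+
  then show ?thesis using that[OF m(1-3)] m(4)[of "bar l ((int r + i) div 2, (int r - i) div 2)"]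
    unfolding bar_congruences by simp
qed

text \<open>A highest weight vector of integral weight n has weight l - 1 modulo l, and
  \<open>F ^ l = 0\<close> takes the place of the vanishing of \<open>F ^ Suc n\<close>.\<close>

lemma Steinberg_block:
  assumes n: "0 \<le> n" "n \<le> int r" "even (int r - n)" "int l dvd n + 1"
    and w: "fst w + snd w = int r" "int l dvd fst w - snd w + 1"
  obtains m where "m \<in> S" "is_e (cc (int l - 1)) (\<Phi> m)" "pci (\<Phi> m)" "block_of q r \<zeta> (bar l w) = blk m"
proof -
  obtain u where u: "u \<noteq> 0" "wt n u" "opE q r * u = 0"
    using primitive_vector[OF n(1-3)] by blast
  have "int l dvd n - (int l - 1)" using n(4) by (simp add: algebra_simps)
  then have wu: "wt (int l - 1) u" using wt_cong[OF u(2)] by blast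
  have "Suc (nat (int l - 1)) = l" using l3 by simp
  then have F: "opF q r ^ Suc (nat (int l - 1)) * u = 0" by (simp only: F_pow_l) simp
  obtain m where m: "m \<in> S" "is_e (cc (int l - 1)) (\<Phi> m)" "pci (\<Phi> m)"
    "\<And>w. int l dvd fst w + snd w - int r \<Longrightarrow> int l dvd fst w - snd w - (int l - 1) \<Longrightarrow> block_of q r \<zeta> w = blk m"
    using ex_block[OF u(1) wu u(3) F] l3 by auto
  have "fst w - snd w - (int l - 1) = (fst w - snd w + 1) - int l" by simp
  then have "int l dvd fst w - snd w - (int l - 1)" using dvd_diff[OF w(2) dvd_refl] by (simp only:)
  then show ?thesis using that[OF m(1-3)] m(4)[of "bar l w"] w(1) unfolding bar_congruences by simp
qed

section \<open>Steinberg weights\<close>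

text \<open>The difference fst w - snd w = l - 1 + l (fst \<nu> - snd \<nu>) may be negative. With
  the absolute value of fst \<nu> - snd \<nu> instead, it becomes a highest weight n in the same
  class that occurs in the tensor power; the parity of n is right because \<bar>x - y\<bar> and x +
  y have the same parity.\<close>

lemma St_weights:
  assumes "w \<in> St l r"
  obtains n where "0 \<le> n" "n \<le> int r" "even (int r - n)" "int l dvd n + 1" "fst w + snd w = int r" "int l dvd fst w - snd w + 1"
proof -
  obtain \<mu> \<nu> k where w: "fst w + snd w = int r" "\<mu> \<in> P1D l" "\<nu> \<in> PD"
    "w = (fst \<mu> + int l * fst \<nu>, snd \<mu> + int l * snd \<nu>)" "fst w - snd w + 1 = k * int l"
    using assms unfolding St_def Gamma1_def by blast
  have \<mu>: "0 \<le> fst \<mu> - snd \<mu>" "fst \<mu> - snd \<mu> \<le> int l - 1" "0 \<le> snd \<mu>" and \<nu>: "0 \<le> fst \<nu>" "0 \<le> snd \<nu>"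
    using w(2,3) by (auto simp: P1D_def PD_def)
  have d: "int l dvd fst w - snd w + 1" using w(5) by simp
  have "fst w - snd w + 1 = (fst \<mu> - snd \<mu> + 1) + int l * (fst \<nu> - snd \<nu>)" using w(4) by (simp add: algebra_simps)
  then have "int l dvd (fst \<mu> - snd \<mu> + 1) + int l * (fst \<nu> - snd \<nu>)" using d by (simp only:)
  then have "int l dvd fst \<mu> - snd \<mu> + 1" by (subst (asm) dvd_add_left_iff) auto
  \<comment> \<open>A multiple of l between 1 and l.\<close>
  then have \<mu>l: "fst \<mu> - snd \<mu> + 1 = int l"
    using \<mu> zdvd_imp_le[of "int l" "fst \<mu> - snd \<mu> + 1"] by auto
  define n where "n = int l - 1 + int l * \<bar>fst \<nu> - snd \<nu>\<bar>"
  have r: "int r = 2 * snd \<mu> + (int l - 1) + int l * (fst \<nu> + snd \<nu>)"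
    using w(1,4) \<mu>l by (simp add: algebra_simps)
  have "int l * \<bar>fst \<nu> - snd \<nu>\<bar> \<le> int l * (fst \<nu> + snd \<nu>)"
    using \<nu> by (intro mult_left_mono) auto
  then have 1: "n \<le> int r" unfolding n_def r using \<mu>(3) by simp
  have 2: "0 \<le> n" unfolding n_def using l3 by simp
  have "int r - n = 2 * snd \<mu> + int l * (fst \<nu> + snd \<nu> - \<bar>fst \<nu> - snd \<nu>\<bar>)"
    unfolding r n_def by (simp add: algebra_simps)
  moreover have "even (fst \<nu> + snd \<nu> - \<bar>fst \<nu> - snd \<nu>\<bar>)" by presburger
  ultimately have 3: "even (int r - n)" by simp
  have "n + 1 = int l * (1 + \<bar>fst \<nu> - snd \<nu>\<bar>)" unfolding n_def by (simp add: algebra_simps)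
  then have 4: "int l dvd n + 1" by simp
  show ?thesis by (rule that[OF 2 1 3 4 w(1) d])
qed

text \<open>Divide snd w by l with remainder a and quotient b, and write n + 1 = l c. The restricted
  part (a + l - 1, a) absorbs the difference l - 1, and (b + c - 1, b) is left as the multiple of
  l.\<close>

lemma St_of_weight:
  assumes n: "0 \<le> n" "n \<le> int r" "even (int r - n)" "int l dvd n + 1"
  obtains w where "w \<in> St l r" "fst w + snd w = int r" "int l dvd fst w - snd w + 1"
proof -
  define w where "w = ((int r + n) div 2, (int r - n) div 2)"
  have w: "fst w + snd w = int r" "fst w - snd w = n" "0 \<le> snd w"
    using n(2,3) unfolding w_def fst_conv snd_conv by presburger+
  obtain c where c: "n + 1 = int l * c" using n(4) by blast
  have "0 < int l * c" using n(1) c by simp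
  then have c1: "1 \<le> c" using l3 by (simp add: zero_less_mult_iff)
  define b where "b = snd w div int l"
  define a where "a = snd w mod int l"
  have ab: "snd w = a + int l * b" "0 \<le> a" "a \<le> int l - 1" "0 \<le> b"
    using l3 w(3) by (auto simp: a_def b_def pos_imp_zdiv_nonneg_iff)
  have fw: "fst w = (a + int l - 1) + int l * (b + c - 1)"
    using w(2) c ab(1) by (simp add: algebra_simps)
  have "w \<in> Gamma1 l r" unfolding Gamma1_def
  proof (intro CollectI conjI bexI)
    show "fst w + snd w = int r" by (rule w)
    show "w = (fst (a + int l - 1, a) + int l * fst (b + c - 1, b), snd (a + int l - 1, a) + int l * snd (b + c - 1, b))"
      using fw ab(1) by (simp add: prod_eq_iff)
    show "(b + c - 1, b) \<in> PD" using ab c1 by (simp add: PD_def)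
    show "(a + int l - 1, a) \<in> P1D l" using ab l3 by (simp add: P1D_def PD_def)
  qed
  moreover have "fst w - snd w + 1 = c * int l" using w(2) c by (simp add: mult.commute)
  ultimately have "w \<in> St l r" unfolding St_def by blast
  then show ?thesis using that w n(4) by simp
qed

section \<open>The classification of the blocks\<close>

lemma block_cases:
  assumes "B \<in> blocks A"
  obtains m where "m \<in> S" "is_e (cc (int l - 1)) (\<Phi> m)" "pci (\<Phi> m)" "B = blk m"
  | m j where "m \<in> S" "small j" "j \<le> int r" "is_e (cc j) (\<Phi> m)" "pci (\<Phi> m)" "B = blk m"
  | m j where "m \<in> S" "large j" "is_e (cc j) (\<Phi> m)" "pci (\<Phi> m)" "B = blk m"
proof -
  obtain m where m: "B = blk m" "m \<in> S" "pci (\<Phi> m)" using assms unfolding blocks_eq primitive_iff by blast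
  obtain i where i: "0 \<le> i" "i < int l" "is_e (cc i) (\<Phi> m)" using pci_is_e[OF m(3)] e_pci by metis
  show ?thesis using i
  proof (cases rule: right_parity)
    case 1
    then show ?thesis using that(1) m i by blast
  next
    case (2 j)
    have "j \<le> int r" using occurs_small[OF 2(2)] 2(1) m(3) by (auto simp: small_def pci_def)
    then show ?thesis using that(2) m 2 by blast
  next
    case (3 j)
    then show ?thesis using that(3) m by blast
  qed
qed

lemma same_block:
  assumes "is_e c (\<Phi> m)" "is_e c (\<Phi> n)" "m \<in> S" "n \<in> S"
  shows "m = n"
  using is_e_uniq[OF assms(1,2)] \<Phi>_inj assms by blast

lemma large_not_semisimple:
  assumes "large j" "is_e (cc j) (\<Phi> m)" "pci (\<Phi> m)" "m \<in> S"
  shows "\<not> semisimple_ring (blk m)"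
proof -
  have "central_idempotent A m" using assms unfolding pci_def central_idempotent_iff by blast
  then show ?thesis using not_semisimple_blk[OF _ assms(2)] large_linking(1)[OF assms(1,2)] by blast
qed

lemma mem_I_set_iff: "w \<in> I_set l r \<longleftrightarrow>
    (\<exists>i. w = ((int r + i) div 2, (int r - i) div 2) \<and> small i \<and> i \<le> int r)"
  unfolding I_set_def small_def by auto

lemma mem_J_set_iff: "w \<in> J_set l r \<longleftrightarrow> (\<exists>i. w = ((int r + i) div 2, (int r - i) div 2) \<and> large i)"
  unfolding J_set_def large_def by auto

lemma semisimple_blocks:
  "block_of q r \<zeta> ` (bar l ` St l r \<union> bar l ` I_set l r) = {B \<in> blocks A. semisimple_ring B}"
proof (intro equalityI subsetI)
  fix B assume "B \<in> block_of q r \<zeta> ` (bar l ` St l r \<union> bar l ` I_set l r)"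
  then consider w where "w \<in> St l r" "B = block_of q r \<zeta> (bar l w)"
    | w where "w \<in> I_set l r" "B = block_of q r \<zeta> (bar l w)" by blast
  then show "B \<in> {B \<in> blocks A. semisimple_ring B}"
  proof cases
    case 1
    obtain n where n: "0 \<le> n" "n \<le> int r" "even (int r - n)" "int l dvd n + 1" "fst w + snd w = int r"
      "int l dvd fst w - snd w + 1" using St_weights[OF 1(1)] by blast
    obtain m where "m \<in> S" "is_e (cc (int l - 1)) (\<Phi> m)" "pci (\<Phi> m)" "block_of q r \<zeta> (bar l w) = blk m"
      using Steinberg_block[OF n] by blast
    then show ?thesis using 1(2) good_semisimple block_in_blocks by auto
  next
    case 2
    obtain i where i: "w = ((int r + i) div 2, (int r - i) div 2)" "small i" "i \<le> int r"
      using 2(1) unfolding mem_I_set_iff by blast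
    obtain m where "m \<in> S" "is_e (cc i) (\<Phi> m)" "pci (\<Phi> m)" "block_of q r \<zeta> (bar l w) = blk m"
      using small_or_large_block[of i] i by blast
    then show ?thesis using 2(2) good_semisimple i(2) block_in_blocks by auto
  qed
next
  fix B assume "B \<in> {B \<in> blocks A. semisimple_ring B}"
  then have B: "B \<in> blocks A" and ss: "semisimple_ring B" by auto
  show "B \<in> block_of q r \<zeta> ` (bar l ` St l r \<union> bar l ` I_set l r)"
    using B
  proof (cases rule: block_cases)
    case (1 m)
    have "\<Phi> m \<noteq> 0" using 1 by (auto simp: pci_def)
    then obtain n where n: "0 \<le> n" "n \<le> int r" "even (int r - n)" "int l dvd n + 1"
      using occurs_Steinberg[OF 1(2)] by blast
    obtain w where w: "w \<in> St l r" "fst w + snd w = int r" "int l dvd fst w - snd w + 1"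
      using St_of_weight[OF n] by blast
    obtain m' where m': "m' \<in> S" "is_e (cc (int l - 1)) (\<Phi> m')" "block_of q r \<zeta> (bar l w) = blk m'"
      using Steinberg_block[OF n w(2,3)] by blast
    then have "B = block_of q r \<zeta> (bar l w)" using same_block[OF 1(2) m'(2)] 1 by simp
    then show ?thesis using w(1) by blast
  next
    case (2 m j)
    obtain m' where m': "m' \<in> S" "is_e (cc j) (\<Phi> m')" "block_of q r \<zeta> (bar l ((int r + j) div 2, (int r - j) div 2)) = blk m'"
      using small_or_large_block[of j] 2 by blast
    then have "B = block_of q r \<zeta> (bar l ((int r + j) div 2, (int r - j) div 2))"
      using same_block[OF 2(4) m'(2)] 2 by simp
    moreover have "((int r + j) div 2, (int r - j) div 2) \<in> I_set l r" unfolding mem_I_set_iff using 2 by blast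
    ultimately show ?thesis by blast
  next
    case (3 m j)
    then show ?thesis using large_not_semisimple ss by blast
  qed
qed

lemma nonsemisimple_blocks:
  "block_of q r \<zeta> ` (bar l ` J_set l r) = {B \<in> blocks A. \<not> semisimple_ring B}"
proof (intro equalityI subsetI)
  fix B assume "B \<in> block_of q r \<zeta> ` (bar l ` J_set l r)"
  then obtain i where i: "B = block_of q r \<zeta> (bar l ((int r + i) div 2, (int r - i) div 2))" "large i"
    using mem_J_set_iff by auto
  obtain m where "m \<in> S" "is_e (cc i) (\<Phi> m)" "pci (\<Phi> m)"
      "block_of q r \<zeta> (bar l ((int r + i) div 2, (int r - i) div 2)) = blk m"
    using small_or_large_block[of i] i by blast
  then show "B \<in> {B \<in> blocks A. \<not> semisimple_ring B}"
    using i large_not_semisimple block_in_blocks by auto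
next
  fix B assume "B \<in> {B \<in> blocks A. \<not> semisimple_ring B}"
  then have B: "B \<in> blocks A" and ss: "\<not> semisimple_ring B" by auto
  show "B \<in> block_of q r \<zeta> ` (bar l ` J_set l r)"
    using B
  proof (cases rule: block_cases)
    case (1 m)
    then show ?thesis using ss good_semisimple by blast
  next
    case (2 m j)
    then show ?thesis using ss good_semisimple by blast
  next
    case (3 m j)
    obtain m' where m': "m' \<in> S" "is_e (cc j) (\<Phi> m')" "block_of q r \<zeta> (bar l ((int r + j) div 2, (int r - j) div 2)) = blk m'"
      using small_or_large_block[of j] 3 by blast
    then have "B = block_of q r \<zeta> (bar l ((int r + j) div 2, (int r - j) div 2))"
      using same_block[OF 3(3) m'(2)] 3 by simp
    moreover have "((int r + j) div 2, (int r - j) div 2) \<in> J_set l r" unfolding mem_J_set_iff using 3 by blast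
    ultimately show ?thesis by blast
  qed
qed

end

theorem proposition4p6:
  fixes \<epsilon> :: "'k :: field" and l r :: nat and \<zeta> :: "'k tr set \<Rightarrow> 'k mat"
  assumes "3 \<le> l" and "odd l" and "1 \<le> r"
    and "primitive_root l \<epsilon>"
    and "is_zeta \<epsilon> r \<zeta>"
  shows "(r < l \<longrightarrow> semisimple_ring (little_q_schur \<epsilon> r \<zeta>)) \<and>
    block_of \<epsilon> r \<zeta> ` (bar l ` St l r \<union> bar l ` I_set l r) =
      {B \<in> blocks (little_q_schur \<epsilon> r \<zeta>). semisimple_ring B} \<and>
    (l \<le> r \<longrightarrow>
      block_of \<epsilon> r \<zeta> ` (bar l ` J_set l r) =
        {B \<in> blocks (little_q_schur \<epsilon> r \<zeta>). \<not> semisimple_ring B})"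
proof -
  interpret schur_rep \<epsilon> l r \<zeta>
    using assms by unfold_locales
  show ?thesis
    using semisimple_of_less semisimple_blocks nonsemisimple_blocks by blast
qed

end
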